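(* Let $\mathbb{B}$ be a Banach space with $\dim\mathbb{B}>1$ and let $C\subset\mathbb{B}$ be closed, convex and bounded with $0\in\mathrm{int}(C)$. Let $T\in\mathbf{M}_1(C)$ and suppose that $\|T\|$ is inner regular by compact sets. Then, for any $\varepsilon>0$, there exist a normal $1$-current $N\in\mathbf{N}_1(C)$ and a Borel set $B\subset\mathbb{B}$ such that (i) $\partial N=0$; (ii) $\mathbb{M}(N)\le(2+\varepsilon)\,\mathbb{M}(T)$; (iii) $N|_B=T$. Moreover, if the support of $T$ is contained in an affine hyperplane, then one can take $B=\mathrm{supp}(T)$.
   Context: Metric currents (Ambrosio–Kirchheim) on a complete metric space $X$ (here $X=C$ with the norm distance). $\mathrm{LIP}(f)$ is the global Lipschitz constant; $\mathrm{Lip}(X)$ the real Lipschitz functions, $\mathrm{Lip}_b(X)$ the bounded ones. A metric $1$-current on $X$ is a bilinear map $T\colon \mathrm{Lip}_b(X)\times \mathrm{Lip}(X)\to\mathbb{R}$ such that: (locality) $T(f,\pi)=0$ if $\pi$ is constant on a neighbourhood of $\{f\neq0\}$; (joint continuity) $T(f,\pi^n)\to T(f,\pi)$ whenever $\pi^n\to\pi$ pointwise and $\sup_n\mathrm{LIP}(\pi^n)<\infty$; (finite mass) there is a finite nonnegative Borel measure $\mu$ with $|T(f,\pi)|\le \mathrm{LIP}(\pi)\int|f|\,d\mu$ for all $(f,\pi)$. The minimal such $\mu$ is the mass measure $\|T\|$, and $\mathbb{M}(T):=\|T\|(X)$. $T$ extends uniquely to bounded Borel functions $f$ in the first argument,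 with the same mass bound. $\mathbf{M}_1(X)$ is the space of metric $1$-currents. The boundary is $\partial T(f):=T(1,f)$; $T$ is normal if $\partial T$ has finite mass (there is a finite Borel measure $\nu$ with $|\partial T(f)|\le\int|f|\,d\nu$ for all $f\in\mathrm{Lip}_b(X)$), and $\mathbf{N}_1(X)$ is the space of normal $1$-currents. The restriction to a Borel set $B$ is $T|_B(f,\pi):=T(\chi_Bf,\pi)$. $\mathrm{supp}(T)$ is the support of the measure $\|T\|$. An affine hyperplane of $\mathbb{B}$ is a level set of a nonzero continuous linear functional. *)

theory Defs
  imports "HOL-Analysis.Analysis"
begin

text \<open>
  The metric space is a subset \<open>X\<close> of a metric type with the induced distance. Functions on \<open>X\<close> are
  represented by functions on the whole type of which only the values on \<open>X\<close> matter; see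
  \<open>metric_1_current_cong\<close> below for why a current is a well-defined functional of the restrictions.
\<close>

definition Lip :: "'a::metric_space set \<Rightarrow> ('a \<Rightarrow> real) set"
  where "Lip X = {f. \<exists>L. L-lipschitz_on X f}"

definition Lip\<^sub>b :: "'a::metric_space set \<Rightarrow> ('a \<Rightarrow> real) set"
  where "Lip\<^sub>b X = {f \<in> Lip X. bounded (f ` X)}"

definition LIP :: "'a::metric_space set \<Rightarrow> ('a \<Rightarrow> real) \<Rightarrow> real"
  where "LIP X f = Inf {L. L-lipschitz_on X f}"

definition bounded_Borel :: "'a::metric_space set \<Rightarrow> ('a \<Rightarrow> real) set"
  where "bounded_Borel X = {f \<in> borel_measurable (restrict_space borel X). bounded (f ` X)}"

text \<open>A functional is total in HOL; it is only ever evaluated at arguments in the indicated classes.\<close>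

type_synonym 'a functional = "('a \<Rightarrow> real) \<Rightarrow> ('a \<Rightarrow> real) \<Rightarrow> real"

definition bilinear_on :: "('a \<Rightarrow> real) set \<Rightarrow> ('a \<Rightarrow> real) set \<Rightarrow> 'a functional \<Rightarrow> bool"
  where "bilinear_on F P T \<longleftrightarrow>
    (\<forall>f\<in>F. \<forall>g\<in>F. \<forall>p\<in>P. \<forall>a b. T (\<lambda>x. a * f x + b * g x) p = a * T f p + b * T g p) \<and>
    (\<forall>f\<in>F. \<forall>p\<in>P. \<forall>q\<in>P. \<forall>a b. T f (\<lambda>x. a * p x + b * q x) = a * T f p + b * T f q)"

definition current_locality :: "'a::metric_space set \<Rightarrow> 'a functional \<Rightarrow> bool"
  where "current_locality X T \<longleftrightarrow>
    (\<forall>f\<in>Lip\<^sub>b X. \<forall>p\<in>Lip X.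
      (\<exists>U. openin (top_of_set X) U \<and> {x\<in>X. f x \<noteq> 0} \<subseteq> U \<and> p constant_on U) \<longrightarrow> T f p = 0)"

definition current_joint_continuity :: "'a::metric_space set \<Rightarrow> 'a functional \<Rightarrow> bool"
  where "current_joint_continuity X T \<longleftrightarrow>
    (\<forall>f\<in>Lip\<^sub>b X. \<forall>p\<in>Lip X. \<forall>pn :: nat \<Rightarrow> 'a \<Rightarrow> real.
      (\<forall>n. pn n \<in> Lip X) \<longrightarrow> (\<forall>x\<in>X. (\<lambda>n. pn n x) \<longlonglongrightarrow> p x) \<longrightarrow>
      bdd_above (range (\<lambda>n. LIP X (pn n))) \<longrightarrow> (\<lambda>n. T f (pn n)) \<longlonglongrightarrow> T f p)"

definition finite_Borel_measure :: "'a::metric_space set \<Rightarrow> 'a measure \<Rightarrow> bool"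
  where "finite_Borel_measure X \<mu> \<longleftrightarrow> finite_measure \<mu> \<and> sets \<mu> = sets (restrict_space borel X)"

definition mass_bound ::
    "'a::metric_space set \<Rightarrow> ('a \<Rightarrow> real) set \<Rightarrow> 'a functional \<Rightarrow> 'a measure \<Rightarrow> bool"
  where "mass_bound X F T \<mu> \<longleftrightarrow> finite_Borel_measure X \<mu> \<and>
    (\<forall>f\<in>F. \<forall>p\<in>Lip X. \<bar>T f p\<bar> \<le> LIP X p * (\<integral>x. \<bar>f x\<bar> \<partial>\<mu>))"

definition metric_1_current :: "'a::metric_space set \<Rightarrow> 'a functional \<Rightarrow> bool"
  where "metric_1_current X T \<longleftrightarrow>
    bilinear_on (Lip\<^sub>b X) (Lip X) T \<and> current_locality X T \<and> current_joint_continuity X T \<and>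
    (\<exists>\<mu>. mass_bound X (Lip\<^sub>b X) T \<mu>)"

definition mass_measure :: "'a::metric_space set \<Rightarrow> 'a functional \<Rightarrow> 'a measure"
  where "mass_measure X T = (THE \<mu>. mass_bound X (Lip\<^sub>b X) T \<mu> \<and>
    (\<forall>\<nu>. mass_bound X (Lip\<^sub>b X) T \<nu> \<longrightarrow>
      (\<forall>A\<in>sets (restrict_space borel X). emeasure \<mu> A \<le> emeasure \<nu> A)))"

definition mass :: "'a::metric_space set \<Rightarrow> 'a functional \<Rightarrow> real"
  where "mass X T = measure (mass_measure X T) X"

definition current_supp :: "'a::metric_space set \<Rightarrow> 'a functional \<Rightarrow> 'a set"
  where "current_supp X T =
    {x\<in>X. \<forall>U. openin (top_of_set X) U \<longrightarrow> x \<in> U \<longrightarrow> 0 < emeasure (mass_measure X T) U}"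

text \<open>
  The values of the extension at bounded Borel \<open>f\<close> and Lipschitz \<open>p\<close> are uniquely determined;
  the choice operator only affects the irrelevant values at other arguments.
\<close>

definition Borel_extension :: "'a::metric_space set \<Rightarrow> 'a functional \<Rightarrow> 'a functional"
  where "Borel_extension X T = (SOME S.
    bilinear_on (bounded_Borel X) (Lip X) S \<and>
    (\<forall>f\<in>Lip\<^sub>b X. \<forall>p\<in>Lip X. S f p = T f p) \<and>
    mass_bound X (bounded_Borel X) S (mass_measure X T))"

definition current_restrict :: "'a::metric_space set \<Rightarrow> 'a functional \<Rightarrow> 'a set \<Rightarrow> 'a functional"
  where "current_restrict X T B f p = Borel_extension X T (\<lambda>x. indicator B x * f x) p"

definition current_eq :: "'a::metric_space set \<Rightarrow> 'a functional \<Rightarrow> 'a functional \<Rightarrow> bool"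
  where "current_eq X S T \<longleftrightarrow> (\<forall>f\<in>Lip\<^sub>b X. \<forall>p\<in>Lip X. S f p = T f p)"

definition boundary :: "'a functional \<Rightarrow> ('a \<Rightarrow> real) \<Rightarrow> real"
  where "boundary T f = T (\<lambda>_. 1) f"

definition normal_1_current :: "'a::metric_space set \<Rightarrow> 'a functional \<Rightarrow> bool"
  where "normal_1_current X T \<longleftrightarrow> metric_1_current X T \<and>
    (\<exists>\<nu>. finite_Borel_measure X \<nu> \<and> (\<forall>f\<in>Lip\<^sub>b X. \<bar>boundary T f\<bar> \<le> (\<integral>x. \<bar>f x\<bar> \<partial>\<nu>)))"

definition inner_regular_by_compacts :: "'a::topological_space measure \<Rightarrow> bool"
  where "inner_regular_by_compacts \<mu> \<longleftrightarrow>
    (\<forall>A\<in>sets \<mu>. emeasure \<mu> A = (SUP K\<in>{K. K \<subseteq> A \<and> compact K}. emeasure \<mu> K))"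

definition affine_hyperplane :: "'a::real_normed_vector set \<Rightarrow> bool"
  where "affine_hyperplane H \<longleftrightarrow>
    (\<exists>(\<phi> :: 'a \<Rightarrow> real) c. bounded_linear \<phi> \<and> \<phi> \<noteq> (\<lambda>_. 0) \<and> H = {x. \<phi> x = c})"

lemma metric_1_current_cong:
  assumes T: "metric_1_current X T"
    and fg: "f \<in> Lip\<^sub>b X" "g \<in> Lip\<^sub>b X" "\<And>x. x \<in> X \<Longrightarrow> f x = g x"
    and pq: "p \<in> Lip X" "q \<in> Lip X" "\<And>x. x \<in> X \<Longrightarrow> p x = q x"
  shows "T f p = T g q"
proof -
  obtain \<mu> where \<mu>: "mass_bound X (Lip\<^sub>b X) T \<mu>" and bil: "bilinear_on (Lip\<^sub>b X) (Lip X) T"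
    using T by (auto simp: metric_1_current_def)
  have space: "space \<mu> = X"
    using \<mu> sets_eq_imp_space_eq[of \<mu> "restrict_space borel X"]
    by (auto simp: mass_bound_def finite_Borel_measure_def space_restrict_space)
  have zero: "0-lipschitz_on X (\<lambda>x. h x - k x)" if "\<And>x. x \<in> X \<Longrightarrow> h x = k x" for h k :: "'a \<Rightarrow> real"
    using that by (auto simp: lipschitz_on_def)
  have "LIP X (\<lambda>x. p x - q x) = 0"
    unfolding LIP_def by (rule cInf_eq_minimum) (use zero[of p q] pq(3) in \<open>auto simp: lipschitz_on_def\<close>)
  moreover have "(\<lambda>x. p x - q x) \<in> Lip X"
    using zero[of p q] pq(3) by (auto simp: Lip_def)
  ultimately have "T g (\<lambda>x. p x - q x) = 0"
    using \<mu> fg(2) by (force simp: mass_bound_def)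
  moreover have "T g (\<lambda>x. 1 * p x + (-1) * q x) = 1 * T g p + (-1) * T g q"
    using bil fg(2) pq(1,2) unfolding bilinear_on_def by blast
  ultimately have 1: "T g p = T g q" by simp
  have fg': "(\<lambda>x. f x - g x) \<in> Lip\<^sub>b X"
    using zero[of f g] fg(3) by (auto simp: Lip\<^sub>b_def Lip_def bounded_iff)
  have "(\<integral>x. \<bar>f x - g x\<bar> \<partial>\<mu>) = (\<integral>x. 0 \<partial>\<mu>)"
    by (rule Bochner_Integration.integral_cong) (use fg(3) space in auto)
  then have "T (\<lambda>x. f x - g x) p = 0"
    using \<mu> fg' pq(1) by (force simp: mass_bound_def)
  moreover have "T (\<lambda>x. 1 * f x + (-1) * g x) p = 1 * T f p + (-1) * T g p"
    using bil fg(1,2) pq(1) unfolding bilinear_on_def by blast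
  ultimately show ?thesis using 1 by simp
qed

end

theory Submission
  imports Defs
begin

text \<open>
  By locality and tightness, the boundary \<open>\<partial>T\<close> is a functional on Lipschitz functions that is
  determined, up to a small error, by the values at finitely many points. A finite-dimensional
  Hahn-Banach argument then writes \<open>-\<partial>T = \<Sum>\<^sub>i a\<^sub>i (\<delta>(y\<^sub>i) - \<delta>(x\<^sub>i))\<close> with
  \<open>\<Sum>\<^sub>i \<bar>a\<^sub>i\<bar> \<parallel>x\<^sub>i - y\<^sub>i\<parallel> \<le> (1 + \<epsilon>) M(T)\<close>. Joining \<open>x\<^sub>i\<close> to \<open>y\<^sub>i\<close> by a nearly shortest curve
  gives a current \<open>R\<close> of mass at most \<open>(1 + \<epsilon>) M(T)\<close> with \<open>\<partial>R = -\<partial>T\<close>, and \<open>N = T + R\<close>. As the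
  dimension exceeds one, there are uncountably many such curves, disjoint up to their end points, so they can be
  chosen null for \<open>\<parallel>T\<parallel>\<close> and transversal to a given hyperplane; hence \<open>R\<close> and \<open>T\<close> are mutually
  singular.
\<close>

section \<open>Lipschitz functions and finite Borel measures\<close>

text \<open>Finitely many point evaluations give the boundary only up to an error, so filling the
  approximate boundary leaves a residual functional, and the filling has to be iterated: a residual
  of norm \<open>b n\<close> is filled at mass at most \<open>b n + \<eta> n\<close>, leaving one of
  norm \<open>\<eta> n\<close>. With M the mass of T and \<eta> geometric of sum M\<epsilon>/2, all
  fillings together cost at most M + M\<epsilon>, and T itself adds M; this is the constant 2 +
  \<epsilon>. Each residual must again be finitely determined, so this is stated for functionals,
  not for T. Compact inner regularity enters twice: it supplies the finite nets behind finite
  determination, and it makes the support carry the mass measure although the space may be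
  nonseparable. Convexity and the ball about 0 give room for the detours: the midpoint of a segment
  is pulled slightly towards 0 and shifted in a fixed direction, which stays inside C even when the
  end points lie on its boundary. Sums of currents are controlled by arbitrary dominating measures,
  which simply add up, and only afterwards compared with the minimal one.\<close>

lemma Lip_lipschitz_on: "f \<in> Lip X \<Longrightarrow> (LIP X f)-lipschitz_on X f"
proof -
  assume "f \<in> Lip X"
  then obtain L where L: "L-lipschitz_on X f" by (auto simp: Lip_def)
  let ?S = "{L. L-lipschitz_on X f}"
  have bdd: "bdd_below ?S" by (auto intro!: bdd_belowI[of _ 0] lipschitz_on_nonneg)
  show ?thesis
  proof (rule lipschitz_onI)
    show "0 \<le> LIP X f" unfolding LIP_def
      using L by (intro cInf_greatest) (auto intro: lipschitz_on_nonneg)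
    fix x y assume xy: "x \<in> X" "y \<in> X"
    show "dist (f x) (f y) \<le> LIP X f * dist x y"
    proof (cases "dist x y = 0")
      case False
      then have "0 < dist x y" by simp
      \<comment> \<open>The difference quotient bounds every admissible constant from below, hence
        also their infimum; so the infimum is itself admissible.\<close>
      have "dist (f x) (f y) / dist x y \<le> Inf ?S"
      proof (rule cInf_greatest)
        show "?S \<noteq> {}" using L by auto
        fix K assume "K \<in> ?S"
        then show "dist (f x) (f y) / dist x y \<le> K"
          using lipschitz_onD[of K X f x y] xy \<open>0 < dist x y\<close> by (simp add: divide_simps)
      qed
      then show ?thesis using \<open>0 < dist x y\<close> by (simp add: LIP_def divide_simps)
    qed simp
  qed
qed

lemma LIP_nonneg: "f \<in> Lip X \<Longrightarrow> 0 \<le> LIP X f"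
  using Lip_lipschitz_on lipschitz_on_nonneg by blast

lemma LIP_le: "L-lipschitz_on X f \<Longrightarrow> LIP X f \<le> L"
  unfolding LIP_def by (rule cInf_lower) (auto intro!: bdd_belowI[of _ 0] lipschitz_on_nonneg)

lemma LipI: "L-lipschitz_on X f \<Longrightarrow> f \<in> Lip X"
  by (auto simp: Lip_def)

lemma Lip\<^sub>b_I: "L-lipschitz_on X f \<Longrightarrow> (\<And>x. x \<in> X \<Longrightarrow> \<bar>f x\<bar> \<le> B) \<Longrightarrow> f \<in> Lip\<^sub>b X"
  by (auto simp: Lip\<^sub>b_def Lip_def bounded_iff)

lemma Lip\<^sub>b_E:
  assumes "f \<in> Lip\<^sub>b X"
  obtains L B where "L-lipschitz_on X f" "0 \<le> B" "\<And>x. x \<in> X \<Longrightarrow> \<bar>f x\<bar> \<le> B"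
proof -
  obtain B where "\<forall>x\<in>X. \<bar>f x\<bar> \<le> B" using assms by (auto simp: Lip\<^sub>b_def bounded_iff)
  moreover obtain L where "L-lipschitz_on X f" using assms by (auto simp: Lip\<^sub>b_def Lip_def)
  ultimately show ?thesis by (intro that[of L "max B 0"]) force+
qed

lemma Lip_lin: "p \<in> Lip X \<Longrightarrow> q \<in> Lip X \<Longrightarrow> (\<lambda>x. a * p x + b * q x) \<in> Lip X"
  unfolding Lip_def mem_Collect_eq by (metis lipschitz_on_add lipschitz_on_cmult_real)

lemma Lip\<^sub>b_lin:
  assumes "f \<in> Lip\<^sub>b X" "g \<in> Lip\<^sub>b X"
  shows "(\<lambda>x. a * f x + b * g x) \<in> Lip\<^sub>b X"
proof -
  obtain L B where f: "L-lipschitz_on X f" "0 \<le> B" "\<And>x. x \<in> X \<Longrightarrow> \<bar>f x\<bar> \<le> B"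
    using Lip\<^sub>b_E[OF assms(1)] by blast
  obtain M D where g: "M-lipschitz_on X g" "0 \<le> D" "\<And>x. x \<in> X \<Longrightarrow> \<bar>g x\<bar> \<le> D"
    using Lip\<^sub>b_E[OF assms(2)] by blast
  show ?thesis
  proof (rule Lip\<^sub>b_I)
    show "(\<bar>a\<bar> * L + \<bar>b\<bar> * M)-lipschitz_on X (\<lambda>x. a * f x + b * g x)"
      by (intro lipschitz_intros f g)
    show "\<bar>a * f x + b * g x\<bar> \<le> \<bar>a\<bar> * B + \<bar>b\<bar> * D" if "x \<in> X" for x
      by (rule order_trans[OF abs_triangle_ineq])
        (auto simp: abs_mult intro!: add_mono mult_left_mono f g that)
  qed
qed

lemma lipschitz_on_mult_bounded:
  fixes f g :: "'a::metric_space \<Rightarrow> real"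
  assumes f: "L-lipschitz_on X f" "0 \<le> B" "\<And>x. x \<in> X \<Longrightarrow> \<bar>f x\<bar> \<le> B"
    and g: "M-lipschitz_on X g" "0 \<le> D" "\<And>x. x \<in> X \<Longrightarrow> \<bar>g x\<bar> \<le> D"
  shows "(B * M + D * L)-lipschitz_on X (\<lambda>x. f x * g x)"
proof (rule lipschitz_onI)
  show "0 \<le> B * M + D * L"
    using assms lipschitz_on_nonneg[OF f(1)] lipschitz_on_nonneg[OF g(1)] by simp
  fix x y assume xy: "x \<in> X" "y \<in> X"
  have "f x * g x - f y * g y = f x * (g x - g y) + (f x - f y) * g y"
    by (simp add: algebra_simps)
  then have "\<bar>f x * g x - f y * g y\<bar> \<le> \<bar>f x\<bar> * \<bar>g x - g y\<bar> + \<bar>f x - f y\<bar> * \<bar>g y\<bar>"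
    by (metis abs_mult abs_triangle_ineq)
  also have "\<dots> \<le> B * (M * dist x y) + (L * dist x y) * D"
    using lipschitz_onD[OF f(1) xy] lipschitz_onD[OF g(1) xy] f(2,3) g(2,3) xy lipschitz_on_nonneg[OF f(1)]
    by (intro add_mono mult_mono) (auto simp: dist_real_def)
  finally show "dist (f x * g x) (f y * g y) \<le> (B * M + D * L) * dist x y"
    by (simp add: dist_real_def algebra_simps)
qed

lemma Lip\<^sub>b_mult:
  assumes "f \<in> Lip\<^sub>b X" "g \<in> Lip\<^sub>b X"
  shows "(\<lambda>x. f x * g x) \<in> Lip\<^sub>b X"
proof -
  obtain L B where f: "L-lipschitz_on X f" "0 \<le> B" "\<And>x. x \<in> X \<Longrightarrow> \<bar>f x\<bar> \<le> B"
    using Lip\<^sub>b_E[OF assms(1)] by blast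
  obtain M D where g: "M-lipschitz_on X g" "0 \<le> D" "\<And>x. x \<in> X \<Longrightarrow> \<bar>g x\<bar> \<le> D"
    using Lip\<^sub>b_E[OF assms(2)] by blast
  show ?thesis
    by (rule Lip\<^sub>b_I[OF lipschitz_on_mult_bounded[OF f g], of "B * D"])
      (auto simp: abs_mult intro!: mult_mono f g)
qed

lemma Lip\<^sub>b_const [simp]: "(\<lambda>_. c) \<in> Lip\<^sub>b X"
  by (rule Lip\<^sub>b_I[OF lipschitz_on_constant order_refl])

lemma Lip\<^sub>b_imp_Lip: "f \<in> Lip\<^sub>b X \<Longrightarrow> f \<in> Lip X"
  by (simp add: Lip\<^sub>b_def)

lemma Lip\<^sub>b_imp_bounded_Borel: "f \<in> Lip\<^sub>b X \<Longrightarrow> f \<in> bounded_Borel X"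
  using lipschitz_on_continuous_on
  by (auto simp: Lip\<^sub>b_def Lip_def bounded_Borel_def intro!: borel_measurable_continuous_on_restrict)

lemma bounded_Borel_lin:
  assumes "f \<in> bounded_Borel X" "g \<in> bounded_Borel X"
  shows "(\<lambda>x. a * f x + b * g x) \<in> bounded_Borel X"
proof -
  obtain B D where "\<forall>x\<in>X. \<bar>f x\<bar> \<le> B" "\<forall>x\<in>X. \<bar>g x\<bar> \<le> D"
    using assms by (auto simp: bounded_Borel_def bounded_iff)
  then have "\<forall>x\<in>X. \<bar>a * f x + b * g x\<bar> \<le> \<bar>a\<bar> * B + \<bar>b\<bar> * D"
    by (intro ballI order_trans[OF abs_triangle_ineq]) (auto simp: abs_mult intro!: add_mono mult_left_mono)
  then show ?thesis using assms by (auto simp: bounded_Borel_def bounded_iff)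
qed

lemma bounded_Borel_indicator_mult:
  assumes "B \<in> sets borel" "f \<in> bounded_Borel X"
  shows "(\<lambda>x. indicator B x * f x) \<in> bounded_Borel X"
proof -
  have "(indicator B :: 'a \<Rightarrow> real) \<in> borel_measurable (restrict_space borel X)"
    using assms(1) by (simp add: measurable_restrict_space1)
  moreover obtain D where "\<forall>x\<in>X. \<bar>f x\<bar> \<le> D"
    using assms by (auto simp: bounded_Borel_def bounded_iff)
  then have "\<forall>x\<in>X. \<bar>indicator B x * f x\<bar> \<le> D" 
    by (auto simp: indicator_def intro: order_trans[OF abs_ge_zero])
  ultimately show ?thesis using assms by (auto simp: bounded_Borel_def bounded_iff)
qed

section \<open>Density of bounded Lipschitz functions in L1 of a finite Borel measure\<close>

context
  fixes X :: "'a::metric_space set" and \<mu> :: "'a measure"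
  assumes fin: "finite_Borel_measure X \<mu>"
begin

lemma finite_Borel_sets: "sets \<mu> = sets (restrict_space borel X)"
  using fin by (simp add: finite_Borel_measure_def)

lemma finite_Borel_space: "space \<mu> = X"
  using sets_eq_imp_space_eq[OF finite_Borel_sets] by (simp add: space_restrict_space)

lemma finite_Borel_finite_measure: "finite_measure \<mu>"
  using fin by (simp add: finite_Borel_measure_def)

lemma finite_Borel_measurable:
  "f \<in> borel_measurable \<mu> \<longleftrightarrow> f \<in> borel_measurable (restrict_space borel X)"
  by (intro measurable_cong_sets[THEN eqset_imp_iff] finite_Borel_sets refl)

lemma finite_Borel_Int: "B \<in> sets borel \<Longrightarrow> X \<inter> B \<in> sets \<mu>"
  by (auto simp: finite_Borel_sets sets_restrict_space)

lemma bounded_Borel_integrable: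
  assumes "f \<in> bounded_Borel X"
  shows "integrable \<mu> f"
proof -
  interpret finite_measure \<mu> by (rule finite_Borel_finite_measure)
  obtain D where "\<forall>x\<in>X. \<bar>f x\<bar> \<le> D"
    using assms by (auto simp: bounded_Borel_def bounded_iff)
  then show ?thesis
    using assms by (intro integrable_const_bound[of _ D])
      (auto simp: finite_Borel_space finite_Borel_measurable bounded_Borel_def)
qed

lemma integrable_diff_Lip\<^sub>b:
  "integrable \<mu> f \<Longrightarrow> g \<in> Lip\<^sub>b X \<Longrightarrow> integrable \<mu> (\<lambda>x. \<bar>g x - f x\<bar>)"
  using bounded_Borel_integrable[OF Lip\<^sub>b_imp_bounded_Borel] by simp

text \<open>The tents \<open>max 0 (1 - n * infdist x K)\<close> decrease to the indicator of
  \<open>K\<close>, because off a closed set the distance is positive; dominated convergence does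
  the rest.\<close>

lemma closed_approx_Lip:
  assumes K: "closed K" and e: "0 < e"
  shows "\<exists>g\<in>Lip\<^sub>b X. range g \<subseteq> {0..1} \<and> (\<integral>x. \<bar>g x - indicator K x\<bar> \<partial>\<mu>) < e"
\<comment> \<open>For empty \<open>K\<close> the convention \<open>infdist x {} = 0\<close> would
  turn every tent into the constant 1.\<close>
proof (cases "K = {}")
  case True
  then show ?thesis using e by (intro bexI[of _ "\<lambda>_. 0"]) auto
next
  case False
  interpret finite_measure \<mu> by (rule finite_Borel_finite_measure)
  define g where "g n x = max 0 (1 - real n * infdist x K)" for n :: nat and x
  have gL: "(real n)-lipschitz_on X (g n)" for n
  proof (rule lipschitz_onI)
    fix x y assume "x \<in> X" "y \<in> X"
    have "\<bar>infdist x K - infdist y K\<bar> \<le> dist x y"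
      using infdist_triangle_abs[of x K y] by simp
    then have "real n * \<bar>infdist x K - infdist y K\<bar> \<le> real n * dist x y"
      by (intro mult_left_mono) auto
    then have "\<bar>real n * infdist x K - real n * infdist y K\<bar> \<le> real n * dist x y"
      by (metis abs_mult abs_of_nat right_diff_distrib)
    then show "dist (g n x) (g n y) \<le> real n * dist x y"
      unfolding g_def dist_real_def by linarith
  qed simp
  have g01: "0 \<le> g n x" "g n x \<le> 1" for n x
    by (auto simp: g_def infdist_nonneg)
  have gLb: "g n \<in> Lip\<^sub>b X" for n
    using g01 by (intro Lip\<^sub>b_I[OF gL, of _ 1]) auto
  have Kb: "(indicator K :: 'a \<Rightarrow> real) \<in> borel_measurable (restrict_space borel X)"
    using K by (simp add: measurable_restrict_space1)
  have lim: "(\<lambda>n. \<integral>x. \<bar>g n x - indicator K x\<bar> \<partial>\<mu>) \<longlonglongrightarrow> (\<integral>x. 0 \<partial>\<mu>)"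
  proof (rule integral_dominated_convergence[where w = "\<lambda>_. 1"])
    fix n
    show "(\<lambda>x. \<bar>g n x - indicator K x\<bar>) \<in> borel_measurable \<mu>"
      using Lip\<^sub>b_imp_bounded_Borel[OF gLb[of n]] Kb
      by (auto simp: finite_Borel_measurable bounded_Borel_def)
    show "AE x in \<mu>. norm \<bar>g n x - indicator K x\<bar> \<le> 1"
      using g01[of n] by (auto simp: indicator_def abs_le_iff intro!: AE_I2) 
        (smt (verit) g01)+
  next
    show "AE x in \<mu>. (\<lambda>n. \<bar>g n x - indicator K x\<bar>) \<longlonglongrightarrow> 0"
    proof (rule AE_I2)
      fix x
      show "(\<lambda>n. \<bar>g n x - indicator K x\<bar>) \<longlonglongrightarrow> 0"
      proof (cases "x \<in> K")
        case True
        then show ?thesis by (simp add: g_def)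
      next
        case False
        then have d: "0 < infdist x K"
          using K \<open>K \<noteq> {}\<close> infdist_pos_not_in_closed by blast
        have "\<forall>\<^sub>F n in sequentially. \<bar>g n x - indicator K x\<bar> = 0"
        proof (rule eventually_sequentiallyI[of "nat \<lceil>1 / infdist x K\<rceil>"])
          fix n assume "nat \<lceil>1 / infdist x K\<rceil> \<le> n"
          then have "1 / infdist x K \<le> real n" by linarith
          then have "1 \<le> real n * infdist x K" using d by (simp add: divide_simps)
          then show "\<bar>g n x - indicator K x\<bar> = 0" using False by (simp add: g_def)
        qed
        then show ?thesis by (rule tendsto_eventually)
      qed
    qed
  qed (auto simp: finite_Borel_measurable)
  then obtain n where "(\<integral>x. \<bar>g n x - indicator K x\<bar> \<partial>\<mu>) < e"
    using e order_tendstoD(2)[OF lim, of e] by (auto simp: eventually_sequentially)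
  then show ?thesis using gLb g01 by (intro bexI[of _ "g n"]) auto
qed

text \<open>Induction over the sigma-algebra generated by the closed sets, which are stable under
  intersection. Values in the unit interval are kept so that g and 1 - g can serve as a partition of
  unity in \<open>current_with_cut\<close>.\<close>

lemma Borel_approx_Lip:
  assumes A: "A \<in> sets borel" and e: "0 < e"
  shows "\<exists>g\<in>Lip\<^sub>b X. range g \<subseteq> {0..1} \<and> (\<integral>x. \<bar>g x - indicator A x\<bar> \<partial>\<mu>) < e"
proof -
  interpret finite_measure \<mu> by (rule finite_Borel_finite_measure)
  have "Int_stable (Collect closed :: 'a set set)" by (auto simp: Int_stable_def)
  moreover have "Collect closed \<subseteq> Pow (UNIV :: 'a set)" by simp
  moreover have "A \<in> sigma_sets UNIV (Collect closed)"
    using A unfolding borel_eq_closed by (simp add: sets_measure_of)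
  ultimately show ?thesis using e
  proof (induction A arbitrary: e rule: sigma_sets_induct_disjoint)
    case (basic A)
    then show ?case using closed_approx_Lip by simp
  next
    case empty
    then show ?case by (intro bexI[of _ "\<lambda>_. 0"]) auto
  next
    case (compl A)
    then obtain g where g: "g\<in>Lip\<^sub>b X" "range g \<subseteq> {0..1}" "(\<integral>x. \<bar>g x - indicator A x\<bar> \<partial>\<mu>) < e" by blast
    have "(\<lambda>x. 1 - g x) \<in> Lip\<^sub>b X" using Lip\<^sub>b_lin[OF Lip\<^sub>b_const[of 1] g(1), of 1 "-1"] by simp
    moreover have "\<bar>1 - g x - indicator (UNIV - A) x\<bar> = \<bar>g x - indicator A x\<bar>" for x
      by (auto simp: indicator_def)
    ultimately show ?case using g by (intro bexI[of _ "\<lambda>x. 1 - g x"]) auto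
  next
    case (union A)
    have Ab: "A i \<in> sets borel" for i
      using union(2) unfolding borel_eq_closed by (auto simp: sets_measure_of)
    have int: "integrable \<mu> (\<lambda>x. indicator B x :: real)" if "B \<in> sets borel" for B
      using bounded_Borel_indicator_mult[OF that Lip\<^sub>b_imp_bounded_Borel[OF Lip\<^sub>b_const[of 1]]]
      by (intro bounded_Borel_integrable) simp
    have lim: "(\<lambda>n. \<integral>x. \<bar>indicator (\<Union>i<n. A i) x - indicator (\<Union>i. A i) x\<bar> \<partial>\<mu>) \<longlonglongrightarrow> (\<integral>x. 0 \<partial>\<mu> :: real)"
    proof (rule integral_dominated_convergence[where w = "\<lambda>_. 1"])
      fix n
      show "(\<lambda>x. \<bar>indicator (\<Union>i<n. A i) x - indicator (\<Union>i. A i) x\<bar> :: real) \<in> borel_measurable \<mu>"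
        by (intro borel_measurable_abs borel_measurable_diff borel_measurable_integrable int) (use Ab in auto)
      show "AE x in \<mu>. norm \<bar>indicator (\<Union>i<n. A i) x - indicator (\<Union>i. A i) x :: real\<bar> \<le> 1"
        by (auto simp: indicator_def)
      show "AE x in \<mu>. (\<lambda>n. \<bar>indicator (\<Union>i<n. A i) x - indicator (\<Union>i. A i) x :: real\<bar>) \<longlonglongrightarrow> 0"
      proof (rule AE_I2)
        fix x
        show "(\<lambda>n. \<bar>indicator (\<Union>i<n. A i) x - indicator (\<Union>i. A i) x :: real\<bar>) \<longlonglongrightarrow> 0"
        proof (cases "x \<in> (\<Union>i. A i)")
          case True
          then obtain i where "x \<in> A i" by auto
          then have "\<forall>\<^sub>F n in sequentially. \<bar>indicator (\<Union>i<n. A i) x - indicator (\<Union>i. A i) x :: real\<bar> = 0"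
            by (intro eventually_sequentiallyI[of "Suc i"]) (auto simp: indicator_def)
          then show ?thesis by (rule tendsto_eventually)
        qed (auto simp: indicator_def)
      qed
    qed simp_all
    then obtain n where n: "(\<integral>x. \<bar>indicator (\<Union>i<n. A i) x - indicator (\<Union>i. A i) x :: real\<bar> \<partial>\<mu>) < e/2"
      using union(4) order_tendstoD(2)[OF lim, of "e/2"] by (auto simp: eventually_sequentially)
    \<comment> \<open>The tail of the union uses one half of e; n sets with error d each stay within
      the other half. The summand 1 covers n = 0.\<close>
    define d where "d = e / (2 * (real n + 1))"
    have d: "0 < d" using union(4) by (simp add: d_def)
    have "\<forall>i. \<exists>g. g\<in>Lip\<^sub>b X \<and> range g \<subseteq> {0..1} \<and> (\<integral>x. \<bar>g x - indicator (A i) x\<bar> \<partial>\<mu>) < d"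
      using union(3)[OF d] by blast
    then obtain g where g: "\<And>i. g i \<in> Lip\<^sub>b X" "\<And>i. range (g i) \<subseteq> {0..1}"
      "\<And>i. (\<integral>x. \<bar>g i x - indicator (A i) x\<bar> \<partial>\<mu>) < d" by metis
    \<comment> \<open>Capping the nonnegative sum at 1 brings the values back into the unit interval
      and does not increase the distance to an indicator.\<close>
    define h where "h x = min 1 (\<Sum>i<n. g i x)" for x
    have sumLip: "(\<lambda>x. \<Sum>i<m. g i x) \<in> Lip\<^sub>b X" for m
    proof (induction m)
      case (Suc m)
      show ?case using Lip\<^sub>b_lin[OF Suc g(1)[of m], of 1 1] by simp
    qed simp
    have g0: "0 \<le> g i x" for i x using g(2)[of i] by (simp add: image_subset_iff)
    have sum0: "0 \<le> (\<Sum>i<n. g i x)" for x by (intro sum_nonneg) (simp add: g0)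
    obtain L where L: "L-lipschitz_on X (\<lambda>x. \<Sum>i<n. g i x)" using sumLip[of n] Lip\<^sub>b_E by blast
    have hL: "L-lipschitz_on X h"
    proof (rule lipschitz_onI)
      fix x y assume "x \<in> X" "y \<in> X"
      then show "dist (h x) (h y) \<le> L * dist x y"
        using lipschitz_onD[OF L, of x y] unfolding h_def dist_real_def by linarith
    qed (rule lipschitz_on_nonneg[OF L])
    have hLb: "h \<in> Lip\<^sub>b X" 
      by (rule Lip\<^sub>b_I[OF hL, of 1]) (use sum0 in \<open>auto simp: h_def\<close>)
    have ind: "indicator (\<Union>i<n. A i) x = (\<Sum>i<n. indicator (A i) x :: real)" for x
      using union(1) by (intro indicator_UN_disjoint) (auto simp: disjoint_family_on_def)
    have h_le: "\<bar>h x - indicator (\<Union>i<n. A i) x\<bar> \<le> (\<Sum>i<n. \<bar>g i x - indicator (A i) x\<bar>)" for x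
    proof -
      have "\<bar>h x - indicator (\<Union>i<n. A i) x\<bar> \<le> \<bar>(\<Sum>i<n. g i x) - indicator (\<Union>i<n. A i) x\<bar>"
        using sum0[of x] by (auto simp: h_def indicator_def)
      also have "\<dots> = \<bar>\<Sum>i<n. g i x - indicator (A i) x\<bar>" by (simp add: ind sum_subtractf)
      also have "\<dots> \<le> (\<Sum>i<n. \<bar>g i x - indicator (A i) x\<bar>)" by (rule sum_abs)
      finally show ?thesis .
    qed
    have i1: "integrable \<mu> (\<lambda>x. \<bar>h x - indicator (\<Union>i. A i) x\<bar>)"
      and i2: "integrable \<mu> (\<lambda>x. \<bar>g i x - indicator (A i) x\<bar>)"
      and i3: "integrable \<mu> (\<lambda>x. \<bar>indicator (\<Union>i<n. A i) x - indicator (\<Union>i. A i) x :: real\<bar>)" for i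
      subgoal using Ab hLb by (intro integrable_diff_Lip\<^sub>b int) auto
      subgoal using Ab g(1) by (intro integrable_diff_Lip\<^sub>b int) auto
      subgoal using Ab by (intro integrable_abs Bochner_Integration.integrable_diff int) auto
      done
    have "(\<integral>x. \<bar>h x - indicator (\<Union>i. A i) x\<bar> \<partial>\<mu>) \<le>
      (\<integral>x. (\<Sum>i<n. \<bar>g i x - indicator (A i) x\<bar>) + \<bar>indicator (\<Union>i<n. A i) x - indicator (\<Union>i. A i) x\<bar> \<partial>\<mu>)"
    proof (rule integral_mono)
      show "\<bar>h x - indicator (\<Union>i. A i) x\<bar> \<le> (\<Sum>i<n. \<bar>g i x - indicator (A i) x\<bar>) + \<bar>indicator (\<Union>i<n. A i) x - indicator (\<Union>i. A i) x\<bar>" for x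
        using h_le[of x] by linarith
    qed (use i1 i2 i3 in auto)
    also have "\<dots> = (\<Sum>i<n. \<integral>x. \<bar>g i x - indicator (A i) x\<bar> \<partial>\<mu>) + (\<integral>x. \<bar>indicator (\<Union>i<n. A i) x - indicator (\<Union>i. A i) x\<bar> \<partial>\<mu>)"
      using i2 i3 by simp
    also have "\<dots> < (\<Sum>i<n. d) + e/2"
      using g(3) n by (intro add_le_less_mono sum_mono less_imp_le)
    also have "\<dots> \<le> e"
      using union(4) by (simp add: d_def divide_simps) (simp add: algebra_simps)
    finally show ?case using hLb sum0 by (intro bexI[of _ h]) (auto simp: h_def)
  qed
qed

lemma integrable_approx_Lip:
  assumes "integrable \<mu> f" "0 < e"
  shows "\<exists>g\<in>Lip\<^sub>b X. (\<integral>x. \<bar>g x - f x\<bar> \<partial>\<mu>) < e"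
  using assms
proof (induction f arbitrary: e rule: integrable_induct)
  case (base A c)
  then obtain A' where A': "A' \<in> sets borel" "A = X \<inter> A'" by (auto simp: finite_Borel_sets sets_restrict_space)
  \<comment> \<open>Division by \<bar>c\<bar> + 1 instead of \<bar>c\<bar> covers c = 0.\<close>
  have "0 < e / (\<bar>c\<bar> + 1)" using base(3) by simp
  then obtain g where g: "g \<in> Lip\<^sub>b X" "(\<integral>x. \<bar>g x - indicator A' x\<bar> \<partial>\<mu>) < e / (\<bar>c\<bar> + 1)"
    using Borel_approx_Lip[OF A'(1)] by blast
  have "(\<integral>x. \<bar>c * g x - indicator A x *\<^sub>R c\<bar> \<partial>\<mu>) = (\<integral>x. \<bar>c\<bar> * \<bar>g x - indicator A' x\<bar> \<partial>\<mu>)"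
    by (rule Bochner_Integration.integral_cong)
      (auto simp: A' finite_Borel_space indicator_def abs_mult[symmetric] algebra_simps)
  also have "\<dots> = \<bar>c\<bar> * (\<integral>x. \<bar>g x - indicator A' x\<bar> \<partial>\<mu>)" by simp
  also have "\<dots> \<le> \<bar>c\<bar> * (e / (\<bar>c\<bar> + 1))" using g by (intro mult_left_mono) auto
  also have "\<dots> < e" using base(3) by (simp add: divide_simps)
  finally have "(\<integral>x. \<bar>c * g x - indicator A x *\<^sub>R c\<bar> \<partial>\<mu>) < e" .
  moreover have "(\<lambda>x. c * g x) \<in> Lip\<^sub>b X" using Lip\<^sub>b_lin[OF g(1) g(1), of c 0] by simp
  ultimately show ?case by (intro bexI[of _ "\<lambda>x. c * g x"])
next
  case (add f1 f2)
  from add.prems have "0 < e/2" by simp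
  then obtain g1 g2 where g: "g1 \<in> Lip\<^sub>b X" "(\<integral>x. \<bar>g1 x - f1 x\<bar> \<partial>\<mu>) < e/2"
    "g2 \<in> Lip\<^sub>b X" "(\<integral>x. \<bar>g2 x - f2 x\<bar> \<partial>\<mu>) < e/2" using add.IH by meson
  have "(\<integral>x. \<bar>(g1 x + g2 x) - (f1 x + f2 x)\<bar> \<partial>\<mu>) \<le> (\<integral>x. \<bar>g1 x - f1 x\<bar> + \<bar>g2 x - f2 x\<bar> \<partial>\<mu>)"
    using add.hyps g bounded_Borel_integrable[OF Lip\<^sub>b_imp_bounded_Borel]
    by (intro integral_mono) auto
  also have "\<dots> = (\<integral>x. \<bar>g1 x - f1 x\<bar> \<partial>\<mu>) + (\<integral>x. \<bar>g2 x - f2 x\<bar> \<partial>\<mu>)"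
    using add.hyps g by (intro Bochner_Integration.integral_add integrable_diff_Lip\<^sub>b)
  also have "\<dots> < e" using g by simp
  finally show ?case using Lip\<^sub>b_lin[OF g(1,3), of 1 1] by (intro bexI[of _ "\<lambda>x. g1 x + g2 x"]) auto
next
  case (lim f s)
  have l: "(\<lambda>i. \<integral>x. \<bar>s i x - f x\<bar> \<partial>\<mu>) \<longlonglongrightarrow> (\<integral>x. 0 \<partial>\<mu>)"
  \<comment> \<open>The induction rule supplies approximants bounded by twice \<bar>f\<bar>, hence
    the factor 3.\<close>
  proof (rule integral_dominated_convergence[where w = "\<lambda>x. 3 * \<bar>f x\<bar>"])
    show "AE x in \<mu>. (\<lambda>i. \<bar>s i x - f x\<bar>) \<longlonglongrightarrow> 0"
      using lim.hyps(2) by (intro AE_I2 tendsto_rabs_zero) (auto intro: LIM_zero)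
    show "AE x in \<mu>. norm \<bar>s i x - f x\<bar> \<le> 3 * \<bar>f x\<bar>" for i
      using lim.hyps(3)[of _ i] by (intro AE_I2) fastforce
  qed (use lim.hyps(1,4) in auto)
  then obtain i where i: "(\<integral>x. \<bar>s i x - f x\<bar> \<partial>\<mu>) < e/2"
    using lim.prems order_tendstoD(2)[OF l, of "e/2"] by (auto simp: eventually_sequentially)
  obtain g where g: "g \<in> Lip\<^sub>b X" "(\<integral>x. \<bar>g x - s i x\<bar> \<partial>\<mu>) < e/2" using lim.IH[of "e/2" i] lim.prems by auto
  have "(\<integral>x. \<bar>g x - f x\<bar> \<partial>\<mu>) \<le> (\<integral>x. \<bar>g x - s i x\<bar> + \<bar>s i x - f x\<bar> \<partial>\<mu>)"
    using lim.hyps(1,4) g bounded_Borel_integrable[OF Lip\<^sub>b_imp_bounded_Borel]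
    by (intro integral_mono) auto
  also have "\<dots> = (\<integral>x. \<bar>g x - s i x\<bar> \<partial>\<mu>) + (\<integral>x. \<bar>s i x - f x\<bar> \<partial>\<mu>)"
    using lim.hyps(1,4) g by (intro Bochner_Integration.integral_add integrable_diff_Lip\<^sub>b integrable_abs
        Bochner_Integration.integrable_diff) auto
  also have "\<dots> < e" using g i by simp
  finally show ?case using g by blast
qed

end

section \<open>Sums of measures\<close>

text \<open>Writing the sum as an integral over \<open>count_space I\<close> treats two summands
  (indexed by bool), finite families and series alike, and lets the convergence theorems of
  integration exchange sums with limits. \<open>M\<close> only supplies the space and the
  sigma-algebra.\<close>

definition sum_measure :: "'a measure \<Rightarrow> 'i set \<Rightarrow> ('i \<Rightarrow> 'a measure) \<Rightarrow> 'a measure"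
  where "sum_measure M I \<mu> =
    measure_of (space M) (sets M) (\<lambda>A. \<integral>\<^sup>+i. emeasure (\<mu> i) A \<partial>count_space I)"

lemma sets_sum_measure [simp, measurable_cong]: "sets (sum_measure M I \<mu>) = sets M"
  by (simp add: sum_measure_def)

lemma emeasure_sum_measure:
  assumes "\<And>i. i \<in> I \<Longrightarrow> sets (\<mu> i) = sets M" and A: "A \<in> sets M"
  shows "emeasure (sum_measure M I \<mu>) A = (\<integral>\<^sup>+i. emeasure (\<mu> i) A \<partial>count_space I)"
  unfolding sum_measure_def
proof (rule emeasure_measure_of_sigma[OF sets.sigma_algebra_axioms _ _ A])
  show "positive (sets M) (\<lambda>A. \<integral>\<^sup>+i. emeasure (\<mu> i) A \<partial>count_space I)"
    by (simp add: positive_def)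
  show "countably_additive (sets M) (\<lambda>A. \<integral>\<^sup>+i. emeasure (\<mu> i) A \<partial>count_space I)"
  proof (rule countably_additiveI)
    fix A :: "nat \<Rightarrow> _" assume A: "range A \<subseteq> sets M" "disjoint_family A"
    have "(\<Sum>j. \<integral>\<^sup>+i. emeasure (\<mu> i) (A j) \<partial>count_space I) = (\<integral>\<^sup>+i. (\<Sum>j. emeasure (\<mu> i) (A j)) \<partial>count_space I)"
      by (rule nn_integral_suminf[symmetric]) simp
    also have "\<dots> = (\<integral>\<^sup>+i. emeasure (\<mu> i) (\<Union>j. A j) \<partial>count_space I)"
      using A assms(1) by (intro nn_integral_cong) (auto intro!: suminf_emeasure)
    finally show "(\<Sum>j. \<integral>\<^sup>+i. emeasure (\<mu> i) (A j) \<partial>count_space I) = (\<integral>\<^sup>+i. emeasure (\<mu> i) (\<Union>j. A j) \<partial>count_space I)" .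
  qed
qed

lemma nn_integral_sum_measure:
  assumes sets: "\<And>i. i \<in> I \<Longrightarrow> sets (\<mu> i) = sets M" and f: "f \<in> borel_measurable M"
  shows "(\<integral>\<^sup>+x. f x \<partial>sum_measure M I \<mu>) = (\<integral>\<^sup>+i. (\<integral>\<^sup>+x. f x \<partial>\<mu> i) \<partial>count_space I)"
  using f
proof induction
  have meas: "g \<in> borel_measurable (\<mu> i) \<longleftrightarrow> g \<in> borel_measurable M" if "i \<in> I" for g :: "_ \<Rightarrow> ennreal" and i
    by (intro measurable_cong_sets[THEN eqset_imp_iff] sets that refl)
  have meas': "g \<in> borel_measurable (sum_measure M I \<mu>) \<longleftrightarrow> g \<in> borel_measurable M" for g :: "_ \<Rightarrow> ennreal"
    by (intro measurable_cong_sets[THEN eqset_imp_iff]) auto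
  {
    case (cong f g)
    have "space (\<mu> i) = space M" if "i \<in> I" for i using sets[OF that] by (rule sets_eq_imp_space_eq)
    moreover have "space (sum_measure M I \<mu>) = space M" by (rule sets_eq_imp_space_eq) simp
    ultimately have "(\<integral>\<^sup>+x. f x \<partial>sum_measure M I \<mu>) = (\<integral>\<^sup>+x. g x \<partial>sum_measure M I \<mu>)"
      "\<And>i. i \<in> I \<Longrightarrow> (\<integral>\<^sup>+x. f x \<partial>\<mu> i) = (\<integral>\<^sup>+x. g x \<partial>\<mu> i)"
      using cong.hyps by (auto intro!: nn_integral_cong)
    then show ?case using cong.IH by (simp cong: nn_integral_cong_simp)
  next
    case (set A)
    then have "(\<integral>\<^sup>+i. (\<integral>\<^sup>+x. indicator A x \<partial>\<mu> i) \<partial>count_space I) = (\<integral>\<^sup>+i. emeasure (\<mu> i) A \<partial>count_space I)"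
      using sets by (intro nn_integral_cong) auto
    then show ?case using set emeasure_sum_measure[where I = I and \<mu> = \<mu> and M = M and A = A] sets by simp
  next
    case (mult u c)
    have "(\<integral>\<^sup>+i. (\<integral>\<^sup>+x. c * u x \<partial>\<mu> i) \<partial>count_space I) = (\<integral>\<^sup>+i. c * (\<integral>\<^sup>+x. u x \<partial>\<mu> i) \<partial>count_space I)"
      using mult meas by (intro nn_integral_cong nn_integral_cmult) auto
    then show ?case using mult by (simp add: nn_integral_cmult meas')
  next
    case (add u v)
    have "(\<integral>\<^sup>+i. (\<integral>\<^sup>+x. v x + u x \<partial>\<mu> i) \<partial>count_space I) = (\<integral>\<^sup>+i. (\<integral>\<^sup>+x. v x \<partial>\<mu> i) + (\<integral>\<^sup>+x. u x \<partial>\<mu> i) \<partial>count_space I)"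
      using add meas by (intro nn_integral_cong nn_integral_add) auto
    then show ?case using add by (simp add: nn_integral_add meas')
  next
    case (seq U)
    have "(\<integral>\<^sup>+i. (\<integral>\<^sup>+x. (SUP j. U j) x \<partial>\<mu> i) \<partial>count_space I) = (\<integral>\<^sup>+i. (SUP j. (\<integral>\<^sup>+x. U j x \<partial>\<mu> i)) \<partial>count_space I)"
      unfolding SUP_apply using seq meas
      by (intro nn_integral_cong nn_integral_monotone_convergence_SUP) auto
    also have "\<dots> = (SUP j. (\<integral>\<^sup>+i. (\<integral>\<^sup>+x. U j x \<partial>\<mu> i) \<partial>count_space I))"
      using seq by (intro nn_integral_monotone_convergence_SUP)
        (auto simp: incseq_def le_fun_def intro!: nn_integral_mono)
    also have "\<dots> = (SUP j. (\<integral>\<^sup>+x. U j x \<partial>sum_measure M I \<mu>))" using seq by simp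
    also have "\<dots> = (\<integral>\<^sup>+x. (SUP j. U j x) \<partial>sum_measure M I \<mu>)"
      using seq meas' by (intro nn_integral_monotone_convergence_SUP[symmetric]) auto
    finally show ?case by (simp add: SUP_apply image_comp)
  }
qed

context
  fixes X :: "'a::metric_space set" and I :: "'i set" and \<mu> :: "'i \<Rightarrow> 'a measure"
  assumes fin: "\<And>i. i \<in> I \<Longrightarrow> finite_Borel_measure X (\<mu> i)"
    and total: "(\<integral>\<^sup>+i. emeasure (\<mu> i) X \<partial>count_space I) < \<infinity>"
begin

lemma finite_Borel_sum_measure: "finite_Borel_measure X (sum_measure (restrict_space borel X) I \<mu>)"
proof -
  have sp: "space (sum_measure (restrict_space borel X) I \<mu>) = X"
    using sets_eq_imp_space_eq[of "sum_measure (restrict_space borel X) I \<mu>" "restrict_space borel X"]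
    by (simp add: space_restrict_space)
  have X: "X \<in> sets (restrict_space borel X)" by (auto simp: sets_restrict_space)
  have "emeasure (sum_measure (restrict_space borel X) I \<mu>) X = (\<integral>\<^sup>+i. emeasure (\<mu> i) X \<partial>count_space I)"
    using fin X by (intro emeasure_sum_measure) (auto simp: finite_Borel_measure_def)
  then show ?thesis
    using total sp by (auto simp: finite_Borel_measure_def intro!: finite_measureI)
qed

lemma emeasure_sum_Borel:
  "A \<in> sets (restrict_space borel X) \<Longrightarrow>
    emeasure (sum_measure (restrict_space borel X) I \<mu>) A = (\<integral>\<^sup>+i. emeasure (\<mu> i) A \<partial>count_space I)"
  using fin by (intro emeasure_sum_measure) (auto simp: finite_Borel_measure_def)

text \<open>Tonelli for the sum and the integral. The form \<open>has_bochner_integral\<close>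
  yields the value together with integrability in i, which provides the dominating function in
  \<open>current_with_sum\<close>.\<close>

lemma has_integral_sum_measure:
  assumes f: "f \<in> bounded_Borel X"
  shows "has_bochner_integral (count_space I) (\<lambda>i. \<integral>x. \<bar>f x\<bar> \<partial>\<mu> i)
    (\<integral>x. \<bar>f x\<bar> \<partial>sum_measure (restrict_space borel X) I \<mu>)"
proof (rule has_bochner_integral_nn_integral)
  have fm: "(\<lambda>x. ennreal \<bar>f x\<bar>) \<in> borel_measurable (restrict_space borel X)"
    using f by (auto simp: bounded_Borel_def)
  have "(\<integral>\<^sup>+i. ennreal (\<integral>x. \<bar>f x\<bar> \<partial>\<mu> i) \<partial>count_space I) = (\<integral>\<^sup>+i. (\<integral>\<^sup>+x. ennreal \<bar>f x\<bar> \<partial>\<mu> i) \<partial>count_space I)"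
    using bounded_Borel_integrable[OF fin f]
    by (intro nn_integral_cong nn_integral_eq_integral[symmetric] integrable_abs) auto
  also have "\<dots> = (\<integral>\<^sup>+x. ennreal \<bar>f x\<bar> \<partial>sum_measure (restrict_space borel X) I \<mu>)"
    using fin fm by (intro nn_integral_sum_measure[symmetric]) (auto simp: finite_Borel_measure_def)
  also have "\<dots> = ennreal (\<integral>x. \<bar>f x\<bar> \<partial>sum_measure (restrict_space borel X) I \<mu>)"
    using bounded_Borel_integrable[OF finite_Borel_sum_measure f]
    by (intro nn_integral_eq_integral integrable_abs) auto
  finally show "(\<integral>\<^sup>+i. ennreal (\<integral>x. \<bar>f x\<bar> \<partial>\<mu> i) \<partial>count_space I)
    = ennreal (\<integral>x. \<bar>f x\<bar> \<partial>sum_measure (restrict_space borel X) I \<mu>)" .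
qed auto

end

section \<open>Currents with a dominating measure\<close>

text \<open>Frees estimates from the infimum in \<open>LIP\<close>: as the integral is nonnegative,
  any larger Lipschitz constant may be used.\<close>

lemma mass_bound_iff:
  "mass_bound X F T \<mu> \<longleftrightarrow> finite_Borel_measure X \<mu> \<and>
    (\<forall>f\<in>F. \<forall>p l. l-lipschitz_on X p \<longrightarrow> \<bar>T f p\<bar> \<le> l * (\<integral>x. \<bar>f x\<bar> \<partial>\<mu>))"
  (is "?L \<longleftrightarrow> ?R")
proof
  assume L: ?L
  have "\<bar>T f p\<bar> \<le> l * (\<integral>x. \<bar>f x\<bar> \<partial>\<mu>)" if "f \<in> F" "l-lipschitz_on X p" for f p l
  proof -
    have "\<bar>T f p\<bar> \<le> LIP X p * (\<integral>x. \<bar>f x\<bar> \<partial>\<mu>)" using L that LipI[OF that(2)] by (auto simp: mass_bound_def)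
    also have "\<dots> \<le> l * (\<integral>x. \<bar>f x\<bar> \<partial>\<mu>)"
      using LIP_le[OF that(2)] by (intro mult_right_mono) auto
    finally show ?thesis .
  qed
  then show ?R using L by (auto simp: mass_bound_def)
qed (auto simp: mass_bound_def intro: Lip_lipschitz_on)

text \<open>Some dominating measure, not the minimal one: dominating measures add up under sums of
  currents, while the mass measure of a sum is only bounded by the sum of the mass measures.\<close>

definition current_with :: "'a::metric_space set \<Rightarrow> 'a functional \<Rightarrow> 'a measure \<Rightarrow> bool"
  where "current_with X T \<mu> \<longleftrightarrow> metric_1_current X T \<and> mass_bound X (Lip\<^sub>b X) T \<mu>"

lemma current_withI:
  assumes "bilinear_on (Lip\<^sub>b X) (Lip X) T" "current_locality X T" "current_joint_continuity X T"
    "mass_bound X (Lip\<^sub>b X) T \<mu>"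
  shows "current_with X T \<mu>"
  using assms by (auto simp: current_with_def metric_1_current_def)

context
  fixes X :: "'a::metric_space set" and T :: "'a functional" and \<mu> :: "'a measure"
  assumes T: "current_with X T \<mu>"
begin

lemma current_with_finite: "finite_Borel_measure X \<mu>"
  using T by (simp add: current_with_def mass_bound_def)

lemma current_with_bound:
  "f \<in> Lip\<^sub>b X \<Longrightarrow> l-lipschitz_on X p \<Longrightarrow> \<bar>T f p\<bar> \<le> l * (\<integral>x. \<bar>f x\<bar> \<partial>\<mu>)"
  using T by (simp add: current_with_def mass_bound_iff)

lemma current_with_lin_left:
  "f \<in> Lip\<^sub>b X \<Longrightarrow> g \<in> Lip\<^sub>b X \<Longrightarrow> p \<in> Lip X \<Longrightarrow> T (\<lambda>x. a * f x + b * g x) p = a * T f p + b * T g p"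
  using T by (simp add: current_with_def metric_1_current_def bilinear_on_def)

lemma current_with_lin_right:
  "f \<in> Lip\<^sub>b X \<Longrightarrow> p \<in> Lip X \<Longrightarrow> q \<in> Lip X \<Longrightarrow> T f (\<lambda>x. a * p x + b * q x) = a * T f p + b * T f q"
  using T by (simp add: current_with_def metric_1_current_def bilinear_on_def)

lemma current_with_diff_left:
  "f \<in> Lip\<^sub>b X \<Longrightarrow> g \<in> Lip\<^sub>b X \<Longrightarrow> p \<in> Lip X \<Longrightarrow> T (\<lambda>x. f x - g x) p = T f p - T g p"
  using current_with_lin_left[of f g p 1 "-1"] by simp

lemma current_with_diff_right:
  "f \<in> Lip\<^sub>b X \<Longrightarrow> p \<in> Lip X \<Longrightarrow> q \<in> Lip X \<Longrightarrow> T f (\<lambda>x. p x - q x) = T f p - T f q"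
  using current_with_lin_right[of f p q 1 "-1"] by simp

lemma current_with_locality:
  "f \<in> Lip\<^sub>b X \<Longrightarrow> p \<in> Lip X \<Longrightarrow> openin (top_of_set X) U \<Longrightarrow> {x\<in>X. f x \<noteq> 0} \<subseteq> U \<Longrightarrow>
    p constant_on U \<Longrightarrow> T f p = 0"
  using T unfolding current_with_def metric_1_current_def current_locality_def by blast

lemma current_with_continuity:
  assumes "f \<in> Lip\<^sub>b X" "p \<in> Lip X" "\<And>n. l-lipschitz_on X (pn n)" "\<And>x. x \<in> X \<Longrightarrow> (\<lambda>n. pn n x) \<longlonglongrightarrow> p x"
  shows "(\<lambda>n. T f (pn n)) \<longlonglongrightarrow> T f p"
proof -
  have "bdd_above (range (\<lambda>n. LIP X (pn n)))" using LIP_le[OF assms(3)] by (auto intro!: bdd_aboveI[of _ l])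
  then show ?thesis
    using T assms LipI[OF assms(3)]
    unfolding current_with_def metric_1_current_def current_joint_continuity_def by blast
qed

end

text \<open>A bound on the numbers \<open>LIP X (pn n)\<close> amounts to one Lipschitz constant
  common to the sequence, the form in which dominated convergence is applied.\<close>

lemma joint_continuityI:
  assumes "\<And>f p pn l. f \<in> Lip\<^sub>b X \<Longrightarrow> p \<in> Lip X \<Longrightarrow> (\<And>n. l-lipschitz_on X (pn n)) \<Longrightarrow>
    (\<And>x. x \<in> X \<Longrightarrow> (\<lambda>n. pn n x) \<longlonglongrightarrow> p x) \<Longrightarrow> (\<lambda>n. T f (pn n)) \<longlonglongrightarrow> T f p"
  shows "current_joint_continuity X T"
  unfolding current_joint_continuity_def
proof (intro ballI allI impI)
  fix f p and pn :: "nat \<Rightarrow> 'a \<Rightarrow> real"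
  assume H: "f \<in> Lip\<^sub>b X" "p \<in> Lip X" "\<forall>n. pn n \<in> Lip X" "\<forall>x\<in>X. (\<lambda>n. pn n x) \<longlonglongrightarrow> p x"
    "bdd_above (range (\<lambda>n. LIP X (pn n)))"
  obtain l where "\<And>n. LIP X (pn n) \<le> l" using H(5) by (auto simp: bdd_above_def)
  then have "\<And>n. l-lipschitz_on X (pn n)" using Lip_lipschitz_on lipschitz_on_le H(3) by blast
  then show "(\<lambda>n. T f (pn n)) \<longlonglongrightarrow> T f p" using assms H by blast
qed

text \<open>For f fixed and p with constant l, the i-th term is at most l times the integral of
  \<bar>f\<bar> against \<open>\<mu> i\<close>. This bound is summable in i and the same for all
  such p, so limits in p pass through the sum by dominated convergence.\<close>

lemma current_with_sum:
  fixes X :: "'a::metric_space set" and I :: "'i set"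
  assumes cur: "\<And>i. i \<in> I \<Longrightarrow> current_with X (T i) (\<mu> i)"
    and total: "(\<integral>\<^sup>+i. emeasure (\<mu> i) X \<partial>count_space I) < \<infinity>"
  shows current_with_sum_measure: "current_with X (\<lambda>f p. \<integral>i. T i f p \<partial>count_space I)
      (sum_measure (restrict_space borel X) I \<mu>)" (is "current_with X ?T ?\<mu>")
    and current_sum_integrable:
      "\<And>f p. f \<in> Lip\<^sub>b X \<Longrightarrow> p \<in> Lip X \<Longrightarrow> integrable (count_space I) (\<lambda>i. T i f p)"
proof -
  have fin: "\<And>i. i \<in> I \<Longrightarrow> finite_Borel_measure X (\<mu> i)" using cur current_with_finite by blast
  have hb: "has_bochner_integral (count_space I) (\<lambda>i. l * (\<integral>x. \<bar>f x\<bar> \<partial>\<mu> i)) (l * (\<integral>x. \<bar>f x\<bar> \<partial>?\<mu>))"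
    if "f \<in> Lip\<^sub>b X" for f l
    using has_integral_sum_measure[OF fin total Lip\<^sub>b_imp_bounded_Borel[OF that]]
    by (intro has_bochner_integral_mult_right)
  have bd: "norm (T i f p) \<le> l * (\<integral>x. \<bar>f x\<bar> \<partial>\<mu> i)" if "f \<in> Lip\<^sub>b X" "l-lipschitz_on X p" "i \<in> I" for f p l i
    using current_with_bound[OF cur that(1,2)] that(3) by simp
  show int: "integrable (count_space I) (\<lambda>i. T i f p)" if "f \<in> Lip\<^sub>b X" "p \<in> Lip X" for f p
  proof (rule Bochner_Integration.integrable_bound)
    show "integrable (count_space I) (\<lambda>i. LIP X p * (\<integral>x. \<bar>f x\<bar> \<partial>\<mu> i))"
      using hb[OF that(1)] has_bochner_integral_iff by blast
    show "AE i in count_space I. norm (T i f p) \<le> norm (LIP X p * (\<integral>x. \<bar>f x\<bar> \<partial>\<mu> i))"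
      using bd[OF that(1) Lip_lipschitz_on[OF that(2)]] by (force simp: AE_count_space)
  qed simp
  show "current_with X ?T ?\<mu>"
  proof (rule current_withI)
    show "bilinear_on (Lip\<^sub>b X) (Lip X) ?T"
      unfolding bilinear_on_def
    proof (intro conjI ballI allI)
      fix f g p :: "'a \<Rightarrow> real" and a b assume H: "f \<in> Lip\<^sub>b X" "g \<in> Lip\<^sub>b X" "p \<in> Lip X"
      have "?T (\<lambda>x. a * f x + b * g x) p = (\<integral>i. a * T i f p + b * T i g p \<partial>count_space I)"
        using current_with_lin_left[OF cur H] by (intro Bochner_Integration.integral_cong) auto
      then show "?T (\<lambda>x. a * f x + b * g x) p = a * ?T f p + b * ?T g p"
        using int H by simp
    next
      fix f p q :: "'a \<Rightarrow> real" and a b assume H: "f \<in> Lip\<^sub>b X" "p \<in> Lip X" "q \<in> Lip X"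
      have "?T f (\<lambda>x. a * p x + b * q x) = (\<integral>i. a * T i f p + b * T i f q \<partial>count_space I)"
        using current_with_lin_right[OF cur H] by (intro Bochner_Integration.integral_cong) auto
      then show "?T f (\<lambda>x. a * p x + b * q x) = a * ?T f p + b * ?T f q"
        using int H by simp
    qed
    show "current_locality X ?T"
      unfolding current_locality_def
    proof (intro ballI impI)
      fix f p :: "'a \<Rightarrow> real" assume H: "f \<in> Lip\<^sub>b X" "p \<in> Lip X"
        "\<exists>U. openin (top_of_set X) U \<and> {x\<in>X. f x \<noteq> 0} \<subseteq> U \<and> p constant_on U"
      then have "T i f p = 0" if "i \<in> I" for i using current_with_locality[OF cur[OF that]] by blast
      then have "?T f p = (\<integral>i. 0 \<partial>count_space I)"
        by (intro Bochner_Integration.integral_cong) auto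
      then show "?T f p = 0" by simp
    qed
    show "current_joint_continuity X ?T"
    proof (rule joint_continuityI)
      fix f p :: "'a \<Rightarrow> real" and pn l
      assume H: "f \<in> Lip\<^sub>b X" "p \<in> Lip X" "\<And>n. l-lipschitz_on X (pn n)" "\<And>x. x \<in> X \<Longrightarrow> (\<lambda>n. pn n x) \<longlonglongrightarrow> p x"
      show "(\<lambda>n. ?T f (pn n)) \<longlonglongrightarrow> ?T f p"
      proof (rule integral_dominated_convergence)
        show "integrable (count_space I) (\<lambda>i. l * (\<integral>x. \<bar>f x\<bar> \<partial>\<mu> i))"
          using hb[OF H(1)] has_bochner_integral_iff by blast
        show "AE i in count_space I. (\<lambda>n. T i f (pn n)) \<longlonglongrightarrow> T i f p"
          using current_with_continuity[OF cur H] by (simp add: AE_count_space)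
        show "AE i in count_space I. norm (T i f (pn n)) \<le> l * (\<integral>x. \<bar>f x\<bar> \<partial>\<mu> i)" for n
          using bd[OF H(1,3)] by (simp add: AE_count_space)
      qed auto
    qed
    show "mass_bound X (Lip\<^sub>b X) ?T ?\<mu>"
      unfolding mass_bound_iff
    proof (intro conjI ballI allI impI)
      show "finite_Borel_measure X ?\<mu>" by (rule finite_Borel_sum_measure[OF fin total])
      fix f p :: "'a \<Rightarrow> real" and l assume H: "f \<in> Lip\<^sub>b X" "l-lipschitz_on X p"
      have "norm (?T f p) \<le> (\<integral>i. l * (\<integral>x. \<bar>f x\<bar> \<partial>\<mu> i) \<partial>count_space I)"
        by (rule order_trans[OF integral_norm_bound], rule integral_mono)
          (use bd[OF H] hb[OF H(1)] int[OF H(1) LipI[OF H(2)]] in \<open>auto simp: has_bochner_integral_iff\<close>)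
      also have "\<dots> = l * (\<integral>x. \<bar>f x\<bar> \<partial>?\<mu>)" using hb[OF H(1)] by (rule has_bochner_integral_integral_eq)
      finally show "\<bar>?T f p\<bar> \<le> l * (\<integral>x. \<bar>f x\<bar> \<partial>?\<mu>)" by simp
    qed
  qed
qed

section \<open>The mass measure\<close>

lemma restrict_borelE:
  assumes "A \<in> sets (restrict_space borel X)"
  obtains A' where "A' \<in> sets borel" "A = X \<inter> A'"
  using assms by (auto simp: sets_restrict_space)

text \<open>Split f into fg and f(1 - g) with a Lipschitz g close to the indicator of
  \<open>A\<close> in L1, and estimate the first part with \<mu>, the second with \<mu>'. So the
  measure glued from both dominates \<open>T\<close> as well, which is what makes the infimum over
  all dominating measures additive.\<close>

lemma current_with_cut:
  fixes X :: "'a::metric_space set"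
  assumes \<mu>: "current_with X T \<mu>" "current_with X T \<mu>'" and A: "A \<in> sets (restrict_space borel X)"
  obtains \<nu> where "current_with X T \<nu>"
    "\<And>E. E \<in> sets (restrict_space borel X) \<Longrightarrow> emeasure \<nu> E = emeasure \<mu> (E \<inter> A) + emeasure \<mu>' (E - A)"
proof -
  let ?M = "restrict_space borel X :: 'a measure"
  note fin = current_with_finite[OF \<mu>(1)] current_with_finite[OF \<mu>(2)]
  have sp: "space \<mu> = X" "space \<mu>' = X" "sets \<mu> = sets ?M" "sets \<mu>' = sets ?M"
    using fin finite_Borel_space finite_Borel_sets by blast+
  have Asub: "A \<subseteq> X" using A by (auto simp: sets_restrict_space)
  have XM: "X \<in> sets ?M" by (auto simp: sets_restrict_space)
  then have XA: "X - A \<in> sets ?M" using A by blast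
  have XeqX: "emeasure \<mu> X < \<infinity>" "emeasure \<mu>' X < \<infinity>"
    using fin[THEN finite_Borel_finite_measure, THEN finite_measure.finite_emeasure_space] sp by (simp_all add: less_top)
  \<comment> \<open>The sum of both measures: approximation in its L1 is good for \<mu> and \<mu>'
    at once.\<close>
  define \<sigma> where "\<sigma> = sum_measure ?M UNIV (\<lambda>b. if b then \<mu> else \<mu>')"
  define c where "c = (\<lambda>b. if b then density \<mu> (indicator A) else density \<mu>' (indicator (X - A)))"
  define \<nu> where "\<nu> = sum_measure ?M UNIV c"
  have cs: "sets (c b) = sets ?M" for b by (simp add: c_def sp)
  have emd: "emeasure (c True) E = emeasure \<mu> (E \<inter> A)" "emeasure (c False) E = emeasure \<mu>' (E - A)" if "E \<in> sets ?M" for E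
  proof -
    have "E \<subseteq> X" using that by (auto simp: sets_restrict_space)
    then have *: "(X - A) \<inter> E = E - A" by auto
    show "emeasure (c True) E = emeasure \<mu> (E \<inter> A)" using that A sp by (simp add: c_def emeasure_restricted Int_commute)
    show "emeasure (c False) E = emeasure \<mu>' (E - A)" using that XA sp * by (simp add: c_def emeasure_restricted)
  qed
  have sum2: "(\<integral>\<^sup>+b. g b \<partial>count_space UNIV) = g True + g False" for g :: "bool \<Rightarrow> ennreal"
    by (simp add: nn_integral_count_space_finite UNIV_bool add.commute)
  have finc: "finite_Borel_measure X (c b)" for b
  proof -
    have "emeasure (c b) X < \<infinity>"
    proof (cases b)
      case True
      then show ?thesis using XeqX emd(1)[OF XM] emeasure_mono[of "X \<inter> A" X \<mu>] XM sp by (auto intro: le_less_trans)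
    next
      case False
      then show ?thesis using XeqX emd(2)[OF XM] emeasure_mono[of "X - A" X \<mu>'] XM sp by (auto intro: le_less_trans)
    qed
    moreover have "space (c b) = X" using sets_eq_imp_space_eq[OF cs] by (simp add: space_restrict_space)
    ultimately show ?thesis using cs by (auto simp: finite_Borel_measure_def intro!: finite_measureI)
  qed
  then have totc: "(\<integral>\<^sup>+b. emeasure (c b) X \<partial>count_space UNIV) < \<infinity>"
    using emd[OF XM] XeqX emeasure_mono[of "X \<inter> A" X \<mu>] emeasure_mono[of "X - A" X \<mu>'] XM sp
    unfolding sum2 by (auto intro: le_less_trans)
  have fin\<sigma>: "finite_Borel_measure X (if b then \<mu> else \<mu>')" for b using fin by simp
  have tot\<sigma>: "(\<integral>\<^sup>+b. emeasure (if b then \<mu> else \<mu>') X \<partial>count_space UNIV) < \<infinity>"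
    using XeqX unfolding sum2 by simp
  have int2: "(\<integral>b. g b \<partial>count_space UNIV) = g True + g False" for g :: "bool \<Rightarrow> real"
    by (simp add: lebesgue_integral_count_space_finite UNIV_bool add.commute)
  have i\<sigma>: "(\<integral>x. \<bar>f x\<bar> \<partial>\<sigma>) = (\<integral>x. \<bar>f x\<bar> \<partial>\<mu>) + (\<integral>x. \<bar>f x\<bar> \<partial>\<mu>')" if "f \<in> bounded_Borel X" for f
    using has_bochner_integral_integral_eq[OF has_integral_sum_measure[OF fin\<sigma> tot\<sigma> that]]
    by (simp add: \<sigma>_def int2)
  have i\<nu>: "(\<integral>x. \<bar>f x\<bar> \<partial>\<nu>) = (\<integral>x. \<bar>f x\<bar> * indicator A x \<partial>\<mu>) + (\<integral>x. \<bar>f x\<bar> * indicator (X - A) x \<partial>\<mu>')"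
    if f: "f \<in> bounded_Borel X" for f
  proof -
    have fm: "(\<lambda>x. \<bar>f x\<bar>) \<in> borel_measurable \<mu>" "(\<lambda>x. \<bar>f x\<bar>) \<in> borel_measurable \<mu>'"
      by (intro borel_measurable_abs borel_measurable_integrable bounded_Borel_integrable[OF fin(1) f]
          bounded_Borel_integrable[OF fin(2) f])+
    have ind: "(indicator E :: 'a \<Rightarrow> ennreal) = (\<lambda>x. ennreal (indicator E x))" for E
      by (auto simp: indicator_def)
    have "(\<integral>x. \<bar>f x\<bar> \<partial>c True) = (\<integral>x. \<bar>f x\<bar> * indicator A x \<partial>\<mu>)"
      using fm A sp unfolding c_def ind by (simp add: integral_density mult.commute)
    moreover have "(\<integral>x. \<bar>f x\<bar> \<partial>c False) = (\<integral>x. \<bar>f x\<bar> * indicator (X - A) x \<partial>\<mu>')"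
      using fm XA sp unfolding c_def ind by (simp add: integral_density mult.commute)
    ultimately show ?thesis
      using has_bochner_integral_integral_eq[OF has_integral_sum_measure[OF finc totc f]]
      by (simp add: \<nu>_def int2)
  qed
  have "\<bar>T f p\<bar> \<le> l * (\<integral>x. \<bar>f x\<bar> \<partial>\<nu>)" if f: "f \<in> Lip\<^sub>b X" and p: "l-lipschitz_on X p" for f p l
  proof -
    obtain L B where B: "L-lipschitz_on X f" "0 \<le> B" "\<And>x. x \<in> X \<Longrightarrow> \<bar>f x\<bar> \<le> B" using Lip\<^sub>b_E[OF f] by blast
    have l: "0 \<le> l" using lipschitz_on_nonneg[OF p] .
    have "\<bar>T f p\<bar> \<le> l * (\<integral>x. \<bar>f x\<bar> \<partial>\<nu>) + e" if e: "0 < e" for e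
    proof -
      obtain A' where A': "A' \<in> sets borel" "A = X \<inter> A'" using restrict_borelE[OF A] by blast
      \<comment> \<open>The 1 in the denominator covers l * B = 0.\<close>
      define e' where "e' = e / (l * B + 1)"
      have "0 \<le> l * B" using l B(2) by simp
      then have e': "0 < e'" "l * B * e' \<le> e" using e by (auto simp: e'_def divide_simps)
      obtain g where g: "g \<in> Lip\<^sub>b X" "range g \<subseteq> {0..1}" "(\<integral>x. \<bar>g x - indicator A' x\<bar> \<partial>\<sigma>) < e'"
        using Borel_approx_Lip[OF finite_Borel_sum_measure[OF fin\<sigma> tot\<sigma>] A'(1) e'(1)] unfolding \<sigma>_def by blast
      have g01: "0 \<le> g x" "g x \<le> 1" for x using g(2) by (auto simp: image_subset_iff)
      have indA': "(indicator A' :: 'a \<Rightarrow> real) \<in> bounded_Borel X"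
        using bounded_Borel_indicator_mult[OF A'(1) Lip\<^sub>b_imp_bounded_Borel[OF Lip\<^sub>b_const[of 1]]] by simp
      have diff: "(\<lambda>x. g x - indicator A' x) \<in> bounded_Borel X"
        using bounded_Borel_lin[OF Lip\<^sub>b_imp_bounded_Borel[OF g(1)] indA', of 1 "-1"] by simp
      have fg: "(\<lambda>x. f x * g x) \<in> Lip\<^sub>b X" using Lip\<^sub>b_mult[OF f g(1)] .
      have "(\<lambda>x. f x - f x * g x) \<in> Lip\<^sub>b X" using Lip\<^sub>b_lin[OF f fg, of 1 "-1"] by simp
      note f1g = this
      note int = bounded_Borel_integrable[OF fin(1)] bounded_Borel_integrable[OF fin(2)]
      have fA: "integrable \<mu> (\<lambda>x. \<bar>f x\<bar> * indicator A x)" "integrable \<mu>' (\<lambda>x. \<bar>f x\<bar> * indicator (X - A) x)"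
        using A XA sp int[OF Lip\<^sub>b_imp_bounded_Borel[OF f]] by (auto intro!: integrable_real_mult_indicator)
      have ib: "integrable \<mu> (\<lambda>x. \<bar>f x * g x\<bar>)" "integrable \<mu>' (\<lambda>x. \<bar>f x - f x * g x\<bar>)"
        "integrable \<mu> (\<lambda>x. \<bar>g x - indicator A' x\<bar>)" "integrable \<mu>' (\<lambda>x. \<bar>g x - indicator A' x\<bar>)"
        by (intro integrable_abs int Lip\<^sub>b_imp_bounded_Borel[OF fg] Lip\<^sub>b_imp_bounded_Borel[OF f1g] diff)+
      have fB: "\<bar>f x\<bar> * t \<le> B * \<bar>t\<bar>" if "x \<in> X" for x t
        using order_trans[OF mult_left_mono[OF abs_ge_self abs_ge_zero] mult_right_mono[OF B(3)[OF that] abs_ge_zero]] .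
      have "T f p = T (\<lambda>x. f x * g x) p + T (\<lambda>x. f x - f x * g x) p"
        using current_with_lin_left[OF \<mu>(1) fg f1g LipI[OF p], of 1 1] by simp
      also have "\<bar>\<dots>\<bar> \<le> l * (\<integral>x. \<bar>f x * g x\<bar> \<partial>\<mu>) + l * (\<integral>x. \<bar>f x - f x * g x\<bar> \<partial>\<mu>')"
        by (intro order_trans[OF abs_triangle_ineq] add_mono current_with_bound[OF \<mu>(1)] current_with_bound[OF \<mu>(2)] fg f1g p)
      also have "(\<integral>x. \<bar>f x * g x\<bar> \<partial>\<mu>) \<le> (\<integral>x. \<bar>f x\<bar> * indicator A x + B * \<bar>g x - indicator A' x\<bar> \<partial>\<mu>)"
      proof (rule integral_mono)
        fix x assume "x \<in> space \<mu>"
        then have x: "x \<in> X" by (simp add: sp)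
        have "\<bar>f x * g x\<bar> = \<bar>f x\<bar> * g x" using g01 by (simp add: abs_mult)
        also have "\<dots> = \<bar>f x\<bar> * indicator A x + \<bar>f x\<bar> * (g x - indicator A' x)"
          using x by (simp add: A' indicator_def algebra_simps)
        also have "\<dots> \<le> \<bar>f x\<bar> * indicator A x + B * \<bar>g x - indicator A' x\<bar>"
          using fB[OF x, of "g x - indicator A' x"] fB[OF x, of "indicator A' x - g x"]
          by (simp add: abs_minus_commute)
        finally show "\<bar>f x * g x\<bar> \<le> \<bar>f x\<bar> * indicator A x + B * \<bar>g x - indicator A' x\<bar>" .
      qed (use ib fA in auto)
      also have "\<dots> = (\<integral>x. \<bar>f x\<bar> * indicator A x \<partial>\<mu>) + B * (\<integral>x. \<bar>g x - indicator A' x\<bar> \<partial>\<mu>)"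
        using fA ib by simp
      also have "(\<integral>x. \<bar>f x - f x * g x\<bar> \<partial>\<mu>') \<le> (\<integral>x. \<bar>f x\<bar> * indicator (X - A) x + B * \<bar>g x - indicator A' x\<bar> \<partial>\<mu>')"
      proof (rule integral_mono)
        fix x assume "x \<in> space \<mu>'"
        then have x: "x \<in> X" by (simp add: sp)
        have "f x - f x * g x = f x * (1 - g x)" by (simp add: algebra_simps)
        then have "\<bar>f x - f x * g x\<bar> = \<bar>f x\<bar> * (1 - g x)" using g01[of x] by (simp add: abs_mult)
        also have "\<dots> = \<bar>f x\<bar> * indicator (X - A) x + \<bar>f x\<bar> * (indicator A' x - g x)"
          using x by (simp add: A' indicator_def algebra_simps)
        also have "\<dots> \<le> \<bar>f x\<bar> * indicator (X - A) x + B * \<bar>g x - indicator A' x\<bar>"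
          using fB[OF x, of "g x - indicator A' x"] fB[OF x, of "indicator A' x - g x"]
          by (simp add: abs_minus_commute)
        finally show "\<bar>f x - f x * g x\<bar> \<le> \<bar>f x\<bar> * indicator (X - A) x + B * \<bar>g x - indicator A' x\<bar>" .
      qed (use ib fA in auto)
      also have "\<dots> = (\<integral>x. \<bar>f x\<bar> * indicator (X - A) x \<partial>\<mu>') + B * (\<integral>x. \<bar>g x - indicator A' x\<bar> \<partial>\<mu>')"
        using fA ib by simp
      finally have "\<bar>T f p\<bar> \<le> l * ((\<integral>x. \<bar>f x\<bar> * indicator A x \<partial>\<mu>) + B * (\<integral>x. \<bar>g x - indicator A' x\<bar> \<partial>\<mu>)) +
         l * ((\<integral>x. \<bar>f x\<bar> * indicator (X - A) x \<partial>\<mu>') + B * (\<integral>x. \<bar>g x - indicator A' x\<bar> \<partial>\<mu>'))"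
        using l by (simp add: mult_left_mono)
      also have "\<dots> = l * (\<integral>x. \<bar>f x\<bar> \<partial>\<nu>) + l * B * (\<integral>x. \<bar>g x - indicator A' x\<bar> \<partial>\<sigma>)"
        using i\<nu>[OF Lip\<^sub>b_imp_bounded_Borel[OF f]] i\<sigma>[OF diff] by (simp add: algebra_simps)
      also have "\<dots> \<le> l * (\<integral>x. \<bar>f x\<bar> \<partial>\<nu>) + l * B * e'"
        using g(3) l B(2) by (intro add_left_mono mult_left_mono) auto
      finally show ?thesis using e'(2) by linarith
    qed
    then show ?thesis by (rule field_le_epsilon)
  qed
  then have "mass_bound X (Lip\<^sub>b X) T \<nu>"
    using finite_Borel_sum_measure[OF finc totc] unfolding mass_bound_iff \<nu>_def by blast
  then have "current_with X T \<nu>" using \<mu>(1) by (simp add: current_with_def)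
  moreover have "emeasure \<nu> E = emeasure \<mu> (E \<inter> A) + emeasure \<mu>' (E - A)" if "E \<in> sets ?M" for E
    using emeasure_sum_Borel[OF finc totc that] emd[OF that] unfolding \<nu>_def sum2 by simp
  ultimately show ?thesis using that by blast
qed

text \<open>The mass measure is defined by \<open>THE\<close>, so a least dominating measure has to
  be built. A setwise infimum of measures is in general only superadditive; gluing by
  \<open>current_with_cut\<close> gives the other inequality. Continuity at the empty set is
  inherited from any one dominating measure.\<close>

lemma exists_minimal_mass_bound:
  fixes X :: "'a::metric_space set"
  assumes T: "metric_1_current X T"
  obtains \<alpha> where "current_with X T \<alpha>"
    "\<And>\<nu> E. current_with X T \<nu> \<Longrightarrow> E \<in> sets (restrict_space borel X) \<Longrightarrow> emeasure \<alpha> E \<le> emeasure \<nu> E"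
proof -
  let ?M = "restrict_space borel X :: 'a measure"
  define \<M> where "\<M> = {\<mu>. current_with X T \<mu>}"
  obtain \<mu>0 where \<mu>0: "\<mu>0 \<in> \<M>" using T by (auto simp: \<M>_def current_with_def metric_1_current_def)
  have fin: "finite_Borel_measure X \<mu>" if "\<mu> \<in> \<M>" for \<mu> using that current_with_finite by (auto simp: \<M>_def)
  note sets\<mu> = finite_Borel_sets[OF fin] and sp = finite_Borel_space[OF fin]
  have spM: "space ?M = X" by (simp add: space_restrict_space)
  have XM: "X \<in> sets ?M" using sets.top[of ?M] by (simp add: spM)
  define a where "a E = (INF \<mu>\<in>\<M>. emeasure \<mu> E)" for E
  have a_le: "a E \<le> emeasure \<mu> E" if "\<mu> \<in> \<M>" for \<mu> E unfolding a_def by (rule INF_lower[OF that])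
  have em_fin: "emeasure \<mu> E < \<infinity>" if "\<mu> \<in> \<M>" for \<mu> E
    using finite_measure.emeasure_finite[OF finite_Borel_finite_measure[OF fin[OF that]]] by (simp add: less_top)
  have a_fin: "a E < \<infinity>" for E using a_le[OF \<mu>0] em_fin[OF \<mu>0] by (rule le_less_trans)
  have pos: "positive (sets ?M) a"
    unfolding positive_def using a_le[OF \<mu>0, of "{}"] by simp
  have add: "additive (sets ?M) a"
  unfolding additive_def
  proof (intro ballI impI)
    fix E F assume E: "E \<in> sets ?M" and F: "F \<in> sets ?M" and EF: "E \<inter> F = {}"
    show "a (E \<union> F) = a E + a F"
    proof (rule antisym)
      show "a (E \<union> F) \<le> a E + a F"
      proof (rule ennreal_le_epsilon)
        fix e :: real assume "0 < e"
        then have e2: "0 < ennreal (e/2)" by simp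
        have "a E < a E + ennreal (e/2)" "a F < a F + ennreal (e/2)"
          using a_fin e2 by (simp_all add: less_top)
        then obtain \<mu> \<mu>' where \<mu>: "\<mu> \<in> \<M>" "emeasure \<mu> E < a E + ennreal (e/2)"
          and \<mu>': "\<mu>' \<in> \<M>" "emeasure \<mu>' F < a F + ennreal (e/2)"
          unfolding a_def INF_less_iff by blast
        obtain \<nu> where \<nu>: "\<nu> \<in> \<M>" "emeasure \<nu> (E \<union> F) = emeasure \<mu> ((E \<union> F) \<inter> E) + emeasure \<mu>' ((E \<union> F) - E)"
        proof (rule current_with_cut[of X T \<mu> \<mu>' E])
          show "current_with X T \<mu>" "current_with X T \<mu>'" using \<mu>(1) \<mu>'(1) by (auto simp: \<M>_def)
        qed (use E F in \<open>auto simp: \<M>_def\<close>)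
        have "(E \<union> F) \<inter> E = E" "(E \<union> F) - E = F" using EF by auto
        then have "a (E \<union> F) \<le> emeasure \<mu> E + emeasure \<mu>' F" using a_le[OF \<nu>(1), of "E \<union> F"] \<nu>(2) by simp
        also have "\<dots> \<le> (a E + ennreal (e/2)) + (a F + ennreal (e/2))"
          using \<mu>(2) \<mu>'(2) by (intro add_mono) auto
        also have "\<dots> = a E + a F + (ennreal (e/2) + ennreal (e/2))" by (simp add: ac_simps)
        also have "ennreal (e/2) + ennreal (e/2) = ennreal e" using \<open>0 < e\<close> by (simp flip: ennreal_plus)
        finally show "a (E \<union> F) \<le> a E + a F + ennreal e" .
      qed
      show "a E + a F \<le> a (E \<union> F)" unfolding a_def[of "E \<union> F"]
      proof (rule INF_greatest)
        fix \<mu> assume \<mu>: "\<mu> \<in> \<M>"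
        have "a E + a F \<le> emeasure \<mu> E + emeasure \<mu> F" by (intro add_mono a_le \<mu>)
        also have "\<dots> = emeasure \<mu> (E \<union> F)" using E F EF sets\<mu>[OF \<mu>] by (intro plus_emeasure) auto
        finally show "a E + a F \<le> emeasure \<mu> (E \<union> F)" .
      qed
    qed
  qed
  have ca: "countably_additive (sets ?M) a"
  proof (rule sets.empty_continuous_imp_countably_additive[OF pos add])
    show "\<forall>E\<in>sets ?M. a E \<noteq> \<infinity>" using a_fin by (metis less_irrefl)
    fix E :: "nat \<Rightarrow> _" assume E: "range E \<subseteq> sets ?M" "decseq E" "(\<Inter>i. E i) = {}"
    have "(\<lambda>i. emeasure \<mu>0 (E i)) \<longlonglongrightarrow> emeasure \<mu>0 (\<Inter>i. E i)"
      using E sets\<mu>[OF \<mu>0] em_fin[OF \<mu>0] by (intro Lim_emeasure_decseq) (auto simp: less_top)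
    then have "(\<lambda>i. emeasure \<mu>0 (E i)) \<longlonglongrightarrow> 0" using E(3) by simp
    then show "(\<lambda>i. a (E i)) \<longlonglongrightarrow> 0"
      by (rule tendsto_sandwich[OF always_eventually always_eventually tendsto_const, rotated 2])
        (simp_all add: a_le[OF \<mu>0])
  qed
  define \<alpha> where "\<alpha> = measure_of (space ?M) (sets ?M) a"
  have s\<alpha>: "sets \<alpha> = sets ?M" by (simp add: \<alpha>_def)
  have sp\<alpha>: "space \<alpha> = X" using sets_eq_imp_space_eq[OF s\<alpha>] spM by simp
  have e\<alpha>: "emeasure \<alpha> E = a E" if "E \<in> sets ?M" for E
    unfolding \<alpha>_def by (rule emeasure_measure_of_sigma[OF sets.sigma_algebra_axioms pos ca that])
  have fin\<alpha>: "finite_Borel_measure X \<alpha>"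
    using e\<alpha>[OF XM] a_fin[of X] s\<alpha> sp\<alpha> by (auto simp: finite_Borel_measure_def intro!: finite_measureI)
  have "\<bar>T f p\<bar> \<le> l * (\<integral>x. \<bar>f x\<bar> \<partial>\<alpha>)" if f: "f \<in> Lip\<^sub>b X" and p: "l-lipschitz_on X p" for f p l
  proof -
    obtain L B where B: "L-lipschitz_on X f" "0 \<le> B" "\<And>x. x \<in> X \<Longrightarrow> \<bar>f x\<bar> \<le> B" using Lip\<^sub>b_E[OF f] by blast
    have l: "0 \<le> l" using lipschitz_on_nonneg[OF p] .
    have "\<bar>T f p\<bar> \<le> l * (\<integral>x. \<bar>f x\<bar> \<partial>\<alpha>) + e" if e: "0 < e" for e
    proof -
      define e' where "e' = e / (l * B + 1)"
      have "0 \<le> l * B" using l B(2) by simp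
      then have e': "0 < e'" "l * B * e' \<le> e" using e by (auto simp: e'_def divide_simps)
      \<comment> \<open>As \<alpha> \<le> \<mu>, a dominating \<mu> of nearly minimal total mass is
        close to \<alpha> on every set.\<close>
      have "a X < a X + ennreal e'" using a_fin e' by (simp add: less_top)
      then obtain \<mu> where \<mu>: "\<mu> \<in> \<M>" "emeasure \<mu> X < a X + ennreal e'"
        unfolding a_def INF_less_iff by blast
      interpret m: finite_measure \<mu> by (rule finite_Borel_finite_measure[OF fin[OF \<mu>(1)]])
      interpret al: finite_measure \<alpha> by (rule finite_Borel_finite_measure[OF fin\<alpha>])
      have "ennreal (measure \<mu> X) < ennreal (measure \<alpha> X) + ennreal e'"
        using \<mu>(2) e\<alpha>[OF XM] by (simp add: m.emeasure_eq_measure al.emeasure_eq_measure)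
      then have mX: "measure \<mu> X < measure \<alpha> X + e'"
        using e' by (simp flip: ennreal_plus add: ennreal_less_iff)
      have le: "\<alpha> \<le> \<mu>"
      proof -
        have "emeasure \<alpha> E \<le> emeasure \<mu> E" for E
          using e\<alpha>[of E] a_le[OF \<mu>(1), of E] s\<alpha> by (cases "E \<in> sets ?M") (auto simp: emeasure_notin_sets)
        then show ?thesis using s\<alpha> sets\<mu>[OF \<mu>(1)] sp\<alpha> sp[OF \<mu>(1)] by (simp add: le_measure_iff le_fun_def)
      qed
      note bB = Lip\<^sub>b_imp_bounded_Borel[OF f]
      have int: "integrable \<mu> (\<lambda>x. \<bar>f x\<bar>)" "integrable \<alpha> (\<lambda>x. \<bar>f x\<bar>)"
        using bounded_Borel_integrable[OF _ bB] fin[OF \<mu>(1)] fin\<alpha> by auto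
      \<comment> \<open>Monotonicity in the measure is applied to B - \<bar>f\<bar> rather than
        \<bar>f\<bar>; in this way \<alpha> \<le> \<mu> yields an upper bound for the integral of
        \<bar>f\<bar> against \<mu>.\<close>
      have "ennreal (\<integral>x. B - \<bar>f x\<bar> \<partial>\<alpha>) = (\<integral>\<^sup>+x. ennreal (B - \<bar>f x\<bar>) \<partial>\<alpha>)"
        using int B sp\<alpha> by (intro nn_integral_eq_integral[symmetric]) auto
      also have "\<dots> \<le> (\<integral>\<^sup>+x. ennreal (B - \<bar>f x\<bar>) \<partial>\<mu>)"
        using le s\<alpha> sets\<mu>[OF \<mu>(1)] by (intro nn_integral_mono_measure) auto
      also have "\<dots> = ennreal (\<integral>x. B - \<bar>f x\<bar> \<partial>\<mu>)"
        using int B sp[OF \<mu>(1)] by (intro nn_integral_eq_integral) auto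
      finally have "(\<integral>x. B - \<bar>f x\<bar> \<partial>\<alpha>) \<le> (\<integral>x. B - \<bar>f x\<bar> \<partial>\<mu>)"
        using B sp[OF \<mu>(1)] by (subst (asm) ennreal_le_iff) (auto intro!: integral_nonneg_AE)
      then have "B * measure \<alpha> X - (\<integral>x. \<bar>f x\<bar> \<partial>\<alpha>) \<le> B * measure \<mu> X - (\<integral>x. \<bar>f x\<bar> \<partial>\<mu>)"
        using int sp\<alpha> sp[OF \<mu>(1)] by (simp add: mult.commute)
      then have "(\<integral>x. \<bar>f x\<bar> \<partial>\<mu>) \<le> (\<integral>x. \<bar>f x\<bar> \<partial>\<alpha>) + B * (measure \<mu> X - measure \<alpha> X)"
        by (simp add: algebra_simps)
      also have "\<dots> \<le> (\<integral>x. \<bar>f x\<bar> \<partial>\<alpha>) + B * e'"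
        using mX B(2) by (intro add_left_mono mult_left_mono) auto
      finally have "l * (\<integral>x. \<bar>f x\<bar> \<partial>\<mu>) \<le> l * ((\<integral>x. \<bar>f x\<bar> \<partial>\<alpha>) + B * e')" using l by (rule mult_left_mono)
      moreover have "\<bar>T f p\<bar> \<le> l * (\<integral>x. \<bar>f x\<bar> \<partial>\<mu>)"
        using \<mu>(1) f p current_with_bound unfolding \<M>_def by blast
      ultimately show ?thesis using e'(2) by (simp add: algebra_simps)
    qed
    then show ?thesis by (rule field_le_epsilon)
  qed
  then have "current_with X T \<alpha>" using fin\<alpha> T unfolding current_with_def mass_bound_iff by blast
  moreover have "emeasure \<alpha> E \<le> emeasure \<nu> E" if "current_with X T \<nu>" "E \<in> sets ?M" for \<nu> E
    using that e\<alpha> a_le[of \<nu>] by (simp add: \<M>_def)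
  ultimately show ?thesis using that by blast
qed

text \<open>Two least dominating measures agree on all Borel sets, so the description operator picks
  the one just constructed.\<close>

lemma mass_measure_minimal:
  assumes T: "metric_1_current X T"
  shows current_with_mass_measure: "current_with X T (mass_measure X T)"
    and mass_measure_le: "\<And>\<nu> E. current_with X T \<nu> \<Longrightarrow> E \<in> sets (restrict_space borel X) \<Longrightarrow>
      emeasure (mass_measure X T) E \<le> emeasure \<nu> E"
proof -
  obtain \<alpha> where \<alpha>: "current_with X T \<alpha>"
    "\<And>\<nu> E. current_with X T \<nu> \<Longrightarrow> E \<in> sets (restrict_space borel X) \<Longrightarrow> emeasure \<alpha> E \<le> emeasure \<nu> E"
    using exists_minimal_mass_bound[OF T] by blast
  have iff: "current_with X T \<mu> \<longleftrightarrow> mass_bound X (Lip\<^sub>b X) T \<mu>" for \<mu> using T by (simp add: current_with_def)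
  have "mass_measure X T = \<alpha>" unfolding mass_measure_def
  proof (rule the_equality)
    show "mass_bound X (Lip\<^sub>b X) T \<alpha> \<and> (\<forall>\<nu>. mass_bound X (Lip\<^sub>b X) T \<nu> \<longrightarrow>
      (\<forall>A\<in>sets (restrict_space borel X). emeasure \<alpha> A \<le> emeasure \<nu> A))"
      using \<alpha> iff by blast
    fix \<mu> assume \<mu>: "mass_bound X (Lip\<^sub>b X) T \<mu> \<and> (\<forall>\<nu>. mass_bound X (Lip\<^sub>b X) T \<nu> \<longrightarrow>
      (\<forall>A\<in>sets (restrict_space borel X). emeasure \<mu> A \<le> emeasure \<nu> A))"
    then have "current_with X T \<mu>" using iff by blast
    have s: "sets \<mu> = sets (restrict_space borel X)" "sets \<alpha> = sets (restrict_space borel X)"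
      using \<open>current_with X T \<mu>\<close> \<alpha>(1) current_with_finite finite_Borel_sets by blast+
    show "\<mu> = \<alpha>"
    proof (rule measure_eqI)
      fix A assume "A \<in> sets \<mu>"
      then have "A \<in> sets (restrict_space borel X)" using s by simp
      then show "emeasure \<mu> A = emeasure \<alpha> A"
        using \<mu> \<alpha> iff by (intro antisym) blast+
    qed (simp add: s)
  qed
  then show "current_with X T (mass_measure X T)"
    "\<And>\<nu> E. current_with X T \<nu> \<Longrightarrow> E \<in> sets (restrict_space borel X) \<Longrightarrow>
      emeasure (mass_measure X T) E \<le> emeasure \<nu> E" using \<alpha> by simp_all
qed

text \<open>Transfers estimates from the mass measure, which is not explicit for a sum of currents,
  to a dominating measure that is.\<close>

lemma mass_measure_mono:
  assumes T: "current_with X T \<nu>" and f: "f \<in> bounded_Borel X"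
  shows "(\<integral>x. \<bar>f x\<bar> \<partial>mass_measure X T) \<le> (\<integral>x. \<bar>f x\<bar> \<partial>\<nu>)"
    and "mass X T \<le> measure \<nu> X"
proof -
  let ?\<mu> = "mass_measure X T"
  have m: "metric_1_current X T" using T by (simp add: current_with_def)
  have fin: "finite_Borel_measure X ?\<mu>" "finite_Borel_measure X \<nu>"
    using current_with_finite[OF current_with_mass_measure[OF m]] current_with_finite[OF T] .
  have s: "sets ?\<mu> = sets (restrict_space borel X)" "sets \<nu> = sets (restrict_space borel X)"
    using fin finite_Borel_sets by blast+
  have "emeasure ?\<mu> E \<le> emeasure \<nu> E" for E
    using mass_measure_le[OF m T, of E] s by (cases "E \<in> sets ?\<mu>") (auto simp: emeasure_notin_sets)
  then have le: "?\<mu> \<le> \<nu>" using s sets_eq_imp_space_eq[of ?\<mu> \<nu>] by (simp add: le_measure_iff le_fun_def)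
  have "ennreal (\<integral>x. \<bar>f x\<bar> \<partial>?\<mu>) = (\<integral>\<^sup>+x. ennreal \<bar>f x\<bar> \<partial>?\<mu>)"
    using bounded_Borel_integrable[OF fin(1) f] by (intro nn_integral_eq_integral[symmetric]) auto
  also have "\<dots> \<le> (\<integral>\<^sup>+x. ennreal \<bar>f x\<bar> \<partial>\<nu>)"
    using le s by (intro nn_integral_mono_measure) auto
  also have "\<dots> = ennreal (\<integral>x. \<bar>f x\<bar> \<partial>\<nu>)"
    using bounded_Borel_integrable[OF fin(2) f] by (intro nn_integral_eq_integral) auto
  finally show "(\<integral>x. \<bar>f x\<bar> \<partial>?\<mu>) \<le> (\<integral>x. \<bar>f x\<bar> \<partial>\<nu>)"
    by (subst (asm) ennreal_le_iff) auto
  interpret m: finite_measure ?\<mu> by (rule finite_Borel_finite_measure[OF fin(1)])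
  interpret n: finite_measure \<nu> by (rule finite_Borel_finite_measure[OF fin(2)])
  have "emeasure ?\<mu> X \<le> emeasure \<nu> X"
    using le s by (intro le_measureD3) auto
  then show "mass X T \<le> measure \<nu> X"
    by (simp add: mass_def m.emeasure_eq_measure n.emeasure_eq_measure)
qed

section \<open>Extension to bounded Borel functions\<close>

text \<open>\<open>Borel_extension\<close> is chosen by \<open>SOME\<close>, so a witness with the
  three properties must exist. It is the extension by continuity: the mass bound makes T(., p)
  Lipschitz with respect to L1 of the mass measure, where bounded Lipschitz functions are
  dense.\<close>

lemma Borel_extension_props:
  fixes X :: "'a::metric_space set"
  assumes T: "metric_1_current X T"
  shows "bilinear_on (bounded_Borel X) (Lip X) (Borel_extension X T)"
    and "\<And>f p. f \<in> Lip\<^sub>b X \<Longrightarrow> p \<in> Lip X \<Longrightarrow> Borel_extension X T f p = T f p"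
    and "mass_bound X (bounded_Borel X) (Borel_extension X T) (mass_measure X T)"
proof -
  let ?\<mu> = "mass_measure X T"
  note cw = current_with_mass_measure[OF T]
  note fin = current_with_finite[OF cw]
  note int = bounded_Borel_integrable[OF fin]
  note L2B = Lip\<^sub>b_imp_bounded_Borel
  have bdiff: "(\<lambda>x. f x - g x) \<in> bounded_Borel X" if "f \<in> bounded_Borel X" "g \<in> bounded_Borel X" for f g
    using bounded_Borel_lin[OF that, of 1 "-1"] by simp
  have idiff: "integrable ?\<mu> (\<lambda>x. \<bar>f x - g x\<bar>)" if "f \<in> bounded_Borel X" "g \<in> bounded_Borel X" for f g
    by (intro integrable_abs int bdiff that)
  \<comment> \<open>Two Lipschitz approximations of the same f have close values; this gives both
    the Cauchy property and independence of the approximation.\<close>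
  have Tdiff: "\<bar>T g p - T h p\<bar> \<le> LIP X p * ((\<integral>x. \<bar>g x - f x\<bar> \<partial>?\<mu>) + (\<integral>x. \<bar>h x - f x\<bar> \<partial>?\<mu>))"
    if "g \<in> Lip\<^sub>b X" "h \<in> Lip\<^sub>b X" "f \<in> bounded_Borel X" "p \<in> Lip X" for g h f p
  proof -
    have gh: "(\<lambda>x. g x - h x) \<in> Lip\<^sub>b X" using Lip\<^sub>b_lin[OF that(1,2), of 1 "-1"] by simp
    have "T g p - T h p = T (\<lambda>x. g x - h x) p" using current_with_diff_left[OF cw that(1,2,4)] by simp
    also have "\<bar>\<dots>\<bar> \<le> LIP X p * (\<integral>x. \<bar>g x - h x\<bar> \<partial>?\<mu>)"
      by (rule current_with_bound[OF cw gh Lip_lipschitz_on[OF that(4)]])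
    also have "(\<integral>x. \<bar>g x - h x\<bar> \<partial>?\<mu>) \<le> (\<integral>x. \<bar>g x - f x\<bar> + \<bar>h x - f x\<bar> \<partial>?\<mu>)"
      by (intro integral_mono idiff Bochner_Integration.integrable_add L2B that) simp
    also have "\<dots> = (\<integral>x. \<bar>g x - f x\<bar> \<partial>?\<mu>) + (\<integral>x. \<bar>h x - f x\<bar> \<partial>?\<mu>)"
      by (intro Bochner_Integration.integral_add idiff L2B that)
    finally show ?thesis using LIP_nonneg[OF that(4)] by (simp add: mult_left_mono)
  qed
  have "\<forall>f. f \<in> bounded_Borel X \<longrightarrow> (\<exists>g. \<forall>n. g n \<in> Lip\<^sub>b X \<and> (\<integral>x. \<bar>g n x - f x\<bar> \<partial>?\<mu>) < inverse (real (Suc n)))"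
  proof (intro allI impI)
    fix f assume f: "f \<in> bounded_Borel X"
    have "\<forall>n. \<exists>g. g \<in> Lip\<^sub>b X \<and> (\<integral>x. \<bar>g x - f x\<bar> \<partial>?\<mu>) < inverse (real (Suc n))"
      using integrable_approx_Lip[OF fin int[OF f], of "inverse (real (Suc n))" for n]
      by (auto simp: Bex_def)
    then show "\<exists>g. \<forall>n. g n \<in> Lip\<^sub>b X \<and> (\<integral>x. \<bar>g n x - f x\<bar> \<partial>?\<mu>) < inverse (real (Suc n))" by metis
  qed
  then obtain G where G: "\<And>f n. f \<in> bounded_Borel X \<Longrightarrow> G f n \<in> Lip\<^sub>b X"
    "\<And>f n. f \<in> bounded_Borel X \<Longrightarrow> (\<integral>x. \<bar>G f n x - f x\<bar> \<partial>?\<mu>) < inverse (real (Suc n))" by metis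
  have G0: "(\<lambda>n. \<integral>x. \<bar>G f n x - f x\<bar> \<partial>?\<mu>) \<longlonglongrightarrow> 0" if "f \<in> bounded_Borel X" for f
  proof (rule tendsto_sandwich[OF always_eventually always_eventually tendsto_const LIMSEQ_inverse_real_of_nat]; intro allI)
    show "(\<integral>x. \<bar>G f n x - f x\<bar> \<partial>?\<mu>) \<le> inverse (real (Suc n))" for n
      using G(2)[OF that, of n] by (rule less_imp_le)
  qed simp
  define S where "S f p = lim (\<lambda>n. T (G f n) p)" for f p
  have cauchy: "Cauchy (\<lambda>n. T (G f n) p)" if f: "f \<in> bounded_Borel X" and p: "p \<in> Lip X" for f p
  proof (rule metric_CauchyI)
    fix e :: real assume e: "0 < e"
    have "(\<lambda>n. 2 * (LIP X p * inverse (real (Suc n)))) \<longlonglongrightarrow> 2 * (LIP X p * 0)"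
      by (intro tendsto_mult tendsto_const LIMSEQ_inverse_real_of_nat)
    then have "\<forall>\<^sub>F n in sequentially. 2 * (LIP X p * inverse (real (Suc n))) < e"
      using e by (intro order_tendstoD(2)) auto
    then obtain N where N: "\<And>n. n \<ge> N \<Longrightarrow> 2 * (LIP X p * inverse (real (Suc n))) < e"
      by (auto simp: eventually_sequentially)
    have "dist (T (G f m) p) (T (G f n) p) < e" if "m \<ge> N" "n \<ge> N" for m n
    proof -
      have "\<bar>T (G f m) p - T (G f n) p\<bar> \<le> LIP X p * ((\<integral>x. \<bar>G f m x - f x\<bar> \<partial>?\<mu>) + (\<integral>x. \<bar>G f n x - f x\<bar> \<partial>?\<mu>))"
        by (rule Tdiff[OF G(1) G(1) f p]) (rule f)+
      also have "\<dots> \<le> LIP X p * (inverse (real (Suc m)) + inverse (real (Suc n)))"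
        by (intro mult_left_mono add_mono less_imp_le[OF G(2)[OF f]] LIP_nonneg p)
      also have "\<dots> < e" using N[OF that(1)] N[OF that(2)] unfolding distrib_left by linarith
      finally show ?thesis by (simp add: dist_real_def)
    qed
    then show "\<exists>N. \<forall>m\<ge>N. \<forall>n\<ge>N. dist (T (G f m) p) (T (G f n) p) < e" by blast
  qed
  \<comment> \<open>Every L1-approximating sequence leads to the same limit. Linearity of
    \<open>S\<close> in \<open>f\<close> then follows by combining the sequences chosen for the
    summands.\<close>
  have Slim: "(\<lambda>n. T (h n) p) \<longlonglongrightarrow> S f p"
    if f: "f \<in> bounded_Borel X" and p: "p \<in> Lip X" and h: "\<And>n. h n \<in> Lip\<^sub>b X"
      "(\<lambda>n. \<integral>x. \<bar>h n x - f x\<bar> \<partial>?\<mu>) \<longlonglongrightarrow> 0" for f p h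
  proof -
    have l1: "(\<lambda>n. T (G f n) p) \<longlonglongrightarrow> S f p"
      unfolding S_def using Cauchy_convergent[OF cauchy[OF f p]] unfolding convergent_LIMSEQ_iff .
    have l0: "(\<lambda>n. LIP X p * ((\<integral>x. \<bar>h n x - f x\<bar> \<partial>?\<mu>) + (\<integral>x. \<bar>G f n x - f x\<bar> \<partial>?\<mu>))) \<longlonglongrightarrow> LIP X p * (0 + 0)"
      by (intro tendsto_add tendsto_mult tendsto_const h(2) G0[OF f])
    have "(\<lambda>n. T (h n) p - T (G f n) p) \<longlonglongrightarrow> 0"
    proof (rule Lim_null_comparison[OF always_eventually])
      show "\<forall>n. norm (T (h n) p - T (G f n) p) \<le>
        LIP X p * ((\<integral>x. \<bar>h n x - f x\<bar> \<partial>?\<mu>) + (\<integral>x. \<bar>G f n x - f x\<bar> \<partial>?\<mu>))"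
        using Tdiff[OF h(1) G(1)[OF f] f p] by (simp only: real_norm_def simp_thms)
      show "(\<lambda>n. LIP X p * ((\<integral>x. \<bar>h n x - f x\<bar> \<partial>?\<mu>) + (\<integral>x. \<bar>G f n x - f x\<bar> \<partial>?\<mu>))) \<longlonglongrightarrow> 0"
        using l0 by (simp only: add_0_right mult_zero_right)
    qed
    from tendsto_add[OF this l1] show ?thesis by (simp only: diff_add_cancel add_0_left)
  qed
  have SlimG: "(\<lambda>n. T (G f n) p) \<longlonglongrightarrow> S f p" if "f \<in> bounded_Borel X" "p \<in> Lip X" for f p
    by (rule Slim[OF that G(1)[OF that(1)] G0[OF that(1)]])
  have Sext: "S f p = T f p" if "f \<in> Lip\<^sub>b X" "p \<in> Lip X" for f p
    using LIMSEQ_unique[OF Slim[OF L2B[OF that(1)] that(2), of "\<lambda>_. f"] tendsto_const] that by simp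
  have Sbil: "bilinear_on (bounded_Borel X) (Lip X) S"
    unfolding bilinear_on_def
  proof (intro conjI ballI allI)
    fix f g p :: "'a \<Rightarrow> real" and a b assume H: "f \<in> bounded_Borel X" "g \<in> bounded_Borel X" "p \<in> Lip X"
    let ?h = "\<lambda>n x. a * G f n x + b * G g n x"
    have "(\<lambda>n. T (?h n) p) \<longlonglongrightarrow> S (\<lambda>x. a * f x + b * g x) p"
    proof (rule Slim[OF bounded_Borel_lin[OF H(1,2)] H(3)])
      show hL: "?h n \<in> Lip\<^sub>b X" for n by (rule Lip\<^sub>b_lin[OF G(1)[OF H(1)] G(1)[OF H(2)]])
      show "(\<lambda>n. \<integral>x. \<bar>?h n x - (a * f x + b * g x)\<bar> \<partial>?\<mu>) \<longlonglongrightarrow> 0"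
      proof (rule tendsto_sandwich[OF _ _ tendsto_const])
        show "\<forall>\<^sub>F n in sequentially. 0 \<le> (\<integral>x. \<bar>?h n x - (a * f x + b * g x)\<bar> \<partial>?\<mu>)" by simp
        show "\<forall>\<^sub>F n in sequentially. (\<integral>x. \<bar>?h n x - (a * f x + b * g x)\<bar> \<partial>?\<mu>) \<le>
          \<bar>a\<bar> * (\<integral>x. \<bar>G f n x - f x\<bar> \<partial>?\<mu>) + \<bar>b\<bar> * (\<integral>x. \<bar>G g n x - g x\<bar> \<partial>?\<mu>)"
        proof (intro always_eventually allI)
          fix n
          have i: "integrable ?\<mu> (\<lambda>x. \<bar>G f n x - f x\<bar>)" "integrable ?\<mu> (\<lambda>x. \<bar>G g n x - g x\<bar>)"
            by (intro idiff L2B G(1) H(1,2))+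
          have "(\<integral>x. \<bar>?h n x - (a * f x + b * g x)\<bar> \<partial>?\<mu>) \<le> (\<integral>x. \<bar>a\<bar> * \<bar>G f n x - f x\<bar> + \<bar>b\<bar> * \<bar>G g n x - g x\<bar> \<partial>?\<mu>)"
          proof (rule integral_mono)
            show "integrable ?\<mu> (\<lambda>x. \<bar>?h n x - (a * f x + b * g x)\<bar>)"
              by (intro integrable_abs int bdiff bounded_Borel_lin H L2B hL)
            show "\<bar>?h n x - (a * f x + b * g x)\<bar> \<le> \<bar>a\<bar> * \<bar>G f n x - f x\<bar> + \<bar>b\<bar> * \<bar>G g n x - g x\<bar>" for x
            proof -
              have "?h n x - (a * f x + b * g x) = a * (G f n x - f x) + b * (G g n x - g x)" by (simp add: algebra_simps)
              then show ?thesis by (metis abs_mult abs_triangle_ineq)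
            qed
          qed (use i in auto)
          also have "\<dots> = \<bar>a\<bar> * (\<integral>x. \<bar>G f n x - f x\<bar> \<partial>?\<mu>) + \<bar>b\<bar> * (\<integral>x. \<bar>G g n x - g x\<bar> \<partial>?\<mu>)"
            using i by simp
          finally show "(\<integral>x. \<bar>?h n x - (a * f x + b * g x)\<bar> \<partial>?\<mu>) \<le>
            \<bar>a\<bar> * (\<integral>x. \<bar>G f n x - f x\<bar> \<partial>?\<mu>) + \<bar>b\<bar> * (\<integral>x. \<bar>G g n x - g x\<bar> \<partial>?\<mu>)" .
        qed
        have "(\<lambda>n. \<bar>a\<bar> * (\<integral>x. \<bar>G f n x - f x\<bar> \<partial>?\<mu>) + \<bar>b\<bar> * (\<integral>x. \<bar>G g n x - g x\<bar> \<partial>?\<mu>)) \<longlonglongrightarrow> \<bar>a\<bar> * 0 + \<bar>b\<bar> * 0"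
          by (intro tendsto_add tendsto_mult tendsto_const G0[OF H(1)] G0[OF H(2)])
        then show "(\<lambda>n. \<bar>a\<bar> * (\<integral>x. \<bar>G f n x - f x\<bar> \<partial>?\<mu>) + \<bar>b\<bar> * (\<integral>x. \<bar>G g n x - g x\<bar> \<partial>?\<mu>)) \<longlonglongrightarrow> 0" by simp
      qed
    qed
    moreover have "T (?h n) p = a * T (G f n) p + b * T (G g n) p" for n
      by (rule current_with_lin_left[OF cw G(1)[OF H(1)] G(1)[OF H(2)] H(3)])
    moreover have "(\<lambda>n. a * T (G f n) p + b * T (G g n) p) \<longlonglongrightarrow> a * S f p + b * S g p"
      by (intro tendsto_add tendsto_mult tendsto_const SlimG H)
    ultimately show "S (\<lambda>x. a * f x + b * g x) p = a * S f p + b * S g p"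
      using LIMSEQ_unique by auto
  next
    fix f p q :: "'a \<Rightarrow> real" and a b assume H: "f \<in> bounded_Borel X" "p \<in> Lip X" "q \<in> Lip X"
    have "(\<lambda>n. T (G f n) (\<lambda>x. a * p x + b * q x)) \<longlonglongrightarrow> S f (\<lambda>x. a * p x + b * q x)"
      by (rule SlimG[OF H(1) Lip_lin[OF H(2,3)]])
    moreover have "T (G f n) (\<lambda>x. a * p x + b * q x) = a * T (G f n) p + b * T (G f n) q" for n
      by (rule current_with_lin_right[OF cw G(1)[OF H(1)] H(2,3)])
    moreover have "(\<lambda>n. a * T (G f n) p + b * T (G f n) q) \<longlonglongrightarrow> a * S f p + b * S f q"
      by (intro tendsto_add tendsto_mult tendsto_const SlimG H)
    ultimately show "S f (\<lambda>x. a * p x + b * q x) = a * S f p + b * S f q"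
      using LIMSEQ_unique by auto
  qed
  have Smass: "mass_bound X (bounded_Borel X) S ?\<mu>"
    unfolding mass_bound_iff
  proof (intro conjI ballI allI impI fin)
    fix f p :: "'a \<Rightarrow> real" and l assume f: "f \<in> bounded_Borel X" and p: "l-lipschitz_on X p"
    have l0: "0 \<le> l" using lipschitz_on_nonneg[OF p] .
    have "(\<lambda>n. \<bar>T (G f n) p\<bar>) \<longlonglongrightarrow> \<bar>S f p\<bar>"
      by (rule tendsto_rabs[OF SlimG[OF f LipI[OF p]]])
    moreover have "(\<lambda>n. l * ((\<integral>x. \<bar>f x\<bar> \<partial>?\<mu>) + (\<integral>x. \<bar>G f n x - f x\<bar> \<partial>?\<mu>))) \<longlonglongrightarrow> l * ((\<integral>x. \<bar>f x\<bar> \<partial>?\<mu>) + 0)"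
      by (intro tendsto_add tendsto_mult tendsto_const G0[OF f])
    moreover have "\<bar>T (G f n) p\<bar> \<le> l * ((\<integral>x. \<bar>f x\<bar> \<partial>?\<mu>) + (\<integral>x. \<bar>G f n x - f x\<bar> \<partial>?\<mu>))" for n
    proof -
      have i: "integrable ?\<mu> (\<lambda>x. \<bar>G f n x - f x\<bar>)" "integrable ?\<mu> (\<lambda>x. \<bar>f x\<bar>)" "integrable ?\<mu> (\<lambda>x. \<bar>G f n x\<bar>)"
        using idiff[OF L2B[OF G(1)[OF f, of n]] f] integrable_abs[OF int[OF f]]
          integrable_abs[OF int[OF L2B[OF G(1)[OF f, of n]]]] .
      have "\<bar>T (G f n) p\<bar> \<le> l * (\<integral>x. \<bar>G f n x\<bar> \<partial>?\<mu>)"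
        by (rule current_with_bound[OF cw G(1)[OF f] p])
      also have "(\<integral>x. \<bar>G f n x\<bar> \<partial>?\<mu>) \<le> (\<integral>x. \<bar>f x\<bar> + \<bar>G f n x - f x\<bar> \<partial>?\<mu>)"
        using i by (intro integral_mono) auto
      also have "\<dots> = (\<integral>x. \<bar>f x\<bar> \<partial>?\<mu>) + (\<integral>x. \<bar>G f n x - f x\<bar> \<partial>?\<mu>)" using i by simp
      finally show ?thesis using l0 by (simp add: mult_left_mono)
    qed
    ultimately show "\<bar>S f p\<bar> \<le> l * (\<integral>x. \<bar>f x\<bar> \<partial>?\<mu>)"
      using LIMSEQ_le by fastforce
  qed
  let ?P = "\<lambda>S. bilinear_on (bounded_Borel X) (Lip X) S \<and> (\<forall>f\<in>Lip\<^sub>b X. \<forall>p\<in>Lip X. S f p = T f p) \<and>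
    mass_bound X (bounded_Borel X) S ?\<mu>"
  have "?P (Borel_extension X T)"
    unfolding Borel_extension_def by (rule someI[of ?P S]) (use Sext Sbil Smass in blast)
  then show "bilinear_on (bounded_Borel X) (Lip X) (Borel_extension X T)"
    and "\<And>f p. f \<in> Lip\<^sub>b X \<Longrightarrow> p \<in> Lip X \<Longrightarrow> Borel_extension X T f p = T f p"
    and "mass_bound X (bounded_Borel X) (Borel_extension X T) ?\<mu>" by blast+
qed

section \<open>Integration along Lipschitz curves\<close>

text \<open>Left Riemann-Stieltjes sums for the integral of u dv over the unit interval. For
  Lipschitz u and v they converge along dyadic partitions, so the integral along a curve is defined
  without differentiating it.\<close>

definition dyadic_sum :: "(real \<Rightarrow> real) \<Rightarrow> (real \<Rightarrow> real) \<Rightarrow> nat \<Rightarrow> real"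
  where "dyadic_sum u v n = (\<Sum>k<2^n. u (real k / 2^n) * (v ((real k + 1) / 2^n) - v (real k / 2^n)))"

lemma geometric_increments:
  fixes a :: "nat \<Rightarrow> real"
  assumes step: "\<And>n. \<bar>a (Suc n) - a n\<bar> \<le> c / 2^n"
  shows "a \<longlonglongrightarrow> lim a" and "\<bar>a n - lim a\<bar> \<le> 2 * c / 2^n"
proof -
  have c: "0 \<le> c" using step[of 0] by simp
  \<comment> \<open>The exact geometric partial sum is the invariant that survives the induction;
    dropping its negative term gives the bound 2c/2^n.\<close>
  have *: "\<bar>a (n + k) - a n\<bar> \<le> 2 * c / 2^n - 2 * c / 2^(n + k)" for n k
  proof (induction k)
    case (Suc k)
    have "\<bar>a (n + Suc k) - a n\<bar> \<le> \<bar>a (n + k) - a n\<bar> + c / 2^(n + k)"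
      using step[of "n + k"] by simp
    also have "\<dots> \<le> 2 * c / 2^n - 2 * c / 2^(n + k) + c / 2^(n + k)" using Suc by simp
    also have "\<dots> = 2 * c / 2^n - 2 * c / 2^(n + Suc k)" by (simp add: field_simps)
    finally show ?case .
  qed simp
  have le: "\<bar>a m - a n\<bar> \<le> 2 * c / 2^n" if "n \<le> m" for m n
  proof -
    have "0 \<le> 2 * c / 2^m" using c by simp
    then show ?thesis using *[of n "m - n"] that by simp
  qed
  have "Cauchy a"
  proof (rule metric_CauchyI)
    fix e :: real assume e: "0 < e"
    have "(\<lambda>n. 2 * c * (1/2)^n) \<longlonglongrightarrow> 2 * c * 0" by (intro tendsto_mult tendsto_const LIMSEQ_power_zero) simp
    then have "\<forall>\<^sub>F n in sequentially. 2 * c * (1/2)^n < e/2" using e by (intro order_tendstoD(2)) auto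
    then obtain N where "2 * c * (1/2)^N < e/2" by (auto simp: eventually_sequentially)
    then have N: "2 * c / 2^N < e/2" by (simp add: power_divide)
    have "dist (a m) (a n) < e" if "m \<ge> N" "n \<ge> N" for m n
      using le[OF that(1)] le[OF that(2)] N unfolding dist_real_def by linarith
    then show "\<exists>N. \<forall>m\<ge>N. \<forall>n\<ge>N. dist (a m) (a n) < e" by blast
  qed
  then show lim: "a \<longlonglongrightarrow> lim a" by (metis Cauchy_convergent convergent_LIMSEQ_iff)
  have "(\<lambda>m. \<bar>a m - a n\<bar>) \<longlonglongrightarrow> \<bar>lim a - a n\<bar>"
    by (intro tendsto_rabs tendsto_diff lim tendsto_const)
  then have "\<bar>lim a - a n\<bar> \<le> 2 * c / 2^n"
    by (rule LIMSEQ_le_const2) (use le in blast)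
  then show "\<bar>a n - lim a\<bar> \<le> 2 * c / 2^n" by (simp add: abs_minus_commute)
qed

lemma dyadic_points:
  assumes "k < 2^n"
  shows "real k / 2^n \<in> {0..1}" "(real k + 1) / 2^n \<in> {0..1}"
proof -
  have "Suc k \<le> 2^n" using assms by simp
  then have "real (Suc k) \<le> real (2^n)" by (simp only: of_nat_le_iff)
  then have "real k + 1 \<le> 2^n" by simp
  moreover from this have "real k \<le> 2^n" by linarith
  ultimately show "real k / 2^n \<in> {0..1}" "(real k + 1) / 2^n \<in> {0..1}" by (auto simp: divide_simps)
qed

lemma dyadic_increment:
  fixes v :: "real \<Rightarrow> real"
  assumes v: "L-lipschitz_on {0..1} v" and k: "k < 2^n"
  shows "\<bar>v ((real k + 1) / 2^n) - v (real k / 2^n)\<bar> \<le> L / 2^n"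
proof -
  have "dist ((real k + 1) / 2^n) (real k / 2^n) = 1 / 2^n"
    by (simp add: dist_real_def diff_divide_distrib[symmetric])
  then show ?thesis using lipschitz_onD[OF v dyadic_points(2,1)[OF k]] by (simp add: dist_real_def)
qed

context
  fixes u v :: "real \<Rightarrow> real" and L M :: real
  assumes u: "L-lipschitz_on {0..1} u" and v: "M-lipschitz_on {0..1} v"
begin

text \<open>Halving a cell from x to z at y changes its term by (u y - u x)(v z - v y), a product of
  two increments of order 2^-n; over 2^n cells the total change is again of order 2^-n.\<close>

lemma dyadic_step: "\<bar>dyadic_sum u v (Suc n) - dyadic_sum u v n\<bar> \<le> L * M / 2^n"
proof -
  have LM: "0 \<le> L" "0 \<le> M" using u v lipschitz_on_nonneg by blast+
  have double: "(\<Sum>k<2 * m. F k) = (\<Sum>k<m. F (2 * k) + F (2 * k + 1))" for F :: "nat \<Rightarrow> real" and m :: nat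
    by (induction m) auto
  let ?x = "\<lambda>k. real k / 2^n" and ?y = "\<lambda>k. (real (2*k+1)) / 2^(Suc n)" and ?z = "\<lambda>k. (real k + 1) / 2^n"
  have pts: "real (2*k) / 2^(Suc n) = ?x k" "(real (2*k) + 1) / 2^(Suc n) = ?y k" "(real (2*k+1) + 1) / 2^(Suc n) = ?z k" for k
  proof -
    show "real (2*k) / 2^(Suc n) = ?x k" by simp
    show "(real (2*k) + 1) / 2^(Suc n) = ?y k" by (simp only: of_nat_add of_nat_1)
    have "real (2*k+1) + 1 = 2 * (real k + 1)" by simp
    then show "(real (2*k+1) + 1) / 2^(Suc n) = ?z k" by (simp only: power_Suc mult_divide_mult_cancel_left)
  qed
  have "dyadic_sum u v (Suc n) = (\<Sum>k<2^n. u (?x k) * (v (?y k) - v (?x k)) + u (?y k) * (v (?z k) - v (?y k)))"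
    unfolding dyadic_sum_def by (subst power_Suc, subst double, subst (1 2) pts(1), subst pts(2), subst pts(3)) (rule refl)
  then have eq: "dyadic_sum u v (Suc n) - dyadic_sum u v n = (\<Sum>k<2^n. (u (?y k) - u (?x k)) * (v (?z k) - v (?y k)))"
    unfolding dyadic_sum_def[of u v n] by (auto simp only: sum_subtractf[symmetric] intro!: sum.cong) (simp add: algebra_simps)
  have "\<bar>dyadic_sum u v (Suc n) - dyadic_sum u v n\<bar> \<le> (\<Sum>k<2^n. \<bar>(u (?y k) - u (?x k)) * (v (?z k) - v (?y k))\<bar>)"
    unfolding eq by (rule sum_abs)
  also have "\<dots> \<le> (\<Sum>k<(2::nat)^n. (L / 2^(Suc n)) * (M / 2^(Suc n)))"
  proof (rule sum_mono)
    fix k :: nat assume "k \<in> {..<2^n}"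
    then have "k < 2^n" by simp
    then have k: "2 * k < 2^(Suc n)" "2 * k + 1 < 2^(Suc n)" unfolding power_Suc by linarith+
    have a: "\<bar>u (?y k) - u (?x k)\<bar> \<le> L / 2^(Suc n)"
      using dyadic_increment[OF u k(1)] unfolding pts .
    have b: "\<bar>v (?z k) - v (?y k)\<bar> \<le> M / 2^(Suc n)"
      using dyadic_increment[OF v k(2)] unfolding pts .
    show "\<bar>(u (?y k) - u (?x k)) * (v (?z k) - v (?y k))\<bar> \<le> (L / 2^(Suc n)) * (M / 2^(Suc n))"
      unfolding abs_mult by (rule mult_mono[OF a b]) (use LM in simp_all)
  qed
  also have "\<dots> = L * M / 2^n / 4" by simp
  also have "\<dots> \<le> L * M / 2^n"
  proof -
    have "a / 4 \<le> a" if "0 \<le> a" for a :: real using that by simp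
    moreover have "0 \<le> L * M / 2^n" using LM by simp
    ultimately show ?thesis .
  qed
  finally show ?thesis .
qed

lemma dyadic_sum_lim: "dyadic_sum u v \<longlonglongrightarrow> lim (dyadic_sum u v)"
  and dyadic_sum_error: "\<bar>dyadic_sum u v n - lim (dyadic_sum u v)\<bar> \<le> 2 * (L * M) / 2^n"
  using geometric_increments[of "dyadic_sum u v" "L * M", OF dyadic_step] .

end

text \<open>On a cell of length h the function stays above its left value minus L h, so each term
  lies below the integral over its cell.\<close>

lemma lipschitz_left_sum_le:
  fixes w :: "real \<Rightarrow> real"
  assumes w: "L-lipschitz_on {0..1} w" and h: "0 < h" and m: "real m * h \<le> 1"
  shows "(\<Sum>k<m. h * (w (real k * h) - L * h)) \<le> integral {0..real m * h} w"
  using m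
proof (induction m)
  case (Suc m)
  have le: "real m * h \<le> real (Suc m) * h" using h by (intro mult_right_mono) auto
  have m0: "0 \<le> real m * h" using h by simp
  have cont: "continuous_on {0..1} w" using lipschitz_on_continuous_on[OF w] .
  have sub: "{0..real (Suc m) * h} \<subseteq> {0..1}" "{real m * h..real (Suc m) * h} \<subseteq> {0..1}"
    using Suc.prems m0 by auto
  have "h * (w (real m * h) - L * h) = integral {real m * h..real (Suc m) * h} (\<lambda>_. w (real m * h) - L * h)"
    using le by (simp add: algebra_simps)
  also have "\<dots> \<le> integral {real m * h..real (Suc m) * h} w"
  proof (rule integral_le)
    show "w integrable_on {real m * h..real (Suc m) * h}"
      by (intro integrable_continuous_interval continuous_on_subset[OF cont] sub)
    fix t assume t: "t \<in> {real m * h..real (Suc m) * h}"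
    have "\<bar>w t - w (real m * h)\<bar> \<le> L * \<bar>t - real m * h\<bar>"
      using lipschitz_onD[OF w, of t "real m * h"] t sub le by (auto simp: dist_real_def)
    also have "\<dots> \<le> L * h" using t lipschitz_on_nonneg[OF w] by (intro mult_left_mono) (auto simp: algebra_simps)
    finally show "w (real m * h) - L * h \<le> w t" by linarith
  qed auto
  finally have "(\<Sum>k<Suc m. h * (w (real k * h) - L * h)) \<le> integral {0..real m * h} w + integral {real m * h..real (Suc m) * h} w"
    using Suc le by simp
  also have "\<dots> = integral {0..real (Suc m) * h} w"
    using le m0 by (intro Henstock_Kurzweil_Integration.integral_combine integrable_continuous_interval
        continuous_on_subset[OF cont] sub)
  finally show ?case .
qed simp

text \<open>The increments of v are at most M/2^n, and the left sum of \<bar>u\<bar> exceeds its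
  integral by at most L/2^n. In the limit this becomes the mass bound for the current of a
  curve.\<close>

lemma dyadic_sum_le:
  fixes u v :: "real \<Rightarrow> real"
  assumes u: "L-lipschitz_on {0..1} u" and v: "M-lipschitz_on {0..1} v"
  shows "\<bar>dyadic_sum u v n\<bar> \<le> M * ((\<integral>t. \<bar>u t\<bar> \<partial>restrict_space lborel {0..1}) + L / 2^n)"
proof -
  have M: "0 \<le> M" using lipschitz_on_nonneg[OF v] .
  have w: "L-lipschitz_on {0..1} (\<lambda>t. \<bar>u t\<bar>)"
  proof (rule lipschitz_onI)
    fix x y :: real assume "x \<in> {0..1}" "y \<in> {0..1}"
    then show "dist \<bar>u x\<bar> \<bar>u y\<bar> \<le> L * dist x y" using lipschitz_onD[OF u, of x y] by (simp add: dist_real_def)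
  qed (rule lipschitz_on_nonneg[OF u])
  have "set_integrable lborel {0..1} (\<lambda>t. \<bar>u t\<bar>)"
    by (rule borel_integrable_atLeastAtMost') (rule lipschitz_on_continuous_on[OF w])
  then have int: "integral {0..1} (\<lambda>t. \<bar>u t\<bar>) = (\<integral>t. \<bar>u t\<bar> \<partial>restrict_space lborel {0..1})"
    by (subst integral_restrict_space)
      (auto dest: set_borel_integral_eq_integral(2) simp: set_lebesgue_integral_def)
  have "\<bar>dyadic_sum u v n\<bar> \<le> (\<Sum>k<2^n. \<bar>u (real k / 2^n)\<bar> * (M / 2^n))"
    unfolding dyadic_sum_def
  proof (rule order_trans[OF sum_abs], rule sum_mono)
    fix k :: nat assume "k \<in> {..<2^n}"
    then show "\<bar>u (real k / 2^n) * (v ((real k + 1) / 2^n) - v (real k / 2^n))\<bar> \<le> \<bar>u (real k / 2^n)\<bar> * (M / 2^n)"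
      unfolding abs_mult by (intro mult_left_mono dyadic_increment[OF v]) auto
  qed
  also have "\<dots> = M * (\<Sum>k<2^n. (1/2^n) * (\<bar>u (real k * (1/2^n))\<bar> - L * (1/2^n))) + M * (\<Sum>k<(2::nat)^n. (1/2^n) * (L * (1/2^n)))"
    unfolding sum_distrib_left sum.distrib[symmetric] by (intro sum.cong refl) (simp add: algebra_simps)
  also have "(\<Sum>k<(2::nat)^n. (1/2^n) * (L * (1/2^n))) = L / 2^n" by (simp add: field_simps)
  also have "(\<Sum>k<2^n. (1/2^n) * (\<bar>u (real k * (1/2^n))\<bar> - L * (1/2^n))) \<le> integral {0..real (2^n) * (1/2^n)} (\<lambda>t. \<bar>u t\<bar>)"
    by (rule lipschitz_left_sum_le[OF w]) auto
  also have "real (2^n) * (1/2^n) = 1" by simp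
  finally show ?thesis using M int by (simp add: distrib_left mult_left_mono)
qed

section \<open>The current of integration along a curve\<close>

definition curve_integral :: "(real \<Rightarrow> 'a) \<Rightarrow> 'a functional"
  where "curve_integral \<gamma> f p = lim (dyadic_sum (\<lambda>t. f (\<gamma> t)) (\<lambda>t. p (\<gamma> t)))"

text \<open>Parameter measure rather than arc length: for a \<kappa>-Lipschitz curve, \<kappa> times
  this measure is dominating, and sets met at finitely many parameters are null at once.\<close>

definition curve_measure :: "'a::metric_space set \<Rightarrow> (real \<Rightarrow> 'a) \<Rightarrow> 'a measure"
  where "curve_measure X \<gamma> = distr (restrict_space lborel {0..1}) (restrict_space borel X) \<gamma>"

lemma integral_scale_measure_nonneg:
  fixes f :: "'a \<Rightarrow> real"
  assumes "f \<in> borel_measurable M" "\<And>x. 0 \<le> f x" "0 \<le> c"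
  shows "integral\<^sup>L (scale_measure (ennreal c) M) f = c * integral\<^sup>L M f"
proof -
  have "f \<in> borel_measurable (scale_measure (ennreal c) M)"
    using assms(1) by (simp cong: measurable_cong_sets)
  then show ?thesis
    using assms by (simp add: integral_eq_nn_integral nn_integral_scale_measure enn2real_mult)
qed

context
  fixes X :: "'a::metric_space set" and \<gamma> :: "real \<Rightarrow> 'a" and \<kappa> :: real
  assumes \<gamma>: "\<kappa>-lipschitz_on {0..1} \<gamma>" and \<gamma>X: "\<gamma> ` {0..1} \<subseteq> X"
begin

lemma curve_measurable: "\<gamma> \<in> restrict_space lborel {0..1} \<rightarrow>\<^sub>M restrict_space borel X"
proof (rule measurable_restrict_space2)
  show "\<gamma> \<in> space (restrict_space lborel {0..1}) \<rightarrow> X" using \<gamma>X by (auto simp: space_restrict_space)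
  have "\<gamma> \<in> borel_measurable (restrict_space borel {0..1})"
    by (rule borel_measurable_continuous_on_restrict[OF lipschitz_on_continuous_on[OF \<gamma>]])
  also have "borel_measurable (restrict_space borel {0..1}) = borel_measurable (restrict_space lborel {0..1})"
    by (rule measurable_cong_sets) (auto simp: sets_restrict_space)
  finally show "\<gamma> \<in> borel_measurable (restrict_space lborel {0..1})" .
qed

lemma emeasure_curve_measure:
  "A \<in> sets (restrict_space borel X) \<Longrightarrow> emeasure (curve_measure X \<gamma>) A = emeasure lborel {t \<in> {0..1}. \<gamma> t \<in> A}"
  unfolding curve_measure_def
  by (subst emeasure_distr[OF curve_measurable])
    (auto simp: emeasure_restrict_space space_restrict_space intro!: arg_cong[where f = "emeasure lborel"])

lemma emeasure_curve_measure_X: "emeasure (curve_measure X \<gamma>) X = 1"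
proof -
  have "X \<in> sets (restrict_space borel X)" by (auto simp: sets_restrict_space)
  moreover have "{t \<in> {0..1}. \<gamma> t \<in> X} = {0..1}" using \<gamma>X by auto
  ultimately show ?thesis using emeasure_curve_measure[of X] by simp
qed

lemma finite_Borel_curve_measure: "finite_Borel_measure X (scale_measure (ennreal c) (curve_measure X \<gamma>))"
proof -
  have "space (scale_measure (ennreal c) (curve_measure X \<gamma>)) = X"
    by (simp add: space_scale_measure curve_measure_def space_restrict_space)
  then show ?thesis
    using emeasure_curve_measure_X unfolding finite_Borel_measure_def
    by (auto intro!: finite_measureI simp: curve_measure_def)
qed

lemma lipschitz_along_curve: "l-lipschitz_on X p \<Longrightarrow> (l * \<kappa>)-lipschitz_on {0..1} (\<lambda>t. p (\<gamma> t))"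
  using lipschitz_on_compose2[OF \<gamma>, of l p] lipschitz_on_subset[OF _ \<gamma>X] by blast

text \<open>Linearity, locality and the mass bound are read off the dyadic sums and passed to the
  limit. Continuity in p uses in addition that the error of the sums depends on p only through its
  Lipschitz constant.\<close>

lemma current_with_curve_integral:
  "current_with X (\<lambda>f p. a * curve_integral \<gamma> f p) (scale_measure (ennreal (\<bar>a\<bar> * \<kappa>)) (curve_measure X \<gamma>))"
  (is "current_with X ?T ?\<mu>")
proof (rule current_withI)
  have \<kappa>: "0 \<le> \<kappa>" using lipschitz_on_nonneg[OF \<gamma>] .
  let ?D = "\<lambda>f p. dyadic_sum (\<lambda>t. f (\<gamma> t)) (\<lambda>t. p (\<gamma> t))"
  have lim: "?D f p \<longlonglongrightarrow> curve_integral \<gamma> f p" if "f \<in> Lip\<^sub>b X" "p \<in> Lip X" for f p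
    unfolding curve_integral_def
    by (rule dyadic_sum_lim[OF lipschitz_along_curve lipschitz_along_curve])
      (rule Lip_lipschitz_on Lip\<^sub>b_imp_Lip that)+
  show "bilinear_on (Lip\<^sub>b X) (Lip X) ?T"
    unfolding bilinear_on_def
  proof (intro conjI ballI allI)
    fix f g p :: "'a \<Rightarrow> real" and b c assume H: "f \<in> Lip\<^sub>b X" "g \<in> Lip\<^sub>b X" "p \<in> Lip X"
    have "?D (\<lambda>x. b * f x + c * g x) p = (\<lambda>n. b * ?D f p n + c * ?D g p n)"
      unfolding dyadic_sum_def sum_distrib_left sum.distrib[symmetric]
      by (intro ext sum.cong refl) (simp add: algebra_simps)
    then have "(\<lambda>n. b * ?D f p n + c * ?D g p n) \<longlonglongrightarrow> curve_integral \<gamma> (\<lambda>x. b * f x + c * g x) p"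
      using lim[OF Lip\<^sub>b_lin[OF H(1,2), of b c] H(3)] by (simp only:)
    moreover have "(\<lambda>n. b * ?D f p n + c * ?D g p n) \<longlonglongrightarrow> b * curve_integral \<gamma> f p + c * curve_integral \<gamma> g p"
      by (intro tendsto_add tendsto_mult tendsto_const lim H)
    ultimately have "curve_integral \<gamma> (\<lambda>x. b * f x + c * g x) p = b * curve_integral \<gamma> f p + c * curve_integral \<gamma> g p"
      by (rule LIMSEQ_unique)
    then show "?T (\<lambda>x. b * f x + c * g x) p = b * ?T f p + c * ?T g p" by (simp add: algebra_simps)
  next
    fix f p q :: "'a \<Rightarrow> real" and b c assume H: "f \<in> Lip\<^sub>b X" "p \<in> Lip X" "q \<in> Lip X"
    have "?D f (\<lambda>x. b * p x + c * q x) = (\<lambda>n. b * ?D f p n + c * ?D f q n)"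
      unfolding dyadic_sum_def sum_distrib_left sum.distrib[symmetric]
      by (intro ext sum.cong refl) (simp add: algebra_simps)
    then have "(\<lambda>n. b * ?D f p n + c * ?D f q n) \<longlonglongrightarrow> curve_integral \<gamma> f (\<lambda>x. b * p x + c * q x)"
      using lim[OF H(1) Lip_lin[OF H(2,3), of b c]] by (simp only:)
    moreover have "(\<lambda>n. b * ?D f p n + c * ?D f q n) \<longlonglongrightarrow> b * curve_integral \<gamma> f p + c * curve_integral \<gamma> f q"
      by (intro tendsto_add tendsto_mult tendsto_const lim H)
    ultimately have "curve_integral \<gamma> f (\<lambda>x. b * p x + c * q x) = b * curve_integral \<gamma> f p + c * curve_integral \<gamma> f q"
      by (rule LIMSEQ_unique)
    then show "?T f (\<lambda>x. b * p x + c * q x) = b * ?T f p + c * ?T f q" by (simp add: algebra_simps)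
  qed
  have error: "\<bar>?D f p n - curve_integral \<gamma> f p\<bar> \<le> 2 * ((L * \<kappa>) * (l * \<kappa>)) / 2^n"
    if "L-lipschitz_on X f" "l-lipschitz_on X p" for f p L l n
    unfolding curve_integral_def
    by (rule dyadic_sum_error[OF lipschitz_along_curve[OF that(1)] lipschitz_along_curve[OF that(2)]])
  have half: "(\<lambda>n. c / 2^n) \<longlonglongrightarrow> 0" for c :: real
  proof -
    have "(\<lambda>n. c * (1/2)^n) \<longlonglongrightarrow> c * 0" by (intro tendsto_mult tendsto_const LIMSEQ_power_zero) simp
    then show ?thesis by (simp add: power_divide)
  qed
  show "current_locality X ?T"
    unfolding current_locality_def
  proof (intro ballI impI)
    fix f p :: "'a \<Rightarrow> real"
    assume f: "f \<in> Lip\<^sub>b X" and p: "p \<in> Lip X"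
      and "\<exists>U. openin (top_of_set X) U \<and> {x\<in>X. f x \<noteq> 0} \<subseteq> U \<and> p constant_on U"
    then obtain U c where U: "{x\<in>X. f x \<noteq> 0} \<subseteq> U" "\<And>x. x \<in> U \<Longrightarrow> p x = c" by (auto simp: constant_on_def)
    let ?u = "\<lambda>t. f (\<gamma> t)" and ?v = "\<lambda>t. p (\<gamma> t)"
    define A B where "A = LIP X f * \<kappa>" and "B = LIP X p * \<kappa>"
    have u: "A-lipschitz_on {0..1} ?u" and v: "B-lipschitz_on {0..1} ?v"
      unfolding A_def B_def by (intro lipschitz_along_curve Lip_lipschitz_on Lip\<^sub>b_imp_Lip f p)+
    have A: "0 \<le> A" "0 \<le> B" using u v lipschitz_on_nonneg by blast+
    have "\<bar>?D f p n\<bar> \<le> A * B / 2^n" for n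
    proof -
      have "\<bar>?D f p n\<bar> \<le> (\<Sum>k<(2::nat)^n. (A / 2^n) * (B / 2^n))"
        unfolding dyadic_sum_def
      proof (rule order_trans[OF sum_abs], rule sum_mono)
        fix k :: nat assume "k \<in> {..<2^n}"
        then have k: "k < 2^n" by simp
        let ?x = "real k / 2^n" and ?y = "(real k + 1) / 2^n"
        have X: "\<gamma> ?x \<in> X" "\<gamma> ?y \<in> X" using dyadic_points[OF k] \<gamma>X by auto
        \<comment> \<open>A term can be nonzero only if f vanishes at the right end but not at the
          left; then its left value is at most one increment, A/2^n. So every term is of order 4^-n,
          and the sum of 2^n of them tends to 0.\<close>
        consider "?u ?x = 0" | "?u ?x \<noteq> 0" "?u ?y \<noteq> 0" | "?u ?y = 0" by blast
        then show "\<bar>?u ?x * (?v ?y - ?v ?x)\<bar> \<le> (A / 2^n) * (B / 2^n)"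
        proof cases
          case 1
          then show ?thesis using A by simp
        next
          case 2
          then have "\<gamma> ?x \<in> U" "\<gamma> ?y \<in> U" using U(1) X by blast+
          then show ?thesis using U(2) A by simp
        next
          case 3
          have "\<bar>?u ?x\<bar> \<le> A / 2^n" using dyadic_increment[OF u k] 3 by simp
          then show ?thesis unfolding abs_mult
            using A by (intro mult_mono dyadic_increment[OF v k]) auto
        qed
      qed
      also have "\<dots> = A * B / 2^n" by (simp add: field_simps)
      finally show ?thesis .
    qed
    then have "?D f p \<longlonglongrightarrow> 0"
      by (intro Lim_null_comparison[OF always_eventually half[of "A * B"]]) auto
    then have "curve_integral \<gamma> f p = 0" using lim[OF f p] LIMSEQ_unique by blast
    then show "?T f p = 0" by simp
  qed
  show "current_joint_continuity X ?T"
  proof (rule joint_continuityI)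
    fix f p :: "'a \<Rightarrow> real" and pn l
    assume f: "f \<in> Lip\<^sub>b X" and p: "p \<in> Lip X" and pn: "\<And>n. l-lipschitz_on X (pn n)"
      and conv: "\<And>x. x \<in> X \<Longrightarrow> (\<lambda>n. pn n x) \<longlonglongrightarrow> p x"
    define L where "L = LIP X f"
    have Lf: "L-lipschitz_on X f" unfolding L_def by (intro Lip_lipschitz_on Lip\<^sub>b_imp_Lip f)
    define q where "q = LIP X p"
    have q: "q-lipschitz_on X p" unfolding q_def by (rule Lip_lipschitz_on[OF p])
    have "(\<lambda>n. curve_integral \<gamma> f (pn n)) \<longlonglongrightarrow> curve_integral \<gamma> f p"
    proof (rule LIMSEQ_I)
      fix e :: real assume e: "0 < e"
      have "\<forall>\<^sub>F n in sequentially. 2 * ((L * \<kappa>) * (l * \<kappa>)) / 2^n < e/3"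
        "\<forall>\<^sub>F n in sequentially. 2 * ((L * \<kappa>) * (q * \<kappa>)) / 2^n < e/3"
        using e by (auto intro!: order_tendstoD(2)[OF half])
      then have "\<forall>\<^sub>F n in sequentially. 2 * ((L * \<kappa>) * (l * \<kappa>)) / 2^n < e/3 \<and> 2 * ((L * \<kappa>) * (q * \<kappa>)) / 2^n < e/3"
        by (rule eventually_conj)
      then obtain N where N: "2 * ((L * \<kappa>) * (l * \<kappa>)) / 2^N < e/3" "2 * ((L * \<kappa>) * (q * \<kappa>)) / 2^N < e/3"
        by (auto simp: eventually_sequentially)
      \<comment> \<open>The level \<open>N\<close> is good for all \<open>pn n\<close> and for p
        simultaneously; at this level only finitely many points of the curve occur, so pointwise
        convergence suffices.\<close>
      have "(\<lambda>n. ?D f (pn n) N) \<longlonglongrightarrow> ?D f p N"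
        unfolding dyadic_sum_def
      proof (intro tendsto_sum tendsto_mult tendsto_const tendsto_diff)
        fix k :: nat assume "k \<in> {..<2^N}"
        then have k: "k < 2^N" by simp
        show "(\<lambda>n. pn n (\<gamma> ((real k + 1) / 2 ^ N))) \<longlonglongrightarrow> p (\<gamma> ((real k + 1) / 2 ^ N))"
          "(\<lambda>n. pn n (\<gamma> (real k / 2 ^ N))) \<longlonglongrightarrow> p (\<gamma> (real k / 2 ^ N))"
          using dyadic_points[OF k] \<gamma>X by (auto intro!: conv)
      qed
      then obtain n0 where n0: "\<And>n. n \<ge> n0 \<Longrightarrow> \<bar>?D f (pn n) N - ?D f p N\<bar> < e/3"
        using e LIMSEQ_D[of "\<lambda>n. ?D f (pn n) N" "?D f p N" "e/3"] by auto
      have "norm (curve_integral \<gamma> f (pn n) - curve_integral \<gamma> f p) < e" if "n \<ge> n0" for n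
        using n0[OF that] error[OF Lf pn[of n], of N] error[OF Lf q, of N] N unfolding real_norm_def by linarith
      then show "\<exists>n0. \<forall>n\<ge>n0. norm (curve_integral \<gamma> f (pn n) - curve_integral \<gamma> f p) < e" by blast
    qed
    then show "(\<lambda>n. ?T f (pn n)) \<longlonglongrightarrow> ?T f p" by (intro tendsto_mult tendsto_const)
  qed
  show "mass_bound X (Lip\<^sub>b X) ?T ?\<mu>"
    unfolding mass_bound_iff
  proof (intro conjI ballI allI impI finite_Borel_curve_measure)
    fix f p :: "'a \<Rightarrow> real" and l assume f: "f \<in> Lip\<^sub>b X" and p: "l-lipschitz_on X p"
    define L where "L = LIP X f"
    have Lf: "L-lipschitz_on X f" unfolding L_def by (intro Lip_lipschitz_on Lip\<^sub>b_imp_Lip f)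
    let ?J = "\<integral>t. \<bar>f (\<gamma> t)\<bar> \<partial>restrict_space lborel {0..1}"
    have fm: "(\<lambda>x. \<bar>f x\<bar>) \<in> borel_measurable (restrict_space borel X)"
      using Lip\<^sub>b_imp_bounded_Borel[OF f] by (auto simp: bounded_Borel_def)
    have fm': "(\<lambda>x. \<bar>f x\<bar>) \<in> borel_measurable (curve_measure X \<gamma>)"
      using fm by (simp add: curve_measure_def)
    have J: "(\<integral>x. \<bar>f x\<bar> \<partial>?\<mu>) = \<bar>a\<bar> * \<kappa> * ?J"
      using \<kappa> fm fm' by (subst integral_scale_measure_nonneg)
        (auto simp: curve_measure_def integral_distr[OF curve_measurable])
    have "\<bar>curve_integral \<gamma> f p\<bar> \<le> (l * \<kappa>) * (?J + 0)"
    proof (rule LIMSEQ_le)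
      show "(\<lambda>n. \<bar>?D f p n\<bar>) \<longlonglongrightarrow> \<bar>curve_integral \<gamma> f p\<bar>"
        by (rule tendsto_rabs[OF lim[OF f LipI[OF p]]])
      show "(\<lambda>n. (l * \<kappa>) * (?J + L * \<kappa> / 2^n)) \<longlonglongrightarrow> (l * \<kappa>) * (?J + 0)"
        by (intro tendsto_mult tendsto_const tendsto_add half)
      show "\<exists>N. \<forall>n\<ge>N. \<bar>?D f p n\<bar> \<le> (l * \<kappa>) * (?J + L * \<kappa> / 2^n)"
        using dyadic_sum_le[OF lipschitz_along_curve[OF Lf] lipschitz_along_curve[OF p]] by blast
    qed
    then have "\<bar>a\<bar> * \<bar>curve_integral \<gamma> f p\<bar> \<le> \<bar>a\<bar> * ((l * \<kappa>) * ?J)" by (intro mult_left_mono) auto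
    then show "\<bar>?T f p\<bar> \<le> l * (\<integral>x. \<bar>f x\<bar> \<partial>?\<mu>)" unfolding J by (simp add: abs_mult ac_simps)
  qed
qed

end

lemma curve_integral_boundary: "curve_integral \<gamma> (\<lambda>_. 1) p = p (\<gamma> 1) - p (\<gamma> 0)"
proof -
  have "dyadic_sum (\<lambda>t. 1) (\<lambda>t. p (\<gamma> t)) n = p (\<gamma> 1) - p (\<gamma> 0)" for n
  proof -
    have "(\<Sum>k<m. p (\<gamma> ((real k + 1) / 2^n)) - p (\<gamma> (real k / 2^n))) = p (\<gamma> (real m / 2^n)) - p (\<gamma> 0)" for m
      by (induction m) (auto simp: add.commute)
    from this[of "2^n"] show ?thesis by (simp add: dyadic_sum_def)
  qed
  then have "dyadic_sum (\<lambda>t. 1) (\<lambda>t. p (\<gamma> t)) = (\<lambda>n. p (\<gamma> 1) - p (\<gamma> 0))" by auto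
  then show ?thesis by (simp add: curve_integral_def)
qed

section \<open>Approximating functionals by molecules\<close>

text \<open>Dominated extension by one coordinate at a time. Finitely many coordinates make this a
  plain induction and return the functional directly as a vector of coefficients.\<close>

lemma finite_Hahn_Banach:
  fixes s :: "('i \<Rightarrow> real) \<Rightarrow> real"
  assumes sub: "\<And>c d. s (\<lambda>i. c i + d i) \<le> s c + s d"
    and hom: "\<And>t c. 0 < t \<Longrightarrow> s (\<lambda>i. t * c i) = t * s c" and zero: "s (\<lambda>_. 0) = 0"
    and fin: "finite I"
  shows "\<exists>a. \<forall>c. (\<forall>i. i \<notin> I \<longrightarrow> c i = 0) \<longrightarrow> (\<Sum>i\<in>I. a i * c i) \<le> s c"
  using fin
proof (induction I)
  case empty
  show ?case
  proof (intro exI allI impI)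
    fix c :: "'i \<Rightarrow> real" assume "\<forall>i. i \<notin> {} \<longrightarrow> c i = 0"
    then have "c = (\<lambda>_. 0)" by auto
    then show "(\<Sum>i\<in>{}. 0 * c i) \<le> s c" using zero by simp
  qed
next
  case (insert j F)
  then obtain a where a: "\<And>c. (\<And>i. i \<notin> F \<Longrightarrow> c i = 0) \<Longrightarrow> (\<Sum>i\<in>F. a i * c i) \<le> s c" by blast
  define A where "A c = (\<Sum>i\<in>F. a i * c i)" for c
  define e :: "'i \<Rightarrow> real" where "e = (\<lambda>i. if i = j then 1 else 0)"
  define S where "S = {c :: 'i \<Rightarrow> real. \<forall>i. i \<notin> F \<longrightarrow> c i = 0}"
  have Aadd: "A (\<lambda>i. c i + d i) = A c + A d" for c d
    by (simp add: A_def distrib_left sum.distrib)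
  have Amul: "A (\<lambda>i. t * c i) = t * A c" for t c
    unfolding A_def sum_distrib_left by (intro sum.cong refl) simp
  have AS: "A c \<le> s c" if "c \<in> S" for c using a[of c] that by (simp add: A_def S_def)
  have cross: "A c - s (\<lambda>i. c i - e i) \<le> s (\<lambda>i. d i + e i) - A d" if "c \<in> S" "d \<in> S" for c d
  proof -
    have "A c + A d = A (\<lambda>i. c i + d i)" by (simp add: Aadd)
    also have "\<dots> \<le> s (\<lambda>i. c i + d i)" using that by (intro AS) (auto simp: S_def)
    also have "(\<lambda>i. c i + d i) = (\<lambda>i. (c i - e i) + (d i + e i))" by auto
    also have "s \<dots> \<le> s (\<lambda>i. c i - e i) + s (\<lambda>i. d i + e i)" by (rule sub)
    finally show ?thesis by simp
  qed
  \<comment> \<open>The new coefficient must lie between the lower bounds A c - s(c - e) and the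
    upper bounds s(d + e) - A d, which \<open>cross\<close> shows to be compatible; the infimum of
    the upper ones is taken.\<close>
  define \<alpha> where "\<alpha> = (INF d\<in>S. s (\<lambda>i. d i + e i) - A d)"
  have S0: "(\<lambda>_. 0) \<in> S" by (simp add: S_def)
  have bdd: "bdd_below ((\<lambda>d. s (\<lambda>i. d i + e i) - A d) ` S)"
    using cross[OF S0] by (auto intro!: bdd_belowI)
  have up: "\<alpha> \<le> s (\<lambda>i. d i + e i) - A d" if "d \<in> S" for d
    unfolding \<alpha>_def by (rule cINF_lower[OF bdd that])
  have low: "A c - s (\<lambda>i. c i - e i) \<le> \<alpha>" if "c \<in> S" for c
    unfolding \<alpha>_def using S0 by (intro cINF_greatest cross that) auto
  show ?case
  proof (intro exI allI impI)
    fix c :: "'i \<Rightarrow> real" assume c: "\<forall>i. i \<notin> insert j F \<longrightarrow> c i = 0"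
    define t where "t = c j"
    define d where "d = (\<lambda>i. if i = j then 0 else c i)"
    have dS: "d \<in> S" using c insert(2) by (auto simp: S_def d_def)
    have dSt: "(\<lambda>i. r * d i) \<in> S" for r using dS by (auto simp: S_def)
    have cd: "c = (\<lambda>i. d i + t * e i)" by (auto simp: d_def t_def e_def)
    have sumc: "(\<Sum>i\<in>insert j F. (a(j := \<alpha>)) i * c i) = A d + t * \<alpha>"
    proof -
      have "(\<Sum>i\<in>F. (a(j := \<alpha>)) i * c i) = A d"
        unfolding A_def using insert(2) by (intro sum.cong) (auto simp: d_def)
      then show ?thesis using insert by (simp add: t_def)
    qed
    have "A d + t * \<alpha> \<le> s c"
    proof (cases t "0 :: real" rule: linorder_cases)
      case equal
      then have "c = d" using cd by simp
      then show ?thesis using AS[OF dS] equal by simp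
    next
      case greater
      then have "t * \<alpha> \<le> t * (s (\<lambda>i. inverse t * d i + e i) - A (\<lambda>i. inverse t * d i))"
        by (intro mult_left_mono up dSt) auto
      also have "\<dots> = t * s (\<lambda>i. inverse t * d i + e i) - A d"
        using greater unfolding Amul by (simp add: right_diff_distrib)
      also have "t * s (\<lambda>i. inverse t * d i + e i) = s (\<lambda>i. t * (inverse t * d i + e i))"
        using hom[OF greater] by simp
      also have "(\<lambda>i. t * (inverse t * d i + e i)) = c" using greater cd by (auto simp: distrib_left)
      finally show ?thesis by simp
    next
      case less
      define u where "u = - t"
      have u: "0 < u" using less by (simp add: u_def)
      have "u * (A (\<lambda>i. inverse u * d i) - s (\<lambda>i. inverse u * d i - e i)) \<le> u * \<alpha>"
        using u by (intro mult_left_mono low dSt) auto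
      moreover have "u * (A (\<lambda>i. inverse u * d i) - s (\<lambda>i. inverse u * d i - e i)) = A d - u * s (\<lambda>i. inverse u * d i - e i)"
        using u unfolding Amul by (simp add: right_diff_distrib)
      moreover have "u * s (\<lambda>i. inverse u * d i - e i) = s (\<lambda>i. u * (inverse u * d i - e i))"
        using hom[OF u] by simp
      moreover have "(\<lambda>i. u * (inverse u * d i - e i)) = c" using u cd by (auto simp: right_diff_distrib u_def)
      ultimately show ?thesis by (simp add: u_def)
    qed
    then show "(\<Sum>i\<in>insert j F. (a(j := \<alpha>)) i * c i) \<le> s c" using sumc by simp
  qed
qed

text \<open>McShane extension: the lower envelope of the cones of slope \<open>l\<close> placed over
  the finitely many prescribed values.\<close>

lemma McShane_finite:
  fixes p :: "'a::metric_space \<Rightarrow> real"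
  assumes F: "finite F" "F \<noteq> {}" and l: "0 \<le> l"
    and p: "\<And>x y. x \<in> F \<Longrightarrow> y \<in> F \<Longrightarrow> \<bar>p x - p y\<bar> \<le> l * dist x y"
  obtains q where "l-lipschitz_on UNIV q" "\<And>x. x \<in> F \<Longrightarrow> q x = p x"
proof -
  define q where "q z = Min ((\<lambda>y. p y + l * dist z y) ` F)" for z
  have q_le: "q z \<le> p y + l * dist z y" if "y \<in> F" for z y
    unfolding q_def using F that by (intro Min_le) auto
  have q_eq: "\<exists>y\<in>F. q z = p y + l * dist z y" for z
  proof -
    have "q z \<in> (\<lambda>y. p y + l * dist z y) ` F" unfolding q_def using F by (intro Min_in) simp_all
    then show ?thesis by blast
  qed
  have one: "q z - q w \<le> l * dist z w" for z w
  proof -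
    obtain y where y: "y \<in> F" "q w = p y + l * dist w y" using q_eq by blast
    have "q z \<le> p y + l * dist z y" using q_le[OF y(1)] .
    also have "\<dots> \<le> p y + l * (dist z w + dist w y)"
      using l by (intro add_left_mono mult_left_mono dist_triangle)
    finally show ?thesis using y(2) by (simp add: distrib_left)
  qed
  have "l-lipschitz_on UNIV q"
  proof (rule lipschitz_onI)
    show "dist (q x) (q y) \<le> l * dist x y" for x y
      using one[of x y] one[of y x] by (simp add: dist_real_def abs_le_iff dist_commute)
  qed (rule l)
  moreover have "q x = p x" if x: "x \<in> F" for x
  proof (rule antisym)
    show "q x \<le> p x" using q_le[OF x, of x] by simp
    obtain y where y: "y \<in> F" "q x = p y + l * dist x y" using q_eq by blast
    then show "p x \<le> q x" using p[OF x y(1)] by simp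
  qed
  ultimately show ?thesis using that by blast
qed

text \<open>This replaces weak* continuity: together with the Lipschitz bound it puts the functional
  into the Lipschitz-free space, the norm closure of the molecules.\<close>

definition finitely_determined :: "'a::metric_space set \<Rightarrow> (('a \<Rightarrow> real) \<Rightarrow> real) \<Rightarrow> bool"
  where "finitely_determined X L \<longleftrightarrow> (\<forall>\<eta>>0. \<exists>F. finite F \<and> F \<subseteq> X \<and>
    (\<forall>p l. l-lipschitz_on X p \<longrightarrow> (\<forall>x\<in>F. p x = 0) \<longrightarrow> \<bar>L p\<bar> \<le> \<eta> * l))"

definition Lip_linear :: "'a::metric_space set \<Rightarrow> (('a \<Rightarrow> real) \<Rightarrow> real) \<Rightarrow> bool"
  where "Lip_linear X L \<longleftrightarrow>
    (\<forall>p\<in>Lip X. \<forall>q\<in>Lip X. \<forall>a b. L (\<lambda>x. a * p x + b * q x) = a * L p + b * L q)"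

text \<open>Up to a small error \<open>L\<close> depends only on the trace of a function on a finite
  set \<open>F\<close>, hence on its differences over pairs in \<open>F\<close>. A sublinear
  functional on vectors indexed by these pairs encodes both requirements, closeness to
  \<open>L\<close> and cost at most \<open>M\<close>, and Hahn-Banach yields coefficients meeting
  both.\<close>

lemma molecule_approximation:
  fixes X :: "'a::metric_space set"
  assumes X: "X \<noteq> {}" and lin: "Lip_linear X L" and bound: "\<And>l p. l-lipschitz_on X p \<Longrightarrow> \<bar>L p\<bar> \<le> M * l"
    and M: "0 \<le> M" and det: "finitely_determined X L" and \<eta>: "0 < \<eta>"
  obtains I a where "finite I" "I \<subseteq> {z \<in> X \<times> X. fst z \<noteq> snd z}"
    "(\<Sum>z\<in>I. \<bar>a z\<bar> * dist (fst z) (snd z)) \<le> M"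
    "\<And>l p. l-lipschitz_on X p \<Longrightarrow> \<bar>L p - (\<Sum>z\<in>I. a z * (p (snd z) - p (fst z)))\<bar> \<le> \<eta> * l"
proof -
  \<comment> \<open>Half of \<eta>, because a function minus the extension of its trace on
    \<open>F\<close> has Lipschitz constant up to 2l.\<close>
  define h where "h = \<eta> / 2"
  have h: "0 < h" using \<eta> by (simp add: h_def)
  obtain x0 where x0: "x0 \<in> X" using X by blast
  obtain F0 where F0: "finite F0" "F0 \<subseteq> X"
    "\<And>p l. l-lipschitz_on X p \<Longrightarrow> (\<And>x. x \<in> F0 \<Longrightarrow> p x = 0) \<Longrightarrow> \<bar>L p\<bar> \<le> h * l"
  proof -
    obtain F0 where "finite F0" "F0 \<subseteq> X" and
      F0: "\<forall>p l. l-lipschitz_on X p \<longrightarrow> (\<forall>x\<in>F0. p x = 0) \<longrightarrow> \<bar>L p\<bar> \<le> h * l"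
      using det[unfolded finitely_determined_def, THEN spec, THEN mp, OF h] by (elim exE conjE)
    show ?thesis
    proof (rule that[OF \<open>finite F0\<close> \<open>F0 \<subseteq> X\<close>])
      fix p :: "'a \<Rightarrow> real" and l assume p: "l-lipschitz_on X p" "\<And>x. x \<in> F0 \<Longrightarrow> p x = 0"
      show "\<bar>L p\<bar> \<le> h * l" by (rule F0[THEN spec, THEN spec, THEN mp, THEN mp, OF p(1)]) (use p(2) in simp)
    qed
  qed
  \<comment> \<open>The extra point keeps \<open>F\<close> nonempty, as the minimum in the McShane
    extension requires.\<close>
  define F where "F = insert x0 F0"
  have F: "finite F" "F \<subseteq> X" "F \<noteq> {}" using F0 x0 by (auto simp: F_def)
  define I where "I = {z \<in> F \<times> F. fst z \<noteq> snd z}"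
  have I: "finite I" "I \<subseteq> {z \<in> X \<times> X. fst z \<noteq> snd z}" using F by (auto simp: I_def)
  let ?d = "\<lambda>z :: 'a \<times> 'a. dist (fst z) (snd z)"
  let ?D = "\<lambda>(p :: 'a \<Rightarrow> real) z. p (snd z) - p (fst z)"
  have Ladd: "L (\<lambda>x. p x + q x) = L p + L q" if "p \<in> Lip X" "q \<in> Lip X" for p q
  proof -
    have "L (\<lambda>x. 1 * p x + 1 * q x) = 1 * L p + 1 * L q" using lin that unfolding Lip_linear_def by blast
    then show ?thesis by simp
  qed
  have Lmul: "L (\<lambda>x. t * p x) = t * L p" if "p \<in> Lip X" for p t
  proof -
    have "L (\<lambda>x. t * p x + 0 * p x) = t * L p + 0 * L p" using lin that unfolding Lip_linear_def by blast
    then show ?thesis by simp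
  qed
  have L0: "L (\<lambda>_. 0) = 0" using Lmul[OF LipI[OF lipschitz_on_constant[where U = X and c = 0]], of 0] by simp
  \<comment> \<open>If \<open>k\<close> bounds the slopes of p between points of \<open>F\<close>,
    the extension of the trace of p costs at most M k, and its difference from p vanishes on
    \<open>F\<close> and is therefore almost invisible to \<open>L\<close>.\<close>
  have key: "\<bar>L p\<bar> \<le> M * k + 2 * h * l"
    if p: "l-lipschitz_on X p" and k: "0 \<le> k" "\<And>z. z \<in> I \<Longrightarrow> \<bar>?D p z\<bar> \<le> k * ?d z" for p l k
  proof -
    \<comment> \<open>The minimum with l keeps the Lipschitz constant of p - q below 2l even when
      \<open>k\<close> is large.\<close>
    define j where "j = min k l"
    have l0: "0 \<le> l" using lipschitz_on_nonneg[OF p] .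
    have j: "0 \<le> j" "j \<le> k" "j \<le> l" using l0 k by (auto simp: j_def)
    have Fp: "\<bar>p x - p y\<bar> \<le> j * dist x y" if "x \<in> F" "y \<in> F" for x y
    proof (cases "x = y")
      case False
      then have "\<bar>p x - p y\<bar> \<le> k * dist x y" using k(2)[of "(y, x)"] that by (auto simp: I_def dist_commute)
      moreover have "\<bar>p x - p y\<bar> \<le> l * dist x y" using lipschitz_onD[OF p, of x y] that F by (auto simp: dist_real_def)
      ultimately show ?thesis by (simp add: j_def min_def)
    qed simp
    obtain q where q: "j-lipschitz_on UNIV q" "\<And>x. x \<in> F \<Longrightarrow> q x = p x"
      using McShane_finite[OF F(1,3) j(1) Fp] by blast
    have qX: "j-lipschitz_on X q" using lipschitz_on_subset[OF q(1)] by simp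
    have pq: "(l + j)-lipschitz_on X (\<lambda>x. p x - q x)" by (intro lipschitz_intros p qX)
    have "\<bar>L (\<lambda>x. p x - q x)\<bar> \<le> h * (l + j)"
      by (rule F0(3)[OF pq]) (simp add: q(2) F_def)
    also have "\<dots> \<le> h * (2 * l)" using h j by (intro mult_left_mono) auto
    finally have 1: "\<bar>L (\<lambda>x. p x - q x)\<bar> \<le> 2 * h * l" by simp
    have "\<bar>L q\<bar> \<le> M * j" by (rule bound[OF qX])
    also have "\<dots> \<le> M * k" using M j by (intro mult_left_mono)
    finally have 2: "\<bar>L q\<bar> \<le> M * k" .
    have "L p = L (\<lambda>x. (p x - q x) + q x)" by simp
    also have "\<dots> = L (\<lambda>x. p x - q x) + L q" by (rule Ladd[OF LipI[OF pq] LipI[OF qX]])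
    finally show ?thesis using 1 2 by linarith
  qed
  \<comment> \<open>The infimum of this set is an infimal convolution: the vector c is approximated
    by the differences of some p, at the price L p + 2hl, and the relative error \<open>k\<close> is
    paid at the rate \<open>M\<close>. By \<open>key\<close> the prices are bounded below.\<close>
  define \<Phi> where "\<Phi> c = {L p + 2 * h * l + M * k | p l k. l-lipschitz_on X p \<and> 0 \<le> k \<and>
      (\<forall>z\<in>I. \<bar>c z - ?D p z\<bar> \<le> k * ?d z)}" for c
  define s where "s c = Inf (\<Phi> c)" for c
  have dpos: "0 < ?d z" if "z \<in> I" for z using that by (auto simp: I_def)
  have exk: "\<exists>k. 0 \<le> k \<and> (\<forall>z\<in>I. \<bar>c z\<bar> \<le> k * ?d z)" for c :: "'a \<times> 'a \<Rightarrow> real"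
  proof (intro exI conjI ballI)
    show "0 \<le> (\<Sum>z\<in>I. \<bar>c z\<bar> / ?d z)" by (intro sum_nonneg) simp
    fix z assume z: "z \<in> I"
    have "\<bar>c z\<bar> / ?d z \<le> (\<Sum>z\<in>I. \<bar>c z\<bar> / ?d z)" using z I by (intro member_le_sum) auto
    then show "\<bar>c z\<bar> \<le> (\<Sum>z\<in>I. \<bar>c z\<bar> / ?d z) * ?d z" using dpos[OF z] by (simp add: divide_simps)
  qed
  have \<Phi>I: "L p + 2 * h * l + M * k \<in> \<Phi> c"
    if "l-lipschitz_on X p" "0 \<le> k" "\<And>z. z \<in> I \<Longrightarrow> \<bar>c z - ?D p z\<bar> \<le> k * ?d z" for p l k c
    using that unfolding \<Phi>_def by blast
  have ne: "\<Phi> c \<noteq> {}" for c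
  proof -
    obtain k where "0 \<le> k" "\<forall>z\<in>I. \<bar>c z\<bar> \<le> k * ?d z" using exk by blast
    then have "L (\<lambda>_. 0) + 2 * h * 0 + M * k \<in> \<Phi> c" by (intro \<Phi>I lipschitz_on_constant) auto
    then show ?thesis by blast
  qed
  have bdd: "bdd_below (\<Phi> c)" for c
  proof -
    obtain k0 where k0: "0 \<le> k0" "\<forall>z\<in>I. \<bar>c z\<bar> \<le> k0 * ?d z" using exk by blast
    have "- M * k0 \<le> r" if "r \<in> \<Phi> c" for r
    proof -
      obtain p l k where r: "r = L p + 2 * h * l + M * k" "l-lipschitz_on X p" "0 \<le> k"
        "\<And>z. z \<in> I \<Longrightarrow> \<bar>c z - ?D p z\<bar> \<le> k * ?d z" using \<open>r \<in> \<Phi> c\<close> unfolding \<Phi>_def by blast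
      have "\<bar>L p\<bar> \<le> M * (k0 + k) + 2 * h * l"
      proof (rule key[OF r(2)])
        fix z assume z: "z \<in> I"
        have "\<bar>?D p z\<bar> \<le> k0 * ?d z + k * ?d z" using r(4)[OF z] bspec[OF k0(2) z] by linarith
        then show "\<bar>?D p z\<bar> \<le> (k0 + k) * ?d z" by (simp add: distrib_right)
      qed (use k0 r in simp)
      then have "- L p \<le> M * k0 + M * k + 2 * h * l" by (simp add: distrib_left)
      then show ?thesis unfolding r(1) by simp
    qed
    then show ?thesis by (rule bdd_belowI)
  qed
  have s_le: "s c \<le> r" if "r \<in> \<Phi> c" for r c unfolding s_def by (rule cInf_lower[OF that bdd])
  have s_ge: "r \<le> s c" if "\<And>r'. r' \<in> \<Phi> c \<Longrightarrow> r \<le> r'" for r c unfolding s_def by (rule cInf_greatest[OF ne that])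
  have sub: "s (\<lambda>i. c i + d i) \<le> s c + s d" for c d
  proof -
    have "s (\<lambda>i. c i + d i) - r \<le> s d" if rc: "r \<in> \<Phi> c" for r
    proof (rule s_ge)
      fix r' assume rd: "r' \<in> \<Phi> d"
      obtain p l k where r: "r = L p + 2 * h * l + M * k" "l-lipschitz_on X p" "0 \<le> k"
        "\<And>z. z \<in> I \<Longrightarrow> \<bar>c z - ?D p z\<bar> \<le> k * ?d z" using rc unfolding \<Phi>_def by blast
      obtain p' l' k' where r': "r' = L p' + 2 * h * l' + M * k'" "l'-lipschitz_on X p'" "0 \<le> k'"
        "\<And>z. z \<in> I \<Longrightarrow> \<bar>d z - ?D p' z\<bar> \<le> k' * ?d z" using rd unfolding \<Phi>_def by blast
      have "L (\<lambda>x. p x + p' x) + 2 * h * (l + l') + M * (k + k') \<in> \<Phi> (\<lambda>i. c i + d i)"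
      proof (rule \<Phi>I)
        show "(l + l')-lipschitz_on X (\<lambda>x. p x + p' x)" by (intro lipschitz_intros r r')
        fix z assume z: "z \<in> I"
        have "\<bar>c z + d z - ?D (\<lambda>x. p x + p' x) z\<bar> \<le> k * ?d z + k' * ?d z"
          using r(4)[OF z] r'(4)[OF z] by linarith
        then show "\<bar>c z + d z - ?D (\<lambda>x. p x + p' x) z\<bar> \<le> (k + k') * ?d z" by (simp add: distrib_right)
      qed (use r r' in simp)
      then have "s (\<lambda>i. c i + d i) \<le> L (\<lambda>x. p x + p' x) + 2 * h * (l + l') + M * (k + k')" by (rule s_le)
      also have "\<dots> = r + r'" unfolding r(1) r'(1) Ladd[OF LipI[OF r(2)] LipI[OF r'(2)]] by (simp add: algebra_simps)
      finally show "s (\<lambda>i. c i + d i) - r \<le> r'" by simp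
    qed
    then have "s (\<lambda>i. c i + d i) - s d \<le> r" if "r \<in> \<Phi> c" for r using that by fastforce
    then have "s (\<lambda>i. c i + d i) - s d \<le> s c" by (rule s_ge)
    then show ?thesis by simp
  qed
  have hom_le: "s (\<lambda>i. t * c i) \<le> t * s c" if t: "0 < t" for t c
  proof -
    have "s (\<lambda>i. t * c i) / t \<le> r" if rc: "r \<in> \<Phi> c" for r
    proof -
      obtain p l k where r: "r = L p + 2 * h * l + M * k" "l-lipschitz_on X p" "0 \<le> k"
        "\<And>z. z \<in> I \<Longrightarrow> \<bar>c z - ?D p z\<bar> \<le> k * ?d z" using rc unfolding \<Phi>_def by blast
      have "L (\<lambda>x. t * p x) + 2 * h * (t * l) + M * (t * k) \<in> \<Phi> (\<lambda>i. t * c i)"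
      proof (rule \<Phi>I)
        show "(t * l)-lipschitz_on X (\<lambda>x. t * p x)"
          using lipschitz_on_cmult_real[OF r(2), of t] t by simp
        fix z assume z: "z \<in> I"
        have "t * c z - ?D (\<lambda>x. t * p x) z = t * (c z - ?D p z)" by (simp add: algebra_simps)
        then have "\<bar>t * c z - ?D (\<lambda>x. t * p x) z\<bar> = t * \<bar>c z - ?D p z\<bar>" using t by (simp add: abs_mult)
        also have "\<dots> \<le> t * (k * ?d z)" using r(4)[OF z] t by (intro mult_left_mono) auto
        finally show "\<bar>t * c z - ?D (\<lambda>x. t * p x) z\<bar> \<le> (t * k) * ?d z" by simp
      qed (use r t in simp)
      then have "s (\<lambda>i. t * c i) \<le> L (\<lambda>x. t * p x) + 2 * h * (t * l) + M * (t * k)" by (rule s_le)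
      also have "\<dots> = t * r" unfolding r(1) Lmul[OF LipI[OF r(2)]] by (simp add: algebra_simps)
      finally show ?thesis using t by (simp add: pos_divide_le_eq mult.commute)
    qed
    then have "s (\<lambda>i. t * c i) / t \<le> s c" by (rule s_ge)
    then show ?thesis using t by (simp add: pos_divide_le_eq mult.commute)
  qed
  have hom: "s (\<lambda>i. t * c i) = t * s c" if t: "0 < t" for t c
  proof (rule antisym[OF hom_le[OF t]])
    have "s (\<lambda>i. inverse t * (t * c i)) \<le> inverse t * s (\<lambda>i. t * c i)" using t by (intro hom_le) simp
    moreover have "(\<lambda>i. inverse t * (t * c i)) = c" using t by auto
    ultimately have "s c \<le> inverse t * s (\<lambda>i. t * c i)" by (simp only:)
    from mult_left_mono[OF this, of t] show "t * s c \<le> s (\<lambda>i. t * c i)"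
      using t by (simp only: mult.assoc[symmetric] right_inverse less_imp_le less_imp_neq[symmetric] mult_1_left simp_thms)
  qed
  \<comment> \<open>Homogeneity with t = 2 gives s 0 = 2 * s 0.\<close>
  have zero: "s (\<lambda>_. 0) = 0" using hom[of 2 "\<lambda>_. 0"] by simp
  obtain a where a: "\<And>c. (\<And>i. i \<notin> I \<Longrightarrow> c i = 0) \<Longrightarrow> (\<Sum>i\<in>I. a i * c i) \<le> s c"
    using finite_Hahn_Banach[where s = s and I = I, OF sub hom zero I(1)] by blast
  have a': "(\<Sum>i\<in>I. a i * c i) \<le> r" if "r \<in> \<Phi> (\<lambda>i. if i \<in> I then c i else 0)" for c r
  proof -
    have "(\<Sum>i\<in>I. a i * c i) = (\<Sum>i\<in>I. a i * (if i \<in> I then c i else 0))" by (intro sum.cong) auto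
    also have "\<dots> \<le> s (\<lambda>i. if i \<in> I then c i else 0)" by (rule a) simp
    finally show ?thesis using s_le[OF that] by linarith
  qed
  show ?thesis
  proof (rule that[OF I])
    \<comment> \<open>Test vector: signs of the coefficients times the distances, matched with p = 0
      and k = 1. This is the cost bound.\<close>
    have "(\<Sum>z\<in>I. a z * (sgn (a z) * ?d z)) \<le> L (\<lambda>_. 0) + 2 * h * 0 + M * 1"
    proof (rule a', rule \<Phi>I[OF lipschitz_on_constant])
      fix z assume z: "z \<in> I"
      show "\<bar>(if z \<in> I then sgn (a z) * ?d z else 0) - (0 - 0)\<bar> \<le> 1 * ?d z"
        using z by (simp add: abs_mult sgn_real_def)
    qed simp
    moreover have "a z * (sgn (a z) * ?d z) = \<bar>a z\<bar> * ?d z" for z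
      by (simp add: sgn_real_def)
    ultimately show "(\<Sum>z\<in>I. \<bar>a z\<bar> * ?d z) \<le> M" using L0 by simp
    fix l and p :: "'a \<Rightarrow> real" assume p: "l-lipschitz_on X p"
    \<comment> \<open>Test vector: the differences of q itself, matched with p = q and k = 0. Used
      for a function and its negative, this bounds the distance of the molecule from
      \<open>L\<close>.\<close>
    have one: "(\<Sum>z\<in>I. a z * ?D q z) \<le> L q + 2 * h * l" if q: "l-lipschitz_on X q" for q
    proof -
      have "(\<Sum>z\<in>I. a z * ?D q z) \<le> L q + 2 * h * l + M * 0"
        by (rule a', rule \<Phi>I[OF q]) auto
      then show ?thesis by simp
    qed
    have mp: "l-lipschitz_on X (\<lambda>x. - p x)" using p by simp
    have "L (\<lambda>x. - p x) = - L p" using Lmul[OF LipI[OF p], of "-1"] by simp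
    moreover have "(\<Sum>z\<in>I. a z * ?D (\<lambda>x. - p x) z) = - (\<Sum>z\<in>I. a z * ?D p z)"
      unfolding sum_negf[symmetric] by (intro sum.cong refl) (simp add: algebra_simps)
    ultimately show "\<bar>L p - (\<Sum>z\<in>I. a z * ?D p z)\<bar> \<le> \<eta> * l"
      using one[OF p] one[OF mp] by (simp add: h_def abs_le_iff)
  qed
qed

section \<open>The boundary of a tight current is finitely determined\<close>

text \<open>Otherwise 1-Lipschitz functions tending uniformly to 0 would keep \<bar>T f p\<bar>
  above \<eta>, against joint continuity at 0. Scaling gives positive l, and the mass bound gives l
  = 0.\<close>

lemma current_small_uniformly:
  assumes T: "current_with X T \<mu>" and f: "f \<in> Lip\<^sub>b X" and \<eta>: "0 < \<eta>"
  obtains \<delta> where "0 < \<delta>" "\<And>p l. 0 \<le> l \<Longrightarrow> l-lipschitz_on X p \<Longrightarrow> (\<And>x. x \<in> X \<Longrightarrow> \<bar>p x\<bar> \<le> \<delta> * l) \<Longrightarrow> \<bar>T f p\<bar> \<le> \<eta> * l"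
proof -
  have "\<exists>\<delta>>0. \<forall>p. 1-lipschitz_on X p \<longrightarrow> (\<forall>x\<in>X. \<bar>p x\<bar> \<le> \<delta>) \<longrightarrow> \<bar>T f p\<bar> \<le> \<eta>"
  proof (rule ccontr)
    assume "\<not> ?thesis"
    then have "\<forall>\<delta>>0. \<exists>p. 1-lipschitz_on X p \<and> (\<forall>x\<in>X. \<bar>p x\<bar> \<le> \<delta>) \<and> \<eta> < \<bar>T f p\<bar>" by (meson not_le)
    then have "\<forall>n. \<exists>p. 1-lipschitz_on X p \<and> (\<forall>x\<in>X. \<bar>p x\<bar> \<le> inverse (real (Suc n))) \<and> \<eta> < \<bar>T f p\<bar>"
      by (metis inverse_positive_iff_positive of_nat_0_less_iff zero_less_Suc)
    then obtain p where p: "\<And>n. 1-lipschitz_on X (p n)" "\<And>n x. x \<in> X \<Longrightarrow> \<bar>p n x\<bar> \<le> inverse (real (Suc n))"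
      "\<And>n. \<eta> < \<bar>T f (p n)\<bar>" by metis
    have c0: "(\<lambda>_. 0) \<in> Lip X" using Lip\<^sub>b_const Lip\<^sub>b_imp_Lip by blast
    have "(\<lambda>n. p n x) \<longlonglongrightarrow> 0" if "x \<in> X" for x
    proof (rule Lim_null_comparison[OF always_eventually LIMSEQ_inverse_real_of_nat])
      show "\<forall>n. norm (p n x) \<le> inverse (real (Suc n))" using p(2)[OF that] by (simp only: real_norm_def) simp
    qed
    then have "(\<lambda>n. T f (p n)) \<longlonglongrightarrow> T f (\<lambda>_. 0)"
      by (intro current_with_continuity[OF T f c0 p(1)])
    moreover have "T f (\<lambda>_. 0) = 0"
      using current_with_bound[OF T f lipschitz_on_constant[where U = X and c = 0]] by simp
    ultimately have "\<forall>\<^sub>F n in sequentially. \<bar>T f (p n)\<bar> < \<eta>"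
      using \<eta> by (intro order_tendstoD(2)[of _ 0]) (auto intro: tendsto_rabs_zero)
    then show False using p(3) by (auto simp: eventually_sequentially) (meson less_asym order_refl)
  qed
  then obtain \<delta> where \<delta>: "0 < \<delta>" "\<And>p. 1-lipschitz_on X p \<Longrightarrow> (\<And>x. x \<in> X \<Longrightarrow> \<bar>p x\<bar> \<le> \<delta>) \<Longrightarrow> \<bar>T f p\<bar> \<le> \<eta>"
    by blast
  show ?thesis
  proof (rule that[OF \<delta>(1)])
    fix p l assume l: "0 \<le> (l::real)" and p: "l-lipschitz_on X p" "\<And>x. x \<in> X \<Longrightarrow> \<bar>p x\<bar> \<le> \<delta> * l"
    show "\<bar>T f p\<bar> \<le> \<eta> * l"
    proof (cases "l = 0")
      case True
      then show ?thesis using current_with_bound[OF T f p(1)] by simp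
    next
      case False
      then have l: "0 < l" using l by simp
      have "1-lipschitz_on X (\<lambda>x. inverse l * p x)"
        using lipschitz_on_cmult_real[OF p(1), of "inverse l"] l by simp
      moreover have "\<bar>inverse l * p x\<bar> \<le> \<delta>" if "x \<in> X" for x
        using p(2)[OF that] l by (simp add: abs_mult field_simps)
      ultimately have "\<bar>T f (\<lambda>x. inverse l * p x)\<bar> \<le> \<eta>" by (rule \<delta>(2))
      moreover have "T f (\<lambda>x. inverse l * p x) = inverse l * T f p"
        using current_with_lin_right[OF T f LipI[OF p(1)] LipI[OF p(1)], of "inverse l" 0] by simp
      ultimately have "inverse l * \<bar>T f p\<bar> \<le> \<eta>" using l by (simp add: abs_mult)
      then have "\<bar>T f p\<bar> / l \<le> \<eta>" by (simp only: divide_inverse mult.commute)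
      then show ?thesis using l by (simp only: pos_divide_le_eq)
    qed
  qed
qed

text \<open>Cut off with a tent g that equals 1 on \<open>K\<close> and vanishes outside the
  r-neighbourhood. Locality gives T g p = 0, and 1 - g lives off \<open>K\<close>, so only the mass
  there counts.\<close>

lemma current_bound_off_neighbourhood:
  fixes X :: "'a::metric_space set"
  assumes T: "current_with X T \<mu>" and p: "l-lipschitz_on X p" and r: "0 < r"
    and K: "K \<subseteq> X" "closed K" "K \<noteq> {}" and p0: "\<And>x. x \<in> X \<Longrightarrow> infdist x K < r \<Longrightarrow> p x = 0"
  shows "\<bar>T (\<lambda>_. 1) p\<bar> \<le> l * measure \<mu> (X - K)"
proof -
  note fin = current_with_finite[OF T]
  interpret finite_measure \<mu> by (rule finite_Borel_finite_measure[OF fin])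
  define g where "g x = max 0 (1 - infdist x K / r)" for x
  have g: "(1 / r)-lipschitz_on X g"
  proof (rule lipschitz_onI)
    fix x y
    have "\<bar>infdist x K - infdist y K\<bar> / r \<le> dist x y / r"
      using infdist_triangle_abs[of x K y] r by (intro divide_right_mono) auto
    moreover have "\<bar>infdist x K / r - infdist y K / r\<bar> = \<bar>infdist x K - infdist y K\<bar> / r"
      using r by (simp add: diff_divide_distrib[symmetric])
    ultimately have "\<bar>infdist x K / r - infdist y K / r\<bar> \<le> 1 / r * dist x y" by simp
    then show "dist (g x) (g y) \<le> 1 / r * dist x y" unfolding g_def dist_real_def by linarith
  qed (use r in simp)
  have g01: "0 \<le> g x" "g x \<le> 1" for x
    using infdist_nonneg[of x K] r by (auto simp: g_def)
  have gL: "g \<in> Lip\<^sub>b X" by (rule Lip\<^sub>b_I[OF g, of 1]) (use g01 in auto)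
  have g1L: "(\<lambda>x. 1 - g x) \<in> Lip\<^sub>b X" using Lip\<^sub>b_lin[OF Lip\<^sub>b_const gL, of 1 1 "-1"] by simp
  let ?U = "{x \<in> X. infdist x K < r}"
  have "T g p = 0"
  proof (rule current_with_locality[OF T gL LipI[OF p], of ?U])
    have "open {x. infdist x K < r}"
      by (intro open_Collect_less continuous_intros)
    then show "openin (top_of_set X) ?U" by (auto simp: openin_open)
    show "{x \<in> X. g x \<noteq> 0} \<subseteq> ?U" using r by (auto simp: g_def max_def divide_simps split: if_splits)
    show "p constant_on ?U" using p0 by (auto simp: constant_on_def)
  qed
  moreover have "T (\<lambda>x. 1 * g x + 1 * (1 - g x)) p = 1 * T g p + 1 * T (\<lambda>x. 1 - g x) p"
    by (rule current_with_lin_left[OF T gL g1L LipI[OF p]])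
  ultimately have "T (\<lambda>_. 1) p = T (\<lambda>x. 1 - g x) p" by simp
  also have "\<bar>\<dots>\<bar> \<le> l * (\<integral>x. \<bar>1 - g x\<bar> \<partial>\<mu>)" by (rule current_with_bound[OF T g1L p])
  also have "\<dots> \<le> l * measure \<mu> (X - K)"
  proof (rule mult_left_mono[OF _ lipschitz_on_nonneg[OF p]])
    have XK: "X - K \<in> sets \<mu>"
      using finite_Borel_Int[OF fin, of "- K"] K(2) by (simp add: Diff_eq borel_closed)
    have "(\<integral>x. \<bar>1 - g x\<bar> \<partial>\<mu>) \<le> (\<integral>x. indicator (X - K) x \<partial>\<mu>)"
    proof (rule integral_mono)
      show "integrable \<mu> (\<lambda>x. \<bar>1 - g x\<bar>)"
        by (rule integrable_abs[OF bounded_Borel_integrable[OF fin Lip\<^sub>b_imp_bounded_Borel[OF g1L]]])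
      show "integrable \<mu> (indicator (X - K) :: 'a \<Rightarrow> real)" using XK by (simp add: emeasure_eq_measure)
      fix x assume "x \<in> space \<mu>"
      then show "\<bar>1 - g x\<bar> \<le> indicator (X - K) x"
        using g01[of x] finite_Borel_space[OF fin] by (cases "x \<in> K") (auto simp: g_def)
    qed
    also have "\<dots> = measure \<mu> (X - K)" using XK finite_Borel_space[OF fin] by (simp add: Int_absorb2)
    finally show "(\<integral>x. \<bar>1 - g x\<bar> \<partial>\<mu>) \<le> measure \<mu> (X - K)" .
  qed
  finally show ?thesis .
qed

text \<open>A function vanishing on a fine net of a compact set of nearly full mass is small near
  this set. Truncation splits it into a uniformly small part, negligible by joint continuity, and a
  part vanishing near the set, negligible by the mass bound.\<close>

lemma boundary_finitely_determined:
  fixes X :: "'a::metric_space set"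
  assumes T: "current_with X T \<mu>"
    and tight: "\<And>\<eta>. 0 < \<eta> \<Longrightarrow> \<exists>K. compact K \<and> K \<subseteq> X \<and> measure \<mu> (X - K) < \<eta>" and X: "X \<noteq> {}"
  shows "finitely_determined X (T (\<lambda>_. 1))"
  unfolding finitely_determined_def
proof (intro allI impI)
  fix \<eta> :: real assume \<eta>: "0 < \<eta>"
  then have \<eta>2: "0 < \<eta> / 2" by simp
  obtain \<delta> where \<delta>: "0 < \<delta>" "\<And>p l. 0 \<le> l \<Longrightarrow> l-lipschitz_on X p \<Longrightarrow> (\<And>x. x \<in> X \<Longrightarrow> \<bar>p x\<bar> \<le> \<delta> * l) \<Longrightarrow> \<bar>T (\<lambda>_. 1) p\<bar> \<le> (\<eta>/2) * l"
    using current_small_uniformly[OF T Lip\<^sub>b_const \<eta>2] by blast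
  interpret finite_measure \<mu> by (rule finite_Borel_finite_measure[OF current_with_finite[OF T]])
  obtain K0 where K0: "compact K0" "K0 \<subseteq> X" "measure \<mu> (X - K0) < \<eta>/2" using tight[OF \<eta>2] by blast
  obtain x0 where x0: "x0 \<in> X" using X by blast
  \<comment> \<open>The added point makes \<open>K\<close> nonempty; \<open>infdist\<close> to the
    empty set would be 0 everywhere.\<close>
  define K where "K = insert x0 K0"
  have K: "compact K" "K \<subseteq> X" "K \<noteq> {}" using K0 x0 by (auto simp: K_def)
  have XK: "X - K0 \<in> sets \<mu>"
    using finite_Borel_Int[OF current_with_finite[OF T], of "- K0"] compact_imp_closed[OF K0(1)]
    by (simp add: Diff_eq borel_closed)
  have mK: "measure \<mu> (X - K) < \<eta>/2"
    using finite_measure_mono[OF _ XK, of "X - K"] K0(3) by (force simp: K_def)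
  \<comment> \<open>A net of mesh r on \<open>K\<close> and one more step of length r off
    \<open>K\<close> keep \<bar>p\<bar> below 2rl = \<delta>l on the r-neighbourhood.\<close>
  define r where "r = \<delta> / 2"
  have r: "0 < r" using \<delta> by (simp add: r_def)
  obtain F where F: "F \<subseteq> K" "finite F" "K \<subseteq> (\<Union>x\<in>F. ball x r)"
    using compactE_image[OF K(1), of K "\<lambda>x. ball x r"] r by (metis (no_types, lifting) UN_iff centre_in_ball open_ball subsetI)
  have "\<bar>T (\<lambda>_. 1) p\<bar> \<le> \<eta> * l" if p: "l-lipschitz_on X p" and p0: "\<forall>x\<in>F. p x = 0" for p l
  proof -
    have l: "0 \<le> l" using lipschitz_on_nonneg[OF p] .
    have pK: "\<bar>p x\<bar> \<le> r * l" if "x \<in> K" for x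
    proof -
      obtain y where y: "y \<in> F" "dist y x < r" using F(3) \<open>x \<in> K\<close> by auto
      then have yx: "y \<in> X" "x \<in> X" using F(1) K(2) \<open>x \<in> K\<close> by auto
      have "\<bar>p x\<bar> \<le> l * dist x y" using lipschitz_onD[OF p yx(2,1)] p0 y by (simp add: dist_real_def)
      also have "\<dots> \<le> l * r" using y l by (intro mult_left_mono) (auto simp: dist_commute)
      finally show ?thesis by (simp add: mult.commute)
    qed
    have near: "\<bar>p x\<bar> \<le> \<delta> * l" if x: "x \<in> X" "infdist x K < r" for x
    proof -
      obtain y where y: "y \<in> K" "dist x y < r" using x(2) K(3)
        by (auto simp: infdist_notempty cINF_less_iff bdd_belowI2[of _ 0])
      have "\<bar>p x - p y\<bar> \<le> l * dist x y" using lipschitz_onD[OF p x(1), of y] y K by (auto simp: dist_real_def)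
      also have "\<dots> \<le> l * r" using y l by (intro mult_left_mono) auto
      finally have "\<bar>p x\<bar> \<le> r * l + l * r" using pK[OF y(1)] by linarith
      then show ?thesis by (simp add: r_def)
    qed
    \<comment> \<open>Truncation at the level \<delta>l: q is uniformly small, and p - q vanishes
      wherever \<bar>p\<bar> \<le> \<delta>l, in particular near \<open>K\<close>.\<close>
    define q where "q x = max (- (\<delta> * l)) (min (\<delta> * l) (p x))" for x
    have dl: "0 \<le> \<delta> * l" using \<delta>(1) l by simp
    have q: "l-lipschitz_on X q" and pq: "l-lipschitz_on X (\<lambda>x. p x - q x)"
    proof -
      have "\<bar>q x - q y\<bar> \<le> \<bar>p x - p y\<bar>" "\<bar>(p x - q x) - (p y - q y)\<bar> \<le> \<bar>p x - p y\<bar>" for x y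
        using dl unfolding q_def by linarith+
      then show "l-lipschitz_on X q" "l-lipschitz_on X (\<lambda>x. p x - q x)"
        using lipschitz_onD[OF p] l unfolding lipschitz_on_def dist_real_def by (meson order_trans)+
    qed
    have "\<bar>T (\<lambda>_. 1) q\<bar> \<le> (\<eta>/2) * l"
      by (rule \<delta>(2)[OF l q]) (use dl in \<open>auto simp: q_def\<close>)
    moreover have "\<bar>T (\<lambda>_. 1) (\<lambda>x. p x - q x)\<bar> \<le> l * measure \<mu> (X - K)"
    proof (rule current_bound_off_neighbourhood[OF T pq r K(2) compact_imp_closed[OF K(1)] K(3)])
      fix x assume "x \<in> X" "infdist x K < r"
      then show "p x - q x = 0" using near[of x] by (auto simp: q_def abs_le_iff)
    qed
    moreover have "l * measure \<mu> (X - K) \<le> l * (\<eta>/2)" using mK l by (intro mult_left_mono) auto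
    moreover have "T (\<lambda>_. 1) (\<lambda>x. p x - q x) = T (\<lambda>_. 1) p - T (\<lambda>_. 1) q"
      by (rule current_with_diff_right[OF T Lip\<^sub>b_const LipI[OF p] LipI[OF q]])
    ultimately show ?thesis by (simp add: mult.commute)
  qed
  then show "\<exists>F. finite F \<and> F \<subseteq> X \<and> (\<forall>p l. l-lipschitz_on X p \<longrightarrow> (\<forall>x\<in>F. p x = 0) \<longrightarrow> \<bar>T (\<lambda>_. 1) p\<bar> \<le> \<eta> * l)"
    using F K(2) by (intro exI[of _ F]) blast
qed

section \<open>Curves avoiding a measure and a hyperplane\<close>

text \<open>On a line z + t w with z outside \<open>U\<close> and \<open>V\<close>, each of these
  two contains at most one point, so one of t = 1, 2, 3 avoids both. If z is in \<open>W\<close> and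
  w is not, these points avoid \<open>W\<close> as well.\<close>

lemma avoid_three_subspaces:
  fixes U V W :: "'a::real_vector set"
  assumes sub: "subspace U" "subspace V" "subspace W" and ne: "U \<noteq> UNIV" "V \<noteq> UNIV" "W \<noteq> UNIV"
  obtains z where "z \<notin> U" "z \<notin> V" "z \<notin> W"
proof -
  obtain u v w where uvw: "u \<notin> U" "v \<notin> V" "w \<notin> W" using ne by blast
  have "\<exists>z. z \<notin> U \<and> z \<notin> V"
  proof (cases "u \<in> V \<and> v \<in> U")
    case True
    have "u + v \<notin> U" using subspace_diff[OF sub(1), of "u + v" v] True uvw(1) by auto
    moreover have "u + v \<notin> V" using subspace_diff[OF sub(2), of "u + v" u] True uvw(2) by auto
    ultimately show ?thesis by blast
  qed (use uvw in blast)
  then obtain z where z: "z \<notin> U" "z \<notin> V" by blast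
  show ?thesis
  proof (cases "z \<in> W")
    case True
    have zW: "z + t *\<^sub>R w \<notin> W" if "t \<noteq> 0" for t
    proof
      assume "z + t *\<^sub>R w \<in> W"
      then have "t *\<^sub>R w \<in> W" using subspace_diff[OF sub(3) _ True] by fastforce
      then have "inverse t *\<^sub>R t *\<^sub>R w \<in> W" by (rule subspace_scale[OF sub(3)])
      then show False using that uvw(3) by simp
    qed
    have uniq: "s = t" if S: "subspace S" "z \<notin> S" "z + s *\<^sub>R w \<in> S" "z + t *\<^sub>R w \<in> S" for S s t
    proof (rule ccontr)
      assume "s \<noteq> t"
      have "(z + s *\<^sub>R w) - (z + t *\<^sub>R w) \<in> S" by (rule subspace_diff[OF S(1,3,4)])
      then have "(s - t) *\<^sub>R w \<in> S" by (simp add: scaleR_left_diff_distrib)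
      then have "inverse (s - t) *\<^sub>R (s - t) *\<^sub>R w \<in> S" by (rule subspace_scale[OF S(1)])
      then have "w \<in> S" using \<open>s \<noteq> t\<close> by simp
      then have "s *\<^sub>R w \<in> S" by (rule subspace_scale[OF S(1)])
      then have "(z + s *\<^sub>R w) - s *\<^sub>R w \<in> S" by (rule subspace_diff[OF S(1,3)])
      then show False using S(2) by simp
    qed
    have "\<exists>t\<in>{1, 2, 3::real}. z + t *\<^sub>R w \<notin> U \<and> z + t *\<^sub>R w \<notin> V"
    proof (rule ccontr)
      assume H: "\<not> ?thesis"
      then have a: "z + 1 *\<^sub>R w \<in> U \<or> z + 1 *\<^sub>R w \<in> V" and b: "z + 2 *\<^sub>R w \<in> U \<or> z + 2 *\<^sub>R w \<in> V"
        and c: "z + 3 *\<^sub>R w \<in> U \<or> z + 3 *\<^sub>R w \<in> V" by blast+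
      show False
        using a b c uniq[OF sub(1) z(1), of 1 2] uniq[OF sub(1) z(1), of 1 3] uniq[OF sub(1) z(1), of 2 3]
          uniq[OF sub(2) z(2), of 1 2] uniq[OF sub(2) z(2), of 1 3] uniq[OF sub(2) z(2), of 2 3] by auto
    qed
    then obtain t where t: "t \<in> {1, 2, 3::real}" "z + t *\<^sub>R w \<notin> U" "z + t *\<^sub>R w \<notin> V" by blast
    then have "t \<noteq> 0" by auto
    then show ?thesis using zW t that by blast
  qed (use z that in blast)
qed

lemma span_singleton_ne_UNIV:
  fixes u :: "'a::real_vector"
  assumes "\<exists>S::'a set. independent S \<and> card S > 1"
  shows "span {u} \<noteq> UNIV"
proof
  assume span: "span {u} = UNIV"
  obtain S :: "'a set" where S: "independent S" "card S > 1" using assms by blast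
  have "card S \<le> card {u}" using independent_span_bound[of "{u}" S] S(1) span by simp
  then show False using S(2) by simp
qed

text \<open>Measures of disjoint sets are summable, and a summable family has countable support. An
  uncountable disjoint family thus contains null sets.\<close>

lemma (in finite_measure) countable_nonnull_disjoint:
  assumes A: "\<And>t. t \<in> J \<Longrightarrow> A t \<in> sets M" and disj: "disjoint_family_on A J"
  shows "countable {t \<in> J. measure M (A t) \<noteq> 0}"
proof -
  have "(\<lambda>t. measure M (A t)) summable_on J"
  proof (rule nonneg_bdd_above_summable_on)
    have "sum (\<lambda>t. measure M (A t)) F \<le> measure M (space M)" if F: "F \<subseteq> J" "finite F" for F
    proof -
      have "sum (\<lambda>t. measure M (A t)) F = measure M (\<Union>t\<in>F. A t)"
        using F A disj by (intro finite_measure_finite_Union[symmetric])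
          (auto intro: disjoint_family_on_mono)
      also have "\<dots> \<le> measure M (space M)" by (rule bounded_measure)
      finally show ?thesis .
    qed
    then show "bdd_above (sum (\<lambda>t. measure M (A t)) ` {F. F \<subseteq> J \<and> finite F})"
      by (auto intro!: bdd_aboveI[of _ "measure M (space M)"])
  qed simp
  then have "(\<lambda>t. norm (measure M (A t))) summable_on J" by simp
  then show ?thesis by (rule abs_summable_countable)
qed

text \<open>The directions u + (s t) w are pairwise nonparallel because u is not a multiple of w, so
  the segments share only their common origin.\<close>

lemma segment_minus_disjoint:
  fixes x u w :: "'a::real_vector"
  assumes uw: "\<And>k. u \<noteq> k *\<^sub>R w" and w: "w \<noteq> 0" and s: "s \<noteq> 0"
  shows "disjoint_family_on (\<lambda>t. closed_segment x (x + (u + (s * t) *\<^sub>R w)) - {x}) J"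
  unfolding disjoint_family_on_def
proof (intro ballI impI)
  fix t t' :: real assume tt: "t \<noteq> t'"
  have False if z: "z \<in> closed_segment x (x + (u + (s * t) *\<^sub>R w))" "z \<in> closed_segment x (x + (u + (s * t') *\<^sub>R w))" "z \<noteq> x" for z
  proof -
    have u0: "u \<noteq> 0" using uw[of 0] by simp
    obtain a where a: "z = (1 - a) *\<^sub>R x + a *\<^sub>R (x + (u + (s * t) *\<^sub>R w))" using z(1) by (auto simp: in_segment)
    obtain b where b: "z = (1 - b) *\<^sub>R x + b *\<^sub>R (x + (u + (s * t') *\<^sub>R w))" using z(2) by (auto simp: in_segment)
    have a': "z - x = a *\<^sub>R u + (a * (s * t)) *\<^sub>R w" using a by (simp add: algebra_simps)
    have b': "z - x = b *\<^sub>R u + (b * (s * t')) *\<^sub>R w" using b by (simp add: algebra_simps)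
    have a0: "a \<noteq> 0" using a' z(3) by auto
    have "a *\<^sub>R u - b *\<^sub>R u = (b * (s * t')) *\<^sub>R w - (a * (s * t)) *\<^sub>R w"
      using a' b' by (simp add: algebra_simps)
    then have eq: "(a - b) *\<^sub>R u = (b * (s * t') - a * (s * t)) *\<^sub>R w" by (simp only: scaleR_left_diff_distrib)
    have ab: "a = b"
    proof (rule ccontr)
      assume ne: "a \<noteq> b"
      then have "u = inverse (a - b) *\<^sub>R ((a - b) *\<^sub>R u)" by simp
      also have "\<dots> = (inverse (a - b) * (b * (s * t') - a * (s * t))) *\<^sub>R w" unfolding eq by simp
      finally show False using uw by blast
    qed
    have "a * s * (t' - t) = b * (s * t') - a * (s * t)" using ab by (simp add: right_diff_distrib)
    then have "(a * s * (t' - t)) *\<^sub>R w = (a - b) *\<^sub>R u" using eq by (simp only:)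
    then have "(a * s * (t' - t)) *\<^sub>R w = 0" using ab by simp
    then show False using a0 s tt w by auto
  qed
  then show "(closed_segment x (x + (u + (s * t) *\<^sub>R w)) - {x}) \<inter> (closed_segment x (x + (u + (s * t') *\<^sub>R w)) - {x}) = {}"
    by blast
qed

text \<open>The curve has two legs meeting in a corner \<open>m t\<close> close to the midpoint of x
  and y. Different t give disjoint legs apart from the fixed end point, so all but countably many t
  give \<mu>-null legs; at most one t puts the corner on the hyperplane. Uncountably many t are
  available.\<close>

lemma curve_avoiding:
  fixes C :: "'a::real_normed_vector set" and \<phi> :: "'a \<Rightarrow> real"
  assumes dim: "\<exists>S::'a set. independent S \<and> card S > 1"
    and C: "convex C" "0 < r" "cball 0 r \<subseteq> C"
    and \<mu>: "finite_Borel_measure C \<mu>" and \<phi>: "linear \<phi>" "\<phi> v \<noteq> 0"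
    and xy: "x \<in> C" "y \<in> C" "x \<noteq> y" and \<epsilon>: "0 < \<epsilon>"
  obtains \<kappa> and \<gamma> :: "real \<Rightarrow> 'a" and P where "\<kappa>-lipschitz_on {0..1} \<gamma>" "\<gamma> ` {0..1} \<subseteq> C" "\<gamma> 0 = x" "\<gamma> 1 = y" "\<kappa> \<le> dist x y + \<epsilon>"
    "P \<in> sets borel" "P \<subseteq> C" "emeasure \<mu> P = 0" "{t \<in> {0..1}. \<gamma> t \<notin> P} \<subseteq> {0, 1}"
    "finite {t \<in> {0..1}. \<phi> (\<gamma> t) = c}"
proof -
  interpret finite_measure \<mu> by (rule finite_Borel_finite_measure[OF \<mu>])
  define b where "b = midpoint x y"
  have bC: "b \<in> C" unfolding b_def using xy(1,2) C(1) by (meson convex_contains_segment midpoint_in_closed_segment subsetD)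
  \<comment> \<open>\<open>s * D\<close> bounds the distance of the corner from the
    midpoint.\<close>
  define D where "D = norm b + r"
  have D: "0 < D" "norm b \<le> D" using C(2) by (auto simp: D_def add_nonneg_pos)
  have dxy: "0 < dist x y" using xy by simp
  \<comment> \<open>The first bound makes the corner a convex combination, the second makes u and u'
    nonzero, and the third limits the excess length 2sD to \<epsilon>.\<close>
  define s where "s = min (1/2) (min (dist x y / (4 * D)) (\<epsilon> / (2 * D)))"
  have s: "0 < s" "s < 1" using D dxy \<epsilon> by (auto simp: s_def)
  have sD: "s * D \<le> dist x y / 4" "s * D \<le> \<epsilon> / 2"
  proof -
    have "s \<le> dist x y / (4 * D)" "s \<le> \<epsilon> / (2 * D)" by (auto simp: s_def)
    then show "s * D \<le> dist x y / 4" "s * D \<le> \<epsilon> / 2" using D(1) by (auto simp: field_simps)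
  qed
  have "s * norm b \<le> s * D" using s D by (intro mult_left_mono) auto
  then have sb: "s * norm b \<le> dist x y / 4" using sD by linarith
  \<comment> \<open>\<open>u\<close> and \<open>u'\<close> are the vectors from x and from y to the
    unshifted corner \<open>m 0\<close>.\<close>
  define u where "u = (1/2) *\<^sub>R (y - x) - s *\<^sub>R b"
  define u' where "u' = (1/2) *\<^sub>R (x - y) - s *\<^sub>R b"
  have nu: "norm ((1/2) *\<^sub>R (y - x)) = dist x y / 2" "norm ((1/2) *\<^sub>R (x - y)) = dist x y / 2"
    by (simp_all add: dist_norm norm_minus_commute)
  have nsb: "norm (s *\<^sub>R b) = s * norm b" using s by simp
  have u0: "u \<noteq> 0"
  proof
    assume "u = 0"
    then have "norm ((1/2) *\<^sub>R (y - x)) = norm (s *\<^sub>R b)" by (simp add: u_def)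
    then show False using nu nsb sb dxy by linarith
  qed
  have u'0: "u' \<noteq> 0"
  proof
    assume "u' = 0"
    then have "norm ((1/2) *\<^sub>R (x - y)) = norm (s *\<^sub>R b)" by (simp add: u'_def)
    then show False using nu nsb sb dxy by linarith
  qed
  \<comment> \<open>Outside the two spans the legs from x and from y fan out without overlap;
    outside the kernel of \<phi> the corner moves transversally to the hyperplane.\<close>
  obtain w0 where w0: "w0 \<notin> span {u}" "w0 \<notin> span {u'}" "w0 \<notin> {z. \<phi> z = 0}"
  proof (rule avoid_three_subspaces[of "span {u}" "span {u'}" "{z. \<phi> z = 0}"])
    show "subspace {z. \<phi> z = 0}" using linear_subspace_kernel[OF \<phi>(1)] .
    show "{z. \<phi> z = 0} \<noteq> UNIV" using \<phi>(2) by blast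
  qed (use span_singleton_ne_UNIV[OF dim] subspace_span that in blast)+
  have w00: "w0 \<noteq> 0" using w0(1) span_zero by blast
  define w where "w = (r / norm w0) *\<^sub>R w0"
  have rw: "r / norm w0 \<noteq> 0" using C(2) w00 by simp
  have w: "norm w = r" "w \<noteq> 0" "\<phi> w \<noteq> 0"
    using w00 C(2) w0(3) \<phi>(1) by (auto simp: w_def linear_cmul)
  have indep: "a \<noteq> k *\<^sub>R w" if "a \<noteq> 0" "w0 \<notin> span {a}" for a k
  proof
    assume a: "a = k *\<^sub>R w"
    then have "k * (r / norm w0) \<noteq> 0" using that(1) rw by auto
    moreover have "a = (k * (r / norm w0)) *\<^sub>R w0" using a by (simp add: w_def)
    ultimately have "w0 = inverse (k * (r / norm w0)) *\<^sub>R a" by simp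
    moreover have "inverse (k * (r / norm w0)) *\<^sub>R a \<in> span {a}" by (intro span_scale span_base) simp
    ultimately have "w0 \<in> span {a}" by (rule ssubst)
    then show False using that(2) by simp
  qed
  \<comment> \<open>A convex combination of the midpoint and the point t w of the ball about 0,
    hence in \<open>C\<close> for every t in the unit interval.\<close>
  define m where "m t = (1 - s) *\<^sub>R b + s *\<^sub>R (t *\<^sub>R w)" for t
  have half: "p + (1/2) *\<^sub>R (q - p) = (1/2) *\<^sub>R p + (1/2) *\<^sub>R q" for p q :: 'a
  proof -
    have h: "(1/2) *\<^sub>R p + (1/2) *\<^sub>R p = p" by (simp flip: scaleR_left_distrib)
    have "p + (1/2) *\<^sub>R (q - p) = ((1/2) *\<^sub>R p + (1/2) *\<^sub>R p) + ((1/2) *\<^sub>R q - (1/2) *\<^sub>R p)"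
      unfolding h by (simp add: scaleR_diff_right)
    then show ?thesis by simp
  qed
  have bx: "b = x + (1/2) *\<^sub>R (y - x)" and bY: "b = y + (1/2) *\<^sub>R (x - y)"
    unfolding half by (simp_all add: b_def midpoint_def scaleR_add_right add.commute)
  have mb: "m t = b - s *\<^sub>R b + (s * t) *\<^sub>R w" for t
    by (simp add: m_def scaleR_left_diff_distrib)
  have mx: "m t = x + (u + (s * t) *\<^sub>R w)" for t
    unfolding mb u_def by (subst (1) bx) (simp only: algebra_simps)
  have my: "m t = y + (u' + (s * t) *\<^sub>R w)" for t
    unfolding mb u'_def by (subst (1) bY) (simp only: algebra_simps)
  have mC: "m t \<in> C" if "t \<in> {0..1}" for t
  proof -
    have "norm (t *\<^sub>R w) \<le> r" using that w(1) C(2) by (auto simp: mult_left_le_one_le)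
    then have "t *\<^sub>R w \<in> C" using C(3) by auto
    then show ?thesis unfolding m_def using C(1) bC s by (intro convexD) auto
  qed
  \<comment> \<open>Each leg is at most dist x y / 2 + s D long and is traversed in half of the unit
    time.\<close>
  define \<kappa> where "\<kappa> = dist x y + 2 * (s * D)"
  have \<kappa>: "0 \<le> \<kappa>" "\<kappa> \<le> dist x y + \<epsilon>" using sD(2) s(1) D(1) by (auto simp: \<kappa>_def)
  have len: "2 * norm (m t - x) \<le> \<kappa>" "2 * norm (y - m t) \<le> \<kappa>" if t: "t \<in> {0..1}" for t
  proof -
    have "\<bar>s * t\<bar> * norm w \<le> s * r" using t s w(1) C(2) by (auto simp: abs_mult intro!: mult_right_mono mult_left_le)
    then have st: "norm ((s * t) *\<^sub>R w) \<le> s * r" by simp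
    have "norm (m t - x) \<le> norm u + norm ((s * t) *\<^sub>R w)" unfolding mx add_diff_cancel_left' by (rule norm_triangle_ineq)
    moreover have "norm u \<le> dist x y / 2 + s * norm b" unfolding u_def using norm_triangle_ineq4[of "(1/2) *\<^sub>R (y - x)" "s *\<^sub>R b"] nu(1) nsb by linarith
    moreover have "norm (y - m t) \<le> norm u' + norm ((s * t) *\<^sub>R w)"
      unfolding norm_minus_commute[of y] my add_diff_cancel_left' by (rule norm_triangle_ineq)
    moreover have "norm u' \<le> dist x y / 2 + s * norm b" unfolding u'_def using norm_triangle_ineq4[of "(1/2) *\<^sub>R (x - y)" "s *\<^sub>R b"] nu(2) nsb by linarith
    moreover have "s * D = s * norm b + s * r" by (simp add: D_def distrib_left)
    ultimately show "2 * norm (m t - x) \<le> \<kappa>" "2 * norm (y - m t) \<le> \<kappa>" using st unfolding \<kappa>_def by linarith+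
  qed
  have segC: "closed_segment x (m t) \<subseteq> C" "closed_segment y (m t) \<subseteq> C" if "t \<in> {0..1}" for t
    using xy mC[OF that] C(1) by (auto dest: closed_segment_subset)
  \<comment> \<open>The end points x and y are removed since all legs share them and they may be
    atoms of \<mu>; the curve visits them only at the parameters 0 and 1.\<close>
  define A where "A t = closed_segment x (m t) - {x}" for t
  define A' where "A' t = closed_segment y (m t) - {y}" for t
  have Ab: "A t \<in> sets borel" "A' t \<in> sets borel" for t
    unfolding A_def A'_def by (intro sets.Diff borel_closed closed_segment closed_singleton)+
  have As: "A t \<in> sets \<mu>" "A' t \<in> sets \<mu>" if "t \<in> {0..1}" for t
  proof -
    have "C \<inter> A t = A t" "C \<inter> A' t = A' t" using segC[OF that] by (auto simp: A_def A'_def)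
    then show "A t \<in> sets \<mu>" "A' t \<in> sets \<mu>" using finite_Borel_Int[OF \<mu> Ab(1)[of t]] finite_Borel_Int[OF \<mu> Ab(2)[of t]] by simp_all
  qed
  have cA: "countable {t \<in> {0..1}. measure \<mu> (A t) \<noteq> 0}"
    unfolding A_def mx
  proof (rule countable_nonnull_disjoint)
    show "closed_segment x (x + (u + (s * t) *\<^sub>R w)) - {x} \<in> sets \<mu>" if "t \<in> {0..1}" for t
      using As(1)[OF that] unfolding A_def mx .
    show "disjoint_family_on (\<lambda>t. closed_segment x (x + (u + (s * t) *\<^sub>R w)) - {x}) {0..1}"
      using indep[OF u0 w0(1)] w(2) s(1) by (intro segment_minus_disjoint) simp_all
  qed
  have cA': "countable {t \<in> {0..1}. measure \<mu> (A' t) \<noteq> 0}"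
    unfolding A'_def my
  proof (rule countable_nonnull_disjoint)
    show "closed_segment y (y + (u' + (s * t) *\<^sub>R w)) - {y} \<in> sets \<mu>" if "t \<in> {0..1}" for t
      using As(2)[OF that] unfolding A'_def my .
    show "disjoint_family_on (\<lambda>t. closed_segment y (y + (u' + (s * t) *\<^sub>R w)) - {y}) {0..1}"
      using indep[OF u'0 w0(2)] w(2) s(1) by (intro segment_minus_disjoint) simp_all
  qed
  have \<phi>m: "\<phi> (m t) = (1 - s) * \<phi> b + s * t * \<phi> w" for t
    using \<phi>(1) by (simp add: m_def linear_add linear_cmul)
  have "{t. \<phi> (m t) = c} \<subseteq> {(c - (1 - s) * \<phi> b) / (s * \<phi> w)}"
  proof
    fix t assume "t \<in> {t. \<phi> (m t) = c}"
    then have tc: "t * (s * \<phi> w) = c - (1 - s) * \<phi> b" by (simp add: \<phi>m algebra_simps)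
    have "s * \<phi> w \<noteq> 0" using s(1) w(3) by simp
    from eq_divide_imp[OF this tc] have "t = (c - (1 - s) * \<phi> b) / (s * \<phi> w)" .
    then show "t \<in> {(c - (1 - s) * \<phi> b) / (s * \<phi> w)}" by (simp only: singleton_iff)
  qed
  then have c\<phi>: "countable {t. \<phi> (m t) = c}" by (rule countable_subset) simp
  let ?bad = "{t \<in> {0..1}. measure \<mu> (A t) \<noteq> 0} \<union> {t \<in> {0..1}. measure \<mu> (A' t) \<noteq> 0} \<union> {t. \<phi> (m t) = c}"
  have "countable ?bad" using cA cA' c\<phi> by simp
  moreover have "uncountable {0..1::real}" by (simp add: uncountable_closed_interval)
  ultimately have "\<not> {0..1} \<subseteq> ?bad" using countable_subset[of "{0..1}" ?bad] by (metis (no_types))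
  then obtain t where t01: "t \<in> {0..1}" and tb: "t \<notin> ?bad" unfolding subset_iff by (simp only: not_all not_imp) (elim exE conjE)
  have t: "t \<in> {0..1}" "measure \<mu> (A t) = 0" "measure \<mu> (A' t) = 0" "\<phi> (m t) \<noteq> c"
    using t01 tb by simp_all
  define z where "z = m t"
  have zx: "z \<noteq> x"
  proof
    assume "z = x"
    then have "x = x + (u + (s * t) *\<^sub>R w)" using mx[of t] unfolding z_def by (rule trans[OF sym])
    then have "u + (s * t) *\<^sub>R w = 0" by (simp only: add_cancel_right_right)
    then have "u = (- (s * t)) *\<^sub>R w" unfolding scaleR_minus_left by (rule eq_neg_iff_add_eq_0[THEN iffD2])
    then show False using indep[OF u0 w0(1)] by blast
  qed
  have zy: "z \<noteq> y"
  proof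
    assume "z = y"
    then have "y = y + (u' + (s * t) *\<^sub>R w)" using my[of t] unfolding z_def by (rule trans[OF sym])
    then have "u' + (s * t) *\<^sub>R w = 0" by (simp only: add_cancel_right_right)
    then have "u' = (- (s * t)) *\<^sub>R w" unfolding scaleR_minus_left by (rule eq_neg_iff_add_eq_0[THEN iffD2])
    then show False using indep[OF u'0 w0(2)] by blast
  qed
  define \<gamma> where "\<gamma> \<tau> = (if \<tau> \<le> 1/2 then x + (2 * \<tau>) *\<^sub>R (z - x) else z + (2 * \<tau> - 1) *\<^sub>R (y - z))" for \<tau> :: real
  define P where "P = A t \<union> A' t"
  show ?thesis
  proof (rule that[of \<kappa> \<gamma> P])
    have l1: "\<kappa>-lipschitz_on {0..1/2} (\<lambda>\<tau>. x + (2 * \<tau>) *\<^sub>R (z - x))"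
    proof (rule lipschitz_onI)
      fix p q :: real
      have "dist (x + (2 * p) *\<^sub>R (z - x)) (x + (2 * q) *\<^sub>R (z - x)) = norm ((2 * (p - q)) *\<^sub>R (z - x))"
        unfolding dist_norm by (intro arg_cong[where f = norm]) (simp add: algebra_simps)
      also have "\<dots> = 2 * norm (z - x) * dist p q"
        by (simp only: norm_scaleR abs_mult dist_real_def abs_numeral mult.commute mult.left_commute)
      also have "\<dots> \<le> \<kappa> * dist p q" using len(1)[OF t(1)] unfolding z_def by (intro mult_right_mono) auto
      finally show "dist (x + (2 * p) *\<^sub>R (z - x)) (x + (2 * q) *\<^sub>R (z - x)) \<le> \<kappa> * dist p q" .
    qed (rule \<kappa>)
    have l2: "\<kappa>-lipschitz_on {1/2..1} (\<lambda>\<tau>. z + (2 * \<tau> - 1) *\<^sub>R (y - z))"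
    proof (rule lipschitz_onI)
      fix p q :: real
      have "dist (z + (2 * p - 1) *\<^sub>R (y - z)) (z + (2 * q - 1) *\<^sub>R (y - z)) = norm ((2 * (p - q)) *\<^sub>R (y - z))"
        unfolding dist_norm by (intro arg_cong[where f = norm]) (simp add: algebra_simps)
      also have "\<dots> = 2 * norm (y - z) * dist p q"
        by (simp only: norm_scaleR abs_mult dist_real_def abs_numeral mult.commute mult.left_commute)
      also have "\<dots> \<le> \<kappa> * dist p q" using len(2)[OF t(1)] unfolding z_def by (intro mult_right_mono) auto
      finally show "dist (z + (2 * p - 1) *\<^sub>R (y - z)) (z + (2 * q - 1) *\<^sub>R (y - z)) \<le> \<kappa> * dist p q" .
    qed (rule \<kappa>)
    show "\<kappa>-lipschitz_on {0..1} \<gamma>"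
      using lipschitz_on_concat[OF l1 l2] unfolding \<gamma>_def[abs_def] by simp
    have seg1: "\<gamma> \<tau> \<in> closed_segment x z" if "0 \<le> \<tau>" "\<tau> \<le> 1/2" for \<tau>
      using that unfolding in_segment \<gamma>_def by (intro exI[of _ "2 * \<tau>"]) (simp add: algebra_simps)
    have seg2: "\<gamma> \<tau> \<in> closed_segment y z" if "1/2 < \<tau>" "\<tau> \<le> 1" for \<tau>
      using that unfolding in_segment \<gamma>_def by (intro exI[of _ "2 - 2 * \<tau>"]) (simp add: algebra_simps scaleR_2)
    show "\<gamma> ` {0..1} \<subseteq> C"
    proof (rule image_subsetI)
      fix \<tau> :: real assume "\<tau> \<in> {0..1}"
      then show "\<gamma> \<tau> \<in> C" using seg1[of \<tau>] seg2[of \<tau>] segC[OF t(1)] unfolding z_def by (cases "\<tau> \<le> 1/2") auto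
    qed
    show "\<gamma> 0 = x" "\<gamma> 1 = y" by (simp_all add: \<gamma>_def)
    show "\<kappa> \<le> dist x y + \<epsilon>" by (rule \<kappa>)
    show "P \<in> sets borel" using Ab by (simp add: P_def)
    show "P \<subseteq> C" using segC[OF t(1)] by (auto simp: P_def A_def A'_def)
    have "emeasure \<mu> (A t) = 0" "emeasure \<mu> (A' t) = 0" using t(2,3) by (simp_all add: emeasure_eq_measure)
    then show "emeasure \<mu> P = 0" using As[OF t(1)] unfolding P_def
      by (intro emeasure_Un_null_set[THEN trans]) (auto intro!: null_setsI)
    show "{\<tau> \<in> {0..1}. \<gamma> \<tau> \<notin> P} \<subseteq> {0, 1}"
    proof (rule subsetI, rule ccontr)
      fix \<tau> assume "\<tau> \<in> {\<tau> \<in> {0..1}. \<gamma> \<tau> \<notin> P}" "\<tau> \<notin> {0, 1}"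
      then have \<tau>: "0 < \<tau>" "\<tau> < 1" "\<gamma> \<tau> \<notin> P" by auto
      show False
      proof (cases "\<tau> \<le> 1/2")
        case True
        have "\<gamma> \<tau> - x = (2 * \<tau>) *\<^sub>R (z - x)" using True by (simp add: \<gamma>_def)
        then have "\<gamma> \<tau> \<noteq> x" using zx \<tau>(1) by auto
        then show False using seg1[of \<tau>] True \<tau> by (simp add: P_def A_def z_def)
      next
        case False
        have "\<gamma> \<tau> - y = (2 - 2 * \<tau>) *\<^sub>R (z - y)" using False by (simp add: \<gamma>_def algebra_simps scaleR_2)
        then have "\<gamma> \<tau> \<noteq> y" using zy \<tau>(2) by auto
        then show False using seg2[of \<tau>] False \<tau> by (simp add: P_def A'_def z_def)
      qed
    qed
    have lin: "\<phi> (a + k *\<^sub>R (d - a)) = \<phi> a + k * (\<phi> d - \<phi> a)" for a d k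
      using \<phi>(1) by (simp add: linear_add linear_cmul linear_diff)
    have zc: "\<phi> z \<noteq> c" using t(4) by (simp add: z_def)
    \<comment> \<open>\<phi> is affine on each leg and differs from c at the corner, so it takes the
      value c at most once per leg; where a denominator is 0, that leg never meets the
      hyperplane.\<close>
    have "{\<tau> \<in> {0..1}. \<phi> (\<gamma> \<tau>) = c} \<subseteq> {(c - \<phi> x) / (\<phi> z - \<phi> x) / 2, ((c - \<phi> z) / (\<phi> y - \<phi> z) + 1) / 2}"
    proof
      fix \<tau> assume "\<tau> \<in> {\<tau> \<in> {0..1}. \<phi> (\<gamma> \<tau>) = c}"
      then have c: "\<phi> (\<gamma> \<tau>) = c" by simp
      show "\<tau> \<in> {(c - \<phi> x) / (\<phi> z - \<phi> x) / 2, ((c - \<phi> z) / (\<phi> y - \<phi> z) + 1) / 2}"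
      proof (cases "\<tau> \<le> 1/2")
        case True
        then have e: "\<phi> x + (2 * \<tau>) * (\<phi> z - \<phi> x) = c" using c lin[of x "2 * \<tau>" z] by (simp add: \<gamma>_def)
        then have "\<phi> z - \<phi> x \<noteq> 0" using zc by auto
        then have "(c - \<phi> x) / (\<phi> z - \<phi> x) = 2 * \<tau>" using e by (simp add: field_simps)
        then show ?thesis by simp
      next
        case False
        then have e: "\<phi> z + (2 * \<tau> - 1) * (\<phi> y - \<phi> z) = c" using c lin[of z "2 * \<tau> - 1" y] by (simp add: \<gamma>_def)
        then have "\<phi> y - \<phi> z \<noteq> 0" using zc by auto
        then have "(c - \<phi> z) / (\<phi> y - \<phi> z) = 2 * \<tau> - 1" using e by (simp add: divide_simps)
        then show ?thesis by simp
      qed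
    qed
    then show "finite {\<tau> \<in> {0..1}. \<phi> (\<gamma> \<tau>) = c}" by (rule finite_subset) simp
  qed
qed

section \<open>Filling the boundary\<close>

lemma emeasure_curve_measure_finite_null:
  assumes "\<kappa>-lipschitz_on {0..1} \<gamma>" "\<gamma> ` {0..1} \<subseteq> X" "A \<in> sets (restrict_space borel X)"
    and "finite {t \<in> {0..1}. \<gamma> t \<in> A}"
  shows "emeasure (curve_measure X \<gamma>) A = 0"
  using emeasure_curve_measure[OF assms(1-3)] emeasure_lborel_countable[OF countable_finite[OF assms(4)]] by simp

lemma finitely_determined_uminus:
  assumes "finitely_determined X L"
  shows "finitely_determined X (\<lambda>p. - L p)"
  using assms unfolding finitely_determined_def by simp

section \<open>Currents singular to a measure and to a hyperplane, and their iteration\<close>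

context
  fixes C :: "'a::real_normed_vector set" and \<phi> :: "'a \<Rightarrow> real" and \<mu> :: "'a measure" and r c :: real and v :: 'a
  assumes dim: "\<exists>S::'a set. independent S \<and> card S > 1"
    and C: "convex C" "0 < r" "cball 0 r \<subseteq> C"
    and \<mu>: "finite_Borel_measure C \<mu>" and \<phi>: "linear \<phi>" "\<phi> v \<noteq> 0"
begin

text \<open>\<open>P\<close> is part of the data as a witness that \<rho> and \<mu> are mutually
  singular; such witnesses can be united in countable sums. The last clause gives singularity to
  every measure living on the slice \<phi> = c, whatever that measure is.\<close>

definition avoiding :: "'a functional \<Rightarrow> 'a measure \<Rightarrow> 'a set \<Rightarrow> bool"
  where "avoiding R \<rho> P \<longleftrightarrow> current_with C R \<rho> \<and> P \<in> sets borel \<and> P \<subseteq> C \<and> emeasure \<mu> P = 0 \<and>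
    emeasure \<rho> (C - P) = 0 \<and> (\<forall>B\<in>sets borel. B \<subseteq> {x \<in> C. \<phi> x = c} \<longrightarrow> emeasure \<rho> B = 0)"

text \<open>Countability of \<open>I\<close> keeps the union of the sets \<open>P i\<close> Borel
  and \<mu>-null.\<close>

lemma avoiding_sum:
  fixes I :: "'i set"
  assumes I: "countable I" and av: "\<And>i. i \<in> I \<Longrightarrow> avoiding (T i) (\<nu> i) (P i)"
    and tot: "(\<integral>\<^sup>+i. emeasure (\<nu> i) C \<partial>count_space I) < \<infinity>"
  shows "avoiding (\<lambda>f p. \<integral>i. T i f p \<partial>count_space I) (sum_measure (restrict_space borel C) I \<nu>) (\<Union>i\<in>I. P i)"
proof -
  have cur: "\<And>i. i \<in> I \<Longrightarrow> current_with C (T i) (\<nu> i)" using av by (simp add: avoiding_def)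
  have fin: "\<And>i. i \<in> I \<Longrightarrow> finite_Borel_measure C (\<nu> i)" using cur current_with_finite by blast
  have PB: "P i \<in> sets borel" "P i \<subseteq> C" "emeasure \<mu> (P i) = 0" "emeasure (\<nu> i) (C - P i) = 0" if "i \<in> I" for i
    using av[OF that] by (simp_all add: avoiding_def)
  have rb: "B \<in> sets (restrict_space borel C)" if "B \<in> sets borel" "B \<subseteq> C" for B
    using that by (auto simp: sets_restrict_space)
  have cd: "C - D \<in> sets (restrict_space borel C)" if "D \<in> sets borel" for D
    using that unfolding sets_restrict_space by (auto intro!: image_eqI[of _ _ "- D"])
  have UP: "(\<Union>i\<in>I. P i) \<in> sets borel" using PB(1) I by (intro sets.countable_UN'') auto
  have zero: "emeasure (sum_measure (restrict_space borel C) I \<nu>) B = 0"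
    if "B \<in> sets (restrict_space borel C)" "\<And>i. i \<in> I \<Longrightarrow> emeasure (\<nu> i) B = 0" for B
  proof -
    have "emeasure (sum_measure (restrict_space borel C) I \<nu>) B = (\<integral>\<^sup>+i. emeasure (\<nu> i) B \<partial>count_space I)"
      by (rule emeasure_sum_Borel[OF fin tot that(1)])
    also have "\<dots> = (\<integral>\<^sup>+i. 0 \<partial>count_space I)" by (rule nn_integral_cong) (simp add: that(2))
    finally show ?thesis by simp
  qed
  show ?thesis unfolding avoiding_def
  proof (intro conjI ballI impI)
    show "current_with C (\<lambda>f p. \<integral>i. T i f p \<partial>count_space I) (sum_measure (restrict_space borel C) I \<nu>)"
      by (rule current_with_sum_measure[OF cur tot])
    show "(\<Union>i\<in>I. P i) \<in> sets borel" by (rule UP)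
    show "(\<Union>i\<in>I. P i) \<subseteq> C" using PB(2) by blast
    have "P i \<in> null_sets \<mu>" if "i \<in> I" for i
    proof -
      have "P i \<in> sets \<mu>" using rb[OF PB(1,2)[OF that]] finite_Borel_sets[OF \<mu>] by simp
      then show ?thesis using PB(3)[OF that] by (rule null_setsI[rotated])
    qed
    then have "(\<Union>i\<in>I. P i) \<in> null_sets \<mu>" by (intro null_sets_UN' I)
    then show "emeasure \<mu> (\<Union>i\<in>I. P i) = 0" by (rule null_setsD1)
    show "emeasure (sum_measure (restrict_space borel C) I \<nu>) (C - (\<Union>i\<in>I. P i)) = 0"
    proof (rule zero[OF cd[OF UP]])
      fix i assume i: "i \<in> I"
      have "emeasure (\<nu> i) (C - (\<Union>i\<in>I. P i)) \<le> emeasure (\<nu> i) (C - P i)"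
        using i cd[OF PB(1)[OF i]] finite_Borel_sets[OF fin[OF i]] by (intro emeasure_mono) auto
      then show "emeasure (\<nu> i) (C - (\<Union>i\<in>I. P i)) = 0" using PB(4)[OF i] by simp
    qed
    fix B assume B: "B \<in> sets borel" "B \<subseteq> {x \<in> C. \<phi> x = c}"
    show "emeasure (sum_measure (restrict_space borel C) I \<nu>) B = 0"
    proof (rule zero)
      show "B \<in> sets (restrict_space borel C)" using B by (intro rb) auto
      show "emeasure (\<nu> i) B = 0" if "i \<in> I" for i using av[OF that] B by (simp add: avoiding_def)
    qed
  qed
qed

text \<open>One round of the iteration: a molecule close to \<open>L\<close> is realised by curves.
  The residual inherits linearity and finite determination, so the round can be repeated on it with
  the norm \<eta> in place of \<open>M\<close>.\<close>

lemma stage: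
  assumes lin: "Lip_linear C L" and bound: "\<And>l p. l-lipschitz_on C p \<Longrightarrow> \<bar>L p\<bar> \<le> M * l"
    and M: "0 \<le> M" and det: "finitely_determined C L" and \<eta>: "0 < \<eta>"
  obtains R \<rho> P where "avoiding R \<rho> P" "emeasure \<rho> C \<le> ennreal (M + \<eta>)"
    "Lip_linear C (\<lambda>p. L p - R (\<lambda>_. 1) p)" "finitely_determined C (\<lambda>p. L p - R (\<lambda>_. 1) p)"
    "\<And>l p. l-lipschitz_on C p \<Longrightarrow> \<bar>L p - R (\<lambda>_. 1) p\<bar> \<le> \<eta> * l"
proof -
  have Cne: "C \<noteq> {}" using C(2,3) by (metis cball_eq_empty less_le_not_le subset_empty)
  obtain I a where I: "finite I" "I \<subseteq> {z \<in> C \<times> C. fst z \<noteq> snd z}"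
    and cost: "(\<Sum>z\<in>I. \<bar>a z\<bar> * dist (fst z) (snd z)) \<le> M"
    and approx: "\<And>l p. l-lipschitz_on C p \<Longrightarrow> \<bar>L p - (\<Sum>z\<in>I. a z * (p (snd z) - p (fst z)))\<bar> \<le> \<eta> * l"
    using molecule_approximation[OF Cne lin bound M det \<eta>] by blast
  \<comment> \<open>Excess length per curve, such that the total excess weighted by the coefficients
    is at most \<eta>; the 1 covers the case that all coefficients vanish.\<close>
  define e where "e = \<eta> / (1 + (\<Sum>z\<in>I. \<bar>a z\<bar>))"
  have S0: "0 \<le> (\<Sum>z\<in>I. \<bar>a z\<bar>)" by (intro sum_nonneg) simp
  then have S1: "0 < 1 + (\<Sum>z\<in>I. \<bar>a z\<bar>)" by linarith
  have e: "0 < e" unfolding e_def by (rule divide_pos_pos[OF \<eta> S1])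
  have "e * (\<Sum>z\<in>I. \<bar>a z\<bar>) \<le> e * (1 + (\<Sum>z\<in>I. \<bar>a z\<bar>))" using e by (intro mult_left_mono) simp_all
  also have "\<dots> = \<eta>" unfolding e_def using S1 by simp
  finally have eS: "e * (\<Sum>z\<in>I. \<bar>a z\<bar>) \<le> \<eta>" .
  define good where "good z \<kappa> \<gamma> P \<longleftrightarrow> \<kappa>-lipschitz_on {0..1} \<gamma> \<and> \<gamma> ` {0..1} \<subseteq> C \<and> \<gamma> 0 = fst z \<and> \<gamma> 1 = snd z \<and>
    \<kappa> \<le> dist (fst z) (snd z) + e \<and> P \<in> sets borel \<and> P \<subseteq> C \<and> emeasure \<mu> P = 0 \<and>
    {t \<in> {0..1}. \<gamma> t \<notin> P} \<subseteq> {0, 1} \<and> finite {t \<in> {0..1}. \<phi> (\<gamma> t) = c}"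
    for z \<kappa> and \<gamma> :: "real \<Rightarrow> 'a" and P
  have "\<forall>z\<in>I. \<exists>q. good z (fst q) (fst (snd q)) (snd (snd q))"
  proof
    fix z assume "z \<in> I"
    then have z': "fst z \<in> C" "snd z \<in> C" "fst z \<noteq> snd z" using I(2) by auto
    show "\<exists>q. good z (fst q) (fst (snd q)) (snd (snd q))"
    proof (rule curve_avoiding[OF dim C \<mu> \<phi> z' e, of c])
      fix \<kappa> and \<gamma> :: "real \<Rightarrow> 'a" and P
      assume "\<kappa>-lipschitz_on {0..1} \<gamma>" "\<gamma> ` {0..1} \<subseteq> C" "\<gamma> 0 = fst z" "\<gamma> 1 = snd z" "\<kappa> \<le> dist (fst z) (snd z) + e"
        "P \<in> sets borel" "P \<subseteq> C" "emeasure \<mu> P = 0" "{t \<in> {0..1}. \<gamma> t \<notin> P} \<subseteq> {0, 1}"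
        "finite {t \<in> {0..1}. \<phi> (\<gamma> t) = c}"
      then have "good z \<kappa> \<gamma> P" unfolding good_def by (intro conjI)
      then show ?thesis by (intro exI[of _ "(\<kappa>, \<gamma>, P)"]) simp
    qed
  qed
  then obtain q where q: "\<forall>z\<in>I. good z (fst (q z)) (fst (snd (q z))) (snd (snd (q z)))" by (rule bchoice[THEN exE])
  define \<kappa> \<gamma> P where "\<kappa> z = fst (q z)" and "\<gamma> z = fst (snd (q z))" and "P z = snd (snd (q z))" for z
  have good: "good z (\<kappa> z) (\<gamma> z) (P z)" if "z \<in> I" for z
    using bspec[OF q that] unfolding \<kappa>_def \<gamma>_def P_def .
  have z: "(\<kappa> z)-lipschitz_on {0..1} (\<gamma> z)" "\<gamma> z ` {0..1} \<subseteq> C" "\<gamma> z 0 = fst z" "\<gamma> z 1 = snd z"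
    "\<kappa> z \<le> dist (fst z) (snd z) + e" "P z \<in> sets borel" "P z \<subseteq> C" "emeasure \<mu> (P z) = 0"
    "{t \<in> {0..1}. \<gamma> z t \<notin> P z} \<subseteq> {0, 1}" "finite {t \<in> {0..1}. \<phi> (\<gamma> z t) = c}" if "z \<in> I" for z
    using good[OF that] unfolding good_def by - (elim conjE, assumption)+
  define T where "T z = (\<lambda>f p. a z * curve_integral (\<gamma> z) f p)" for z
  define \<nu> where "\<nu> z = scale_measure (ennreal (\<bar>a z\<bar> * \<kappa> z)) (curve_measure C (\<gamma> z))" for z
  have \<kappa>0: "0 \<le> \<kappa> z" if "z \<in> I" for z using z(1)[OF that] lipschitz_on_nonneg by blast
  have av: "avoiding (T z) (\<nu> z) (P z)" if i: "z \<in> I" for z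
    unfolding avoiding_def
  proof (intro conjI ballI impI)
    show "current_with C (T z) (\<nu> z)"
      unfolding T_def \<nu>_def by (rule current_with_curve_integral[OF z(1,2)[OF i]])
    show "P z \<in> sets borel" "P z \<subseteq> C" "emeasure \<mu> (P z) = 0" using z(6-8)[OF i] .
    have CP: "C - P z \<in> sets (restrict_space borel C)"
      using z(6)[OF i] unfolding sets_restrict_space by (auto intro!: image_eqI[of _ _ "- P z"])
    have "{t \<in> {0..1}. \<gamma> z t \<in> C - P z} \<subseteq> {0, 1}" using z(9)[OF i] by blast
    then have "finite {t \<in> {0..1}. \<gamma> z t \<in> C - P z}" by (rule finite_subset) simp
    then show "emeasure (\<nu> z) (C - P z) = 0"
      using emeasure_curve_measure_finite_null[OF z(1,2)[OF i] CP] by (simp add: \<nu>_def)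
    fix B assume B: "B \<in> sets borel" "B \<subseteq> {x \<in> C. \<phi> x = c}"
    have "B \<in> sets (restrict_space borel C)" using B by (auto simp: sets_restrict_space)
    moreover have "finite {t \<in> {0..1}. \<gamma> z t \<in> B}"
      by (rule finite_subset[OF _ z(10)[OF i]]) (use B in auto)
    ultimately show "emeasure (\<nu> z) B = 0"
      using emeasure_curve_measure_finite_null[OF z(1,2)[OF i]] by (simp add: \<nu>_def)
  qed
  have \<nu>C: "emeasure (\<nu> z) C = ennreal (\<bar>a z\<bar> * \<kappa> z)" if "z \<in> I" for z
    using emeasure_curve_measure_X[OF z(1,2)[OF that]] by (simp add: \<nu>_def)
  have totC: "(\<integral>\<^sup>+z. emeasure (\<nu> z) C \<partial>count_space I) \<le> ennreal (M + \<eta>)"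
  proof -
    have "(\<integral>\<^sup>+z. emeasure (\<nu> z) C \<partial>count_space I) = (\<Sum>z\<in>I. ennreal (\<bar>a z\<bar> * \<kappa> z))"
      using I(1) \<nu>C by (simp add: nn_integral_count_space_finite)
    also have "\<dots> = ennreal (\<Sum>z\<in>I. \<bar>a z\<bar> * \<kappa> z)" using \<kappa>0 by (intro sum_ennreal) simp
    also have "(\<Sum>z\<in>I. \<bar>a z\<bar> * \<kappa> z) \<le> (\<Sum>z\<in>I. \<bar>a z\<bar> * (dist (fst z) (snd z) + e))"
      by (intro sum_mono mult_left_mono z(5)) auto
    also have "\<dots> = (\<Sum>z\<in>I. \<bar>a z\<bar> * dist (fst z) (snd z)) + e * (\<Sum>z\<in>I. \<bar>a z\<bar>)"
      by (simp add: distrib_left sum.distrib sum_distrib_left mult.commute)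
    also have "\<dots> \<le> M + \<eta>" by (intro add_mono cost eS)
    finally show ?thesis by (simp add: ennreal_leI)
  qed
  then have tot: "(\<integral>\<^sup>+z. emeasure (\<nu> z) C \<partial>count_space I) < \<infinity>" by (rule le_less_trans) simp
  define R where "R = (\<lambda>f p. \<integral>z. T z f p \<partial>count_space I)"
  define \<rho> where "\<rho> = sum_measure (restrict_space borel C) I \<nu>"
  have avR: "avoiding R \<rho> (\<Union>z\<in>I. P z)"
    unfolding R_def \<rho>_def by (rule avoiding_sum[OF countable_finite[OF I(1)] av tot])
  then have curR: "current_with C R \<rho>" by (simp add: avoiding_def)
  have R1: "R (\<lambda>_. 1) p = (\<Sum>z\<in>I. a z * (p (snd z) - p (fst z)))" for p
    unfolding R_def T_def curve_integral_boundary lebesgue_integral_count_space_finite[OF I(1)]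
    by (intro sum.cong refl) (simp add: z(3,4))
  show ?thesis
  proof (rule that[OF avR])
    have "C \<in> sets (restrict_space borel C)" by (auto simp: sets_restrict_space)
    moreover have "\<And>z. z \<in> I \<Longrightarrow> finite_Borel_measure C (\<nu> z)"
      using av by (auto simp: avoiding_def intro: current_with_finite)
    ultimately have "emeasure \<rho> C = (\<integral>\<^sup>+z. emeasure (\<nu> z) C \<partial>count_space I)"
      unfolding \<rho>_def by (intro emeasure_sum_Borel[OF _ tot])
    then show "emeasure \<rho> C \<le> ennreal (M + \<eta>)" using totC by simp
    show "Lip_linear C (\<lambda>p. L p - R (\<lambda>_. 1) p)"
      unfolding Lip_linear_def
    proof (intro ballI allI)
      fix p q :: "'a \<Rightarrow> real" and s t assume pq: "p \<in> Lip C" "q \<in> Lip C"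
      have "L (\<lambda>x. s * p x + t * q x) = s * L p + t * L q" using lin pq unfolding Lip_linear_def by blast
      moreover have "R (\<lambda>_. 1) (\<lambda>x. s * p x + t * q x) = s * R (\<lambda>_. 1) p + t * R (\<lambda>_. 1) q"
        by (rule current_with_lin_right[OF curR Lip\<^sub>b_const pq])
      ultimately show "L (\<lambda>x. s * p x + t * q x) - R (\<lambda>_. 1) (\<lambda>x. s * p x + t * q x) =
        s * (L p - R (\<lambda>_. 1) p) + t * (L q - R (\<lambda>_. 1) q)" by (simp add: algebra_simps)
    qed
    show "finitely_determined C (\<lambda>p. L p - R (\<lambda>_. 1) p)"
      unfolding finitely_determined_def
    proof (intro allI impI)
      fix \<eta>' :: real assume "0 < \<eta>'"
      from det[unfolded finitely_determined_def, THEN spec, THEN mp, OF this]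
      obtain F where F: "finite F" "F \<subseteq> C"
        "\<forall>p l. l-lipschitz_on C p \<longrightarrow> (\<forall>x\<in>F. p x = 0) \<longrightarrow> \<bar>L p\<bar> \<le> \<eta>' * l" by (elim exE conjE)
      \<comment> \<open>With the end points of the curves added, the boundary of \<open>R\<close>
        vanishes on the test functions and the residual agrees with \<open>L\<close> there.\<close>
      let ?F = "F \<union> fst ` I \<union> snd ` I"
      have "\<bar>L p - R (\<lambda>_. 1) p\<bar> \<le> \<eta>' * l" if p: "l-lipschitz_on C p" "\<forall>x\<in>?F. p x = 0" for p l
      proof -
        have "R (\<lambda>_. 1) p = 0" unfolding R1 using p(2) by (intro sum.neutral) auto
        moreover have "\<bar>L p\<bar> \<le> \<eta>' * l"
          by (rule F(3)[THEN spec, THEN spec, THEN mp, THEN mp, OF p(1)]) (use p(2) in blast)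
        ultimately show ?thesis by simp
      qed
      moreover have "finite ?F" "?F \<subseteq> C" using F(1,2) I by auto
      ultimately show "\<exists>F. finite F \<and> F \<subseteq> C \<and> (\<forall>p l. l-lipschitz_on C p \<longrightarrow> (\<forall>x\<in>F. p x = 0) \<longrightarrow> \<bar>L p - R (\<lambda>_. 1) p\<bar> \<le> \<eta>' * l)"
        by (intro exI[of _ ?F] conjI allI impI)
    qed
    show "\<bar>L p - R (\<lambda>_. 1) p\<bar> \<le> \<eta> * l" if "l-lipschitz_on C p" for l p
      unfolding R1 by (rule approx[OF that])
  qed
qed

text \<open>The residuals of successive rounds have norms \<open>b n\<close> tending to 0, so the
  boundaries telescope to \<open>L\<close>; the masses are summable, so the rounds sum up to a
  current.\<close>

lemma filling_pos:
  assumes lin: "Lip_linear C L" and bound: "\<And>l p. l-lipschitz_on C p \<Longrightarrow> \<bar>L p\<bar> \<le> M * l"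
    and M: "0 < M" and det: "finitely_determined C L" and \<epsilon>: "0 < \<epsilon>"
  obtains R \<rho> P where "avoiding R \<rho> P" "emeasure \<rho> C \<le> ennreal ((1 + \<epsilon>) * M)"
    "\<And>p. p \<in> Lip C \<Longrightarrow> R (\<lambda>_. 1) p = L p"
proof -
  \<comment> \<open>The sum of \<eta> is M\<epsilon>/2. It is paid twice, as the excess of each
    round and as the norm left to the next one, which together with the initial norm M gives (1 +
    \<epsilon>)M. Positivity of M makes every \<open>\<eta> n\<close> positive.\<close>
  define \<eta> where "\<eta> n = M * \<epsilon> * (1/2)^(n + 2)" for n :: nat
  define b where "b n = (case n of 0 \<Rightarrow> M | Suc k \<Rightarrow> \<eta> k)" for n
  have \<eta>0: "0 < \<eta> n" for n using M \<epsilon> by (simp add: \<eta>_def)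
  have b0: "0 \<le> b n" for n
    using M \<eta>0[of "n - 1"] by (cases n) (simp_all add: b_def)
  define St where "St n L \<longleftrightarrow> Lip_linear C L \<and> finitely_determined C L \<and>
    (\<forall>l p. l-lipschitz_on C p \<longrightarrow> \<bar>L p\<bar> \<le> b n * l)" for n L
  define Tr where "Tr n L L' \<longleftrightarrow> (\<exists>R \<rho> P. avoiding R \<rho> P \<and> emeasure \<rho> C \<le> ennreal (b n + \<eta> n) \<and>
    L' = (\<lambda>p. L p - R (\<lambda>_. 1) p))" for n L L'
  have "\<exists>F. F 0 = L \<and> (\<forall>n. St n (F n) \<and> Tr n (F n) (F (Suc n)))"
  proof -
    have step: "\<exists>L'. St (Suc n) L' \<and> Tr n L L'" if "St n L" for n L
    proof -
      have l: "Lip_linear C L" and d: "finitely_determined C L" and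
        bd: "\<And>l p. l-lipschitz_on C p \<Longrightarrow> \<bar>L p\<bar> \<le> b n * l" using that unfolding St_def by simp_all
      show ?thesis
      proof (rule stage[OF l bd b0 d \<eta>0])
        fix R \<rho> P
        assume R: "avoiding R \<rho> P" "emeasure \<rho> C \<le> ennreal (b n + \<eta> n)"
          "Lip_linear C (\<lambda>p. L p - R (\<lambda>_. 1) p)" "finitely_determined C (\<lambda>p. L p - R (\<lambda>_. 1) p)"
          "\<And>l p. l-lipschitz_on C p \<Longrightarrow> \<bar>L p - R (\<lambda>_. 1) p\<bar> \<le> \<eta> n * l"
        show ?thesis
        proof (intro exI conjI)
          show "St (Suc n) (\<lambda>p. L p - R (\<lambda>_. 1) p)" using R(3-5) by (simp add: St_def b_def)
          show "Tr n L (\<lambda>p. L p - R (\<lambda>_. 1) p)" unfolding Tr_def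
            by (intro exI conjI) (rule R(1), rule R(2), rule refl)
        qed
      qed
    qed
    have "St 0 L" using lin det bound by (simp add: St_def b_def)
    \<comment> \<open>The clause for n = 0 pins the start of the chosen sequence to
      \<open>L\<close>.\<close>
    have "\<exists>F. \<forall>n. (St n (F n) \<and> (n = 0 \<longrightarrow> F n = L)) \<and> Tr n (F n) (F (Suc n))"
    proof (rule dependent_nat_choice[where P = "\<lambda>n x. St n x \<and> (n = 0 \<longrightarrow> x = L)" and Q = Tr])
      show "\<exists>x. St 0 x \<and> (0 = (0::nat) \<longrightarrow> x = L)" using \<open>St 0 L\<close> by blast
      fix x n assume "St n x \<and> (n = 0 \<longrightarrow> x = L)"
      then obtain y where "St (Suc n) y" "Tr n x y" using step by blast
      then show "\<exists>y. (St (Suc n) y \<and> (Suc n = 0 \<longrightarrow> y = L)) \<and> Tr n x y"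
        by (intro exI[of _ y]) simp
    qed
    then obtain F where "\<forall>n. (St n (F n) \<and> (n = 0 \<longrightarrow> F n = L)) \<and> Tr n (F n) (F (Suc n))" ..
    then show ?thesis by (intro exI[of _ F]) simp
  qed
  then obtain F where F: "F 0 = L" "\<And>n. St n (F n)" "\<And>n. Tr n (F n) (F (Suc n))" by blast
  have "\<forall>n. \<exists>q. avoiding (fst q) (fst (snd q)) (snd (snd q)) \<and> emeasure (fst (snd q)) C \<le> ennreal (b n + \<eta> n) \<and>
    F (Suc n) = (\<lambda>p. F n p - fst q (\<lambda>_. 1) p)"
  proof
    fix n
    obtain R \<rho> P where "avoiding R \<rho> P" "emeasure \<rho> C \<le> ennreal (b n + \<eta> n)" "F (Suc n) = (\<lambda>p. F n p - R (\<lambda>_. 1) p)"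
      using F(3)[of n] unfolding Tr_def by (elim exE conjE)
    then show "\<exists>q. avoiding (fst q) (fst (snd q)) (snd (snd q)) \<and> emeasure (fst (snd q)) C \<le> ennreal (b n + \<eta> n) \<and>
      F (Suc n) = (\<lambda>p. F n p - fst q (\<lambda>_. 1) p)" by (intro exI[of _ "(R, \<rho>, P)"]) simp
  qed
  then obtain q where q: "\<forall>n. avoiding (fst (q n)) (fst (snd (q n))) (snd (snd (q n))) \<and>
    emeasure (fst (snd (q n))) C \<le> ennreal (b n + \<eta> n) \<and> F (Suc n) = (\<lambda>p. F n p - fst (q n) (\<lambda>_. 1) p)"
    by (rule choice[THEN exE])
  define R \<rho> P where "R n = fst (q n)" and "\<rho> n = fst (snd (q n))" and "P n = snd (snd (q n))" for n
  have R: "avoiding (R n) (\<rho> n) (P n)" "emeasure (\<rho> n) C \<le> ennreal (b n + \<eta> n)"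
    "F (Suc n) = (\<lambda>p. F n p - R n (\<lambda>_. 1) p)" for n
    using spec[OF q, of n] unfolding R_def \<rho>_def P_def by - (elim conjE, assumption)+
  have \<eta>sums: "\<eta> sums (M * \<epsilon> / 2)"
  proof -
    have "(\<lambda>n. M * \<epsilon> * (1/4) * (1/2)^n) sums (M * \<epsilon> * (1/4) * (1 / (1 - 1/2)))"
      by (intro sums_mult geometric_sums) simp
    moreover have "\<eta> = (\<lambda>n. M * \<epsilon> * (1/4) * (1/2)^n)" by (rule ext) (simp add: \<eta>_def power_add power2_eq_square)
    ultimately show ?thesis by simp
  qed
  have "(\<lambda>n. b (Suc n)) sums (M * \<epsilon> / 2)" using \<eta>sums by (simp add: b_def)
  then have bs: "b sums (M * \<epsilon> / 2 + b 0)" by (simp only: sums_Suc_iff)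
  from sums_add[OF this \<eta>sums] have "(\<lambda>n. b n + \<eta> n) sums (M * \<epsilon> / 2 + b 0 + M * \<epsilon> / 2)" .
  moreover have "M * \<epsilon> / 2 + b 0 + M * \<epsilon> / 2 = (1 + \<epsilon>) * M" by (simp add: b_def algebra_simps)
  ultimately have bsums: "(\<lambda>n. b n + \<eta> n) sums ((1 + \<epsilon>) * M)" by simp
  have totC: "(\<integral>\<^sup>+n. emeasure (\<rho> n) C \<partial>count_space UNIV) \<le> ennreal ((1 + \<epsilon>) * M)"
  proof -
    have "(\<integral>\<^sup>+n. emeasure (\<rho> n) C \<partial>count_space UNIV) \<le> (\<integral>\<^sup>+n. ennreal (b n + \<eta> n) \<partial>count_space UNIV)"
      by (intro nn_integral_mono R(2))
    also have "\<dots> = (\<Sum>n. ennreal (b n + \<eta> n))" by (rule nn_integral_count_space_nat)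
    also have "\<dots> = ennreal (\<Sum>n. b n + \<eta> n)"
    proof (rule suminf_ennreal2)
      show "0 \<le> b n + \<eta> n" for n using b0[of n] \<eta>0[of n] by linarith
      show "summable (\<lambda>n. b n + \<eta> n)" using bsums by (rule sums_summable)
    qed
    also have "(\<Sum>n. b n + \<eta> n) = (1 + \<epsilon>) * M" using bsums by (rule sums_unique[symmetric])
    finally show ?thesis .
  qed
  then have tot: "(\<integral>\<^sup>+n. emeasure (\<rho> n) C \<partial>count_space UNIV) < \<infinity>" by (rule le_less_trans) simp
  have cur: "\<And>n. current_with C (R n) (\<rho> n)" using R(1) by (simp add: avoiding_def)
  define S where "S = (\<lambda>f p. \<integral>n. R n f p \<partial>count_space UNIV)"
  have av: "avoiding S (sum_measure (restrict_space borel C) UNIV \<rho>) (\<Union>n. P n)"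
    unfolding S_def by (rule avoiding_sum[where I = UNIV and T = R and \<nu> = \<rho> and P = P]) (simp, rule R(1), rule tot)
  show ?thesis
  proof (rule that[OF av])
    have "C \<in> sets (restrict_space borel C)" by (auto simp: sets_restrict_space)
    then have "emeasure (sum_measure (restrict_space borel C) UNIV \<rho>) C = (\<integral>\<^sup>+n. emeasure (\<rho> n) C \<partial>count_space UNIV)"
      by (rule emeasure_sum_Borel[OF current_with_finite[OF cur] tot])
    then show "emeasure (sum_measure (restrict_space borel C) UNIV \<rho>) C \<le> ennreal ((1 + \<epsilon>) * M)" using totC by (simp only:)
    fix p assume p: "p \<in> Lip C"
    have int: "integrable (count_space UNIV) (\<lambda>n. R n (\<lambda>_. 1) p)"
      by (rule current_sum_integrable[OF cur tot Lip\<^sub>b_const p])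
    have "(\<lambda>n. \<Sum>k<n. R k (\<lambda>_. 1) p) \<longlonglongrightarrow> (\<integral>n. R n (\<lambda>_. 1) p \<partial>count_space UNIV)"
      using sums_integral_count_space_nat[OF int] by (simp only: sums_def)
    moreover have "(\<lambda>n. \<Sum>k<n. R k (\<lambda>_. 1) p) \<longlonglongrightarrow> L p - 0"
    proof -
      \<comment> \<open>Each round subtracts its boundary from the residual, so the sum
        telescopes.\<close>
      have part: "(\<Sum>k<n. R k (\<lambda>_. 1) p) = L p - F n p" for n
        by (induction n) (simp_all add: F(1) R(3))
      have "b \<longlonglongrightarrow> 0" by (rule summable_LIMSEQ_zero[OF sums_summable[OF bs]])
      then have b00: "(\<lambda>n. b n * LIP C p) \<longlonglongrightarrow> 0 * LIP C p" by (intro tendsto_mult tendsto_const)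
      have "(\<lambda>n. F n p) \<longlonglongrightarrow> 0"
      proof (rule Lim_null_comparison[OF always_eventually])
        show "\<forall>n. norm (F n p) \<le> b n * LIP C p"
          using F(2) Lip_lipschitz_on[OF p] unfolding St_def real_norm_def by simp
        show "(\<lambda>n. b n * LIP C p) \<longlonglongrightarrow> 0" using b00 by (simp only: mult_zero_left)
      qed
      then show ?thesis unfolding part by (intro tendsto_diff tendsto_const)
    qed
    ultimately have "(\<integral>n. R n (\<lambda>_. 1) p \<partial>count_space UNIV) = L p - 0" by (rule LIMSEQ_unique)
    then show "S (\<lambda>_. 1) p = L p" by (simp add: S_def)
  qed
qed

text \<open>For M = 0 there are no positive errors proportional to \<open>M\<close>; but then
  \<open>L\<close> vanishes on Lipschitz functions and the zero current fills it.\<close>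

lemma filling:
  assumes lin: "Lip_linear C L" and bound: "\<And>l p. l-lipschitz_on C p \<Longrightarrow> \<bar>L p\<bar> \<le> M * l"
    and M: "0 \<le> M" and det: "finitely_determined C L" and \<epsilon>: "0 < \<epsilon>"
  obtains R \<rho> P where "avoiding R \<rho> P" "emeasure \<rho> C \<le> ennreal ((1 + \<epsilon>) * M)"
    "\<And>p. p \<in> Lip C \<Longrightarrow> R (\<lambda>_. 1) p = L p"
proof (cases "M = 0")
  case False
  then have "0 < M" using M by simp
  show ?thesis by (rule filling_pos[OF lin bound \<open>0 < M\<close> det \<epsilon>]) (assumption, rule that)
next
  case True
  show ?thesis
  proof (rule that)
    have sp: "space (null_measure \<mu>) = C" using finite_Borel_space[OF \<mu>] by simp
    have "finite_Borel_measure C (null_measure \<mu>)"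
      using finite_Borel_sets[OF \<mu>] by (auto simp: finite_Borel_measure_def intro!: finite_measureI)
    then have "current_with C (\<lambda>f p. 0) (null_measure \<mu>)"
      by (intro current_withI)
        (simp_all add: bilinear_on_def current_locality_def current_joint_continuity_def mass_bound_def LIP_nonneg)
    then show "avoiding (\<lambda>f p. 0) (null_measure \<mu>) {}" by (simp add: avoiding_def)
    show "emeasure (null_measure \<mu>) C \<le> ennreal ((1 + \<epsilon>) * M)" by simp
    show "0 = L p" if "p \<in> Lip C" for p using bound[OF Lip_lipschitz_on[OF that]] True by simp
  qed
qed

end

section \<open>Restriction and the main theorem\<close>

text \<open>The two-term case of \<open>current_with_sum\<close>, indexed by bool. Equality of the
  integrals lets an L1 error for the sum be split into errors for the two parts.\<close>

lemma current_with_add: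
  fixes X :: "'a::metric_space set"
  assumes T: "current_with X T \<mu>" and R: "current_with X R \<rho>"
  obtains \<nu> where "current_with X (\<lambda>f p. T f p + R f p) \<nu>"
    "\<And>f. f \<in> bounded_Borel X \<Longrightarrow> (\<integral>x. \<bar>f x\<bar> \<partial>\<nu>) = (\<integral>x. \<bar>f x\<bar> \<partial>\<mu>) + (\<integral>x. \<bar>f x\<bar> \<partial>\<rho>)"
    "measure \<nu> X = measure \<mu> X + measure \<rho> X"
proof -
  define S where "S b = (if b then T else R)" for b
  define m where "m b = (if b then \<mu> else \<rho>)" for b
  have m: "m True = \<mu>" "m False = \<rho>" by (simp_all add: m_def)
  have cur: "current_with X (S b) (m b)" for b using T R by (simp add: S_def m_def)
  note fin = current_with_finite[OF cur]
  have sum2: "(\<integral>\<^sup>+b. g b \<partial>count_space UNIV) = g True + g False" for g :: "bool \<Rightarrow> ennreal"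
    by (simp add: nn_integral_count_space_finite UNIV_bool add.commute)
  have int2: "(\<integral>b. g b \<partial>count_space UNIV) = g True + g False" for g :: "bool \<Rightarrow> real"
    by (simp add: lebesgue_integral_count_space_finite UNIV_bool add.commute)
  have em: "emeasure (m b) X < \<infinity>" for b
    using finite_measure.emeasure_finite[OF finite_Borel_finite_measure[OF fin]] by (simp add: less_top)
  have tot: "(\<integral>\<^sup>+b. emeasure (m b) X \<partial>count_space UNIV) < \<infinity>"
    unfolding sum2 using em[of True] em[of False] by simp
  define \<nu> where "\<nu> = sum_measure (restrict_space borel X) UNIV m"
  have "current_with X (\<lambda>f p. \<integral>b. S b f p \<partial>count_space UNIV) \<nu>"
    unfolding \<nu>_def by (rule current_with_sum_measure[OF cur tot])
  then have 1: "current_with X (\<lambda>f p. T f p + R f p) \<nu>" unfolding int2 by (simp add: S_def)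
  have 2: "(\<integral>x. \<bar>f x\<bar> \<partial>\<nu>) = (\<integral>x. \<bar>f x\<bar> \<partial>\<mu>) + (\<integral>x. \<bar>f x\<bar> \<partial>\<rho>)" if "f \<in> bounded_Borel X" for f
    using has_bochner_integral_integral_eq[OF has_integral_sum_measure[OF fin tot that]]
    unfolding int2 \<nu>_def m by (rule sym)
  have sp: "space \<nu> = X" "space \<mu> = X" "space \<rho> = X"
    using finite_Borel_space current_with_finite 1 T R by blast+
  have one: "(\<lambda>_. 1) \<in> bounded_Borel X" by (rule Lip\<^sub>b_imp_bounded_Borel[OF Lip\<^sub>b_const])
  have "measure \<nu> X = measure \<mu> X + measure \<rho> X" using 2[OF one] by (simp add: sp)
  then show ?thesis using that 1 2 by blast
qed

lemma integral_abs_cong_off_null: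
  fixes f g :: "'a::metric_space \<Rightarrow> real"
  assumes fin: "finite_Borel_measure X \<mu>" and B: "B \<in> sets borel" "emeasure \<mu> (X - B) = 0"
    and fg: "f \<in> borel_measurable (restrict_space borel X)" "g \<in> borel_measurable (restrict_space borel X)"
    and eq: "\<And>x. x \<in> X \<Longrightarrow> x \<in> B \<Longrightarrow> f x = g x"
  shows "(\<integral>x. \<bar>f x\<bar> \<partial>\<mu>) = (\<integral>x. \<bar>g x\<bar> \<partial>\<mu>)"
proof (rule integral_cong_AE)
  show "(\<lambda>x. \<bar>f x\<bar>) \<in> borel_measurable \<mu>" "(\<lambda>x. \<bar>g x\<bar>) \<in> borel_measurable \<mu>"
    using fg unfolding finite_Borel_measurable[OF fin, symmetric] by - (rule borel_measurable_abs, assumption)+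
  have "X - B \<in> sets \<mu>" using finite_Borel_Int[OF fin, of "- B"] B(1) by (simp add: Diff_eq)
  then have "X - B \<in> null_sets \<mu>" using B(2) by (rule null_setsI[rotated])
  then show "AE x in \<mu>. \<bar>f x\<bar> = \<bar>g x\<bar>"
    by (rule AE_I') (use eq finite_Borel_space[OF fin] in auto)
qed

text \<open>Approximating \<open>\<chi>\<^sub>B f\<close> by Lipschitz functions in \<open>L\<^sup>1\<close> of the sum of both measures makes the
  contribution of \<open>R\<close> disappear and leaves that of \<open>T\<close> unchanged.\<close>

lemma restrict_sum_of_singular:
  fixes X :: "'a::metric_space set"
  assumes T: "current_with X T \<mu>" and R: "current_with X R \<rho>"
    and B: "B \<in> sets borel" "emeasure \<mu> (X - B) = 0" "emeasure \<rho> (X \<inter> B) = 0"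
  shows "current_eq X (current_restrict X (\<lambda>f p. T f p + R f p) B) T"
  unfolding current_eq_def
proof (intro ballI)
  fix f p :: "'a \<Rightarrow> real" assume f: "f \<in> Lip\<^sub>b X" and p: "p \<in> Lip X"
  let ?N = "\<lambda>f p. T f p + R f p"
  obtain \<nu> where \<nu>: "current_with X ?N \<nu>"
    "\<And>f. f \<in> bounded_Borel X \<Longrightarrow> (\<integral>x. \<bar>f x\<bar> \<partial>\<nu>) = (\<integral>x. \<bar>f x\<bar> \<partial>\<mu>) + (\<integral>x. \<bar>f x\<bar> \<partial>\<rho>)"
    using current_with_add[OF T R] by blast
  have N: "metric_1_current X ?N" using \<nu>(1) by (simp add: current_with_def)
  define E where "E = Borel_extension X ?N"
  note ext = Borel_extension_props[OF N, folded E_def]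
  define h where "h = (\<lambda>x. indicator B x * f x)"
  have h: "h \<in> bounded_Borel X"
    unfolding h_def by (rule bounded_Borel_indicator_mult[OF B(1) Lip\<^sub>b_imp_bounded_Borel[OF f]])
  have l: "(LIP X p)-lipschitz_on X p" "0 \<le> LIP X p" by (rule Lip_lipschitz_on[OF p], rule LIP_nonneg[OF p])
  have "\<bar>E h p - T f p\<bar> \<le> 0 + e" if e: "0 < e" for e
  proof -
    \<comment> \<open>The three errors estimated below add up to 2 LIP p times the L1 distance in
      \<nu>, as \<nu> integrates like \<mu> plus \<rho>; the 1 covers LIP p = 0.\<close>
    define d where "d = e / (2 * LIP X p + 1)"
    have d: "0 < d" "2 * LIP X p * d \<le> e"
    proof -
      have pos: "0 < 2 * LIP X p + 1" using l(2) by linarith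
      show "0 < d" unfolding d_def by (rule divide_pos_pos[OF e pos])
      then have "2 * LIP X p * d \<le> (2 * LIP X p + 1) * d" by (intro mult_right_mono) simp_all
      also have "\<dots> = e" unfolding d_def using pos by simp
      finally show "2 * LIP X p * d \<le> e" .
    qed
    obtain g where g: "g \<in> Lip\<^sub>b X" "(\<integral>x. \<bar>g x - h x\<bar> \<partial>\<nu>) < d"
      using integrable_approx_Lip[OF current_with_finite[OF \<nu>(1)]
          bounded_Borel_integrable[OF current_with_finite[OF \<nu>(1)] h] d(1)] by blast
    note gB = Lip\<^sub>b_imp_bounded_Borel[OF g(1)]
    note fB = Lip\<^sub>b_imp_bounded_Borel[OF f]
    have gh: "(\<lambda>x. g x - h x) \<in> bounded_Borel X" using bounded_Borel_lin[OF gB h, of 1 "-1"] by simp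
    have gf: "(\<lambda>x. g x - f x) \<in> Lip\<^sub>b X" using Lip\<^sub>b_lin[OF g(1) f, of 1 "-1"] by simp
    have meas: "k \<in> borel_measurable (restrict_space borel X)" if "k \<in> bounded_Borel X" for k
      using that by (simp add: bounded_Borel_def)
    have "E (\<lambda>x. 1 * g x + (- 1) * h x) p = 1 * E g p + (- 1) * E h p"
      using ext(1) gB h p unfolding bilinear_on_def by blast
    then have Egh: "E (\<lambda>x. g x - h x) p = ?N g p - E h p" using ext(2)[OF g(1) p] by simp
    have "\<bar>E (\<lambda>x. g x - h x) p\<bar> \<le> LIP X p * (\<integral>x. \<bar>g x - h x\<bar> \<partial>mass_measure X ?N)"
      using ext(3) gh p unfolding mass_bound_def by blast
    also have "\<dots> \<le> LIP X p * (\<integral>x. \<bar>g x - h x\<bar> \<partial>\<nu>)"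
      by (intro mult_left_mono mass_measure_mono(1)[OF \<nu>(1) gh] l(2))
    finally have 1: "\<bar>?N g p - E h p\<bar> \<le> LIP X p * (\<integral>x. \<bar>g x - h x\<bar> \<partial>\<nu>)" unfolding Egh .
    have "\<bar>T (\<lambda>x. g x - f x) p\<bar> \<le> LIP X p * (\<integral>x. \<bar>g x - f x\<bar> \<partial>\<mu>)" by (rule current_with_bound[OF T gf l(1)])
    \<comment> \<open>f and h agree on \<open>B\<close>, off which \<mu> is null; in the same way h
      vanishes off \<open>B\<close>, while \<rho> is null on it.\<close>
    also have "(\<integral>x. \<bar>g x - f x\<bar> \<partial>\<mu>) = (\<integral>x. \<bar>g x - h x\<bar> \<partial>\<mu>)"
      by (rule integral_abs_cong_off_null[OF current_with_finite[OF T] B(1,2) meas[OF Lip\<^sub>b_imp_bounded_Borel[OF gf]] meas[OF gh]])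
        (simp add: h_def)
    finally have 2: "\<bar>T g p - T f p\<bar> \<le> LIP X p * (\<integral>x. \<bar>g x - h x\<bar> \<partial>\<mu>)"
      unfolding current_with_diff_left[OF T g(1) f p] .
    have "\<bar>R g p\<bar> \<le> LIP X p * (\<integral>x. \<bar>g x\<bar> \<partial>\<rho>)" by (rule current_with_bound[OF R g(1) l(1)])
    also have "(\<integral>x. \<bar>g x\<bar> \<partial>\<rho>) = (\<integral>x. \<bar>g x - h x\<bar> \<partial>\<rho>)"
    proof (rule integral_abs_cong_off_null[OF current_with_finite[OF R] _ _ meas[OF gB] meas[OF gh]])
      show "- B \<in> sets borel" using B(1) by (rule borel_comp)
      show "emeasure \<rho> (X - - B) = 0" using B(3) by (simp add: Diff_eq)
    qed (simp add: h_def)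
    finally have 3: "\<bar>R g p\<bar> \<le> LIP X p * (\<integral>x. \<bar>g x - h x\<bar> \<partial>\<rho>)" .
    have "\<bar>E h p - T f p\<bar> \<le> \<bar>?N g p - E h p\<bar> + \<bar>T g p - T f p\<bar> + \<bar>R g p\<bar>" by linarith
    also have "\<dots> \<le> LIP X p * (\<integral>x. \<bar>g x - h x\<bar> \<partial>\<nu>) + LIP X p * (\<integral>x. \<bar>g x - h x\<bar> \<partial>\<mu>) + LIP X p * (\<integral>x. \<bar>g x - h x\<bar> \<partial>\<rho>)"
      by (intro add_mono 1 2 3)
    also have "\<dots> = 2 * LIP X p * (\<integral>x. \<bar>g x - h x\<bar> \<partial>\<nu>)" using \<nu>(2)[OF gh] by (simp add: algebra_simps)
    also have "\<dots> \<le> 2 * LIP X p * d" using g(2) l(2) by (intro mult_left_mono) simp_all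
    finally show ?thesis using d(2) by linarith
  qed
  then have "\<bar>E h p - T f p\<bar> \<le> 0" by (rule field_le_epsilon)
  then show "current_restrict X ?N B f p = T f p"
    by (simp add: current_restrict_def E_def h_def)
qed

section \<open>Consequences of inner regularity\<close>

context
  fixes X :: "'a::metric_space set" and \<mu> :: "'a measure"
  assumes fin: "finite_Borel_measure X \<mu>" and reg: "inner_regular_by_compacts \<mu>"
begin

lemma inner_regular_tight:
  assumes X: "X \<in> sets borel" and \<eta>: "0 < \<eta>"
  shows "\<exists>K. compact K \<and> K \<subseteq> X \<and> measure \<mu> (X - K) < \<eta>"
proof -
  interpret finite_measure \<mu> by (rule finite_Borel_finite_measure[OF fin])
  have sp: "space \<mu> = X" by (rule finite_Borel_space[OF fin])
  have XM: "X \<in> sets \<mu>" using sets.top[of \<mu>] sp by simp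
  show ?thesis
  \<comment> \<open>If the total mass is below \<eta>, the empty set suffices; otherwise the
    difference of the two is nonnegative and survives the passage to \<open>ennreal\<close>.\<close>
  proof (cases "measure \<mu> X < \<eta>")
    case True
    then show ?thesis by (intro exI[of _ "{}"]) simp
  next
    case False
    then have m: "0 \<le> measure \<mu> X - \<eta>" "measure \<mu> X - \<eta> < measure \<mu> X" using \<eta> by linarith+
    then have "ennreal (measure \<mu> X - \<eta>) < emeasure \<mu> X" by (simp add: emeasure_eq_measure ennreal_less_iff)
    also have "emeasure \<mu> X = (SUP K\<in>{K. K \<subseteq> X \<and> compact K}. emeasure \<mu> K)"
      using reg XM unfolding inner_regular_by_compacts_def by blast
    finally obtain K where K: "K \<subseteq> X" "compact K" "ennreal (measure \<mu> X - \<eta>) < emeasure \<mu> K"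
      unfolding less_SUP_iff by blast
    have KM: "K \<in> sets \<mu>" using finite_Borel_Int[OF fin borel_compact[OF K(2)]] K(1) by (simp add: Int_absorb1)
    have "measure \<mu> X - \<eta> < measure \<mu> K" using K(3) m(1) by (simp add: emeasure_eq_measure ennreal_less_iff)
    moreover have "measure \<mu> (X - K) = measure \<mu> X - measure \<mu> K"
      by (rule finite_measure_Diff[OF XM KM K(1)])
    ultimately show ?thesis using K(1,2) by (intro exI[of _ K]) simp
  qed
qed

text \<open>A compact subset of \<open>A\<close> is covered by finitely many null open sets, and
  inner regularity carries nullity over to \<open>A\<close>. In a nonseparable space the cover of
  \<open>A\<close> itself may have no countable subcover.\<close>

lemma inner_regular_null:
  assumes A: "A \<in> sets \<mu>" and loc: "\<And>x. x \<in> A \<Longrightarrow> \<exists>V. open V \<and> x \<in> V \<and> emeasure \<mu> (X \<inter> V) = 0"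
  shows "emeasure \<mu> A = 0"
proof -
  have "emeasure \<mu> K = 0" if K: "K \<subseteq> A" "compact K" for K
  proof -
    have "\<forall>x\<in>A. \<exists>V. open V \<and> x \<in> V \<and> emeasure \<mu> (X \<inter> V) = 0" using loc by blast
    then obtain V where V: "\<forall>x\<in>A. open (V x) \<and> x \<in> V x \<and> emeasure \<mu> (X \<inter> V x) = 0" by (rule bchoice[THEN exE])
    obtain F where F: "F \<subseteq> K" "finite F" "K \<subseteq> (\<Union>x\<in>F. V x)"
    proof (rule compactE_image[OF K(2), of K V])
      show "open (V x)" if "x \<in> K" for x using V K(1) that by blast
      show "K \<subseteq> (\<Union>x\<in>K. V x)" using V K(1) by blast
    qed
    have AX: "A \<subseteq> X" using sets.sets_into_space[OF A] finite_Borel_space[OF fin] by simp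
    have null: "X \<inter> V x \<in> null_sets \<mu>" if "x \<in> F" for x
    proof (rule null_setsI)
      have x: "x \<in> A" using that F(1) K(1) by blast
      show "emeasure \<mu> (X \<inter> V x) = 0" using V x by blast
      show "X \<inter> V x \<in> sets \<mu>" using V x by (intro finite_Borel_Int[OF fin] borel_open) blast
    qed
    have "(\<Union>x\<in>F. X \<inter> V x) \<in> null_sets \<mu>" using null F(2) by (intro null_sets_UN' countable_finite)
    moreover have "K \<subseteq> (\<Union>x\<in>F. X \<inter> V x)" using F(3) K(1) AX by blast
    moreover have "K \<in> sets \<mu>"
    proof -
      have "X \<inter> K = K" using K(1) AX by blast
      then show ?thesis using finite_Borel_Int[OF fin borel_compact[OF K(2)]] by simp
    qed
    ultimately show ?thesis using null_sets_subset null_setsD1 by blast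
  qed
  moreover have "emeasure \<mu> A = (SUP K\<in>{K. K \<subseteq> A \<and> compact K}. emeasure \<mu> K)"
    using reg A unfolding inner_regular_by_compacts_def by blast
  ultimately have "emeasure \<mu> A \<le> 0" by (simp only:) (rule SUP_least, simp)
  then show ?thesis by simp
qed

end

text \<open>The complement of the support is a union of possibly uncountably many null open sets, to
  which \<open>inner_regular_null\<close> applies. This is what admits the support itself as
  \<open>B\<close>.\<close>

lemma current_supp_carries:
  fixes X :: "'a::metric_space set"
  assumes X: "closed X" and T: "metric_1_current X T" and reg: "inner_regular_by_compacts (mass_measure X T)"
  shows "current_supp X T \<in> sets borel" and "emeasure (mass_measure X T) (X - current_supp X T) = 0"
proof -
  let ?\<mu> = "mass_measure X T" and ?S = "current_supp X T"
  note fin = current_with_finite[OF current_with_mass_measure[OF T]]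
  define \<V> where "\<V> = {V. open V \<and> emeasure ?\<mu> (X \<inter> V) = 0}"
  have S: "?S = X - \<Union>\<V>"
  proof (rule set_eqI)
    fix x
    have "x \<in> ?S \<longleftrightarrow> x \<in> X \<and> (\<forall>V. open V \<longrightarrow> x \<in> X \<inter> V \<longrightarrow> 0 < emeasure ?\<mu> (X \<inter> V))"
      unfolding current_supp_def openin_open by blast
    also have "\<dots> \<longleftrightarrow> x \<in> X - \<Union>\<V>" by (auto simp: \<V>_def zero_less_iff_neq_zero)
    finally show "x \<in> ?S \<longleftrightarrow> x \<in> X - \<Union>\<V>" .
  qed
  have op: "open (\<Union>\<V>)" by (rule open_Union) (simp add: \<V>_def)
  then show "?S \<in> sets borel" unfolding S using X by (intro sets.Diff borel_closed borel_open)
  show "emeasure ?\<mu> (X - ?S) = 0"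
  proof (rule inner_regular_null[OF fin reg])
    have "X - ?S = X \<inter> \<Union>\<V>" unfolding S by blast
    then show "X - ?S \<in> sets ?\<mu>" using finite_Borel_Int[OF fin borel_open[OF op]] by simp
    fix x assume "x \<in> X - ?S"
    then have "x \<in> \<Union>\<V>" unfolding S by blast
    then show "\<exists>V. open V \<and> x \<in> V \<and> emeasure ?\<mu> (X \<inter> V) = 0" by (auto simp: \<V>_def)
  qed
qed

text \<open>Serves both claims: the general one takes \<open>B\<close> to be \<open>C\<close> minus
  \<open>P\<close>, and the last conclusion admits every Borel set on the hyperplane that carries
  \<open>T\<close>. Linearity of \<phi> suffices, since it is affine along the legs of the
  curves.\<close>

lemma exists_filling:
  fixes C :: "'a::real_normed_vector set" and T :: "'a functional" and \<phi> :: "'a \<Rightarrow> real"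
  assumes dim: "\<exists>S::'a set. independent S \<and> card S > 1"
    and C: "closed C" "convex C" "0 \<in> interior C" and T: "metric_1_current C T"
    and reg: "inner_regular_by_compacts (mass_measure C T)" and eps: "0 < \<epsilon>"
    and \<phi>: "linear \<phi>" "\<phi> v \<noteq> 0"
  obtains N P where "P \<in> sets borel" "normal_1_current C N" "\<forall>f\<in>Lip\<^sub>b C. boundary N f = 0"
    "mass C N \<le> (2 + \<epsilon>) * mass C T" "current_eq C (current_restrict C N (C - P)) T"
    "\<And>B. B \<in> sets borel \<Longrightarrow> B \<subseteq> {x \<in> C. \<phi> x = c} \<Longrightarrow> emeasure (mass_measure C T) (C - B) = 0 \<Longrightarrow>
      current_eq C (current_restrict C N B) T"
proof -
  define \<mu> where "\<mu> = mass_measure C T"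
  have cur: "current_with C T \<mu>" unfolding \<mu>_def by (rule current_with_mass_measure[OF T])
  note fin = current_with_finite[OF cur]
  interpret finite_measure \<mu> by (rule finite_Borel_finite_measure[OF fin])
  have sp: "space \<mu> = C" by (rule finite_Borel_space[OF fin])
  define M where "M = measure \<mu> C"
  have M: "0 \<le> M" "mass C T = M" by (simp_all add: M_def mass_def \<mu>_def)
  obtain r where r: "0 < r" "cball 0 r \<subseteq> C" using C(3) by (auto simp: mem_interior_cball)
  have Cne: "C \<noteq> {}" using C(3) interior_subset by blast
  have CB: "C \<in> sets borel" using C(1) by (rule borel_closed)
  \<comment> \<open>The sign makes the filling cancel the boundary of \<open>T\<close>.\<close>
  define L where "L p = - T (\<lambda>_. 1) p" for p
  have lin: "Lip_linear C L" unfolding Lip_linear_def L_def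
    by (simp add: current_with_lin_right[OF cur Lip\<^sub>b_const])
  have bound: "\<bar>L p\<bar> \<le> M * l" if "l-lipschitz_on C p" for l p
    using current_with_bound[OF cur Lip\<^sub>b_const[of 1] that] by (simp add: L_def M_def sp mult.commute)
  have tight: "\<And>\<eta>. 0 < \<eta> \<Longrightarrow> \<exists>K. compact K \<and> K \<subseteq> C \<and> measure \<mu> (C - K) < \<eta>"
    by (rule inner_regular_tight[OF fin reg[folded \<mu>_def] CB])
  have det: "finitely_determined C L"
    unfolding L_def by (rule finitely_determined_uminus[OF boundary_finitely_determined[OF cur tight Cne]])
  obtain R \<rho> P where av: "avoiding C \<phi> \<mu> c R \<rho> P" and \<rho>C: "emeasure \<rho> C \<le> ennreal ((1 + \<epsilon>) * M)"
    and R1: "\<And>p. p \<in> Lip C \<Longrightarrow> R (\<lambda>_. 1) p = L p"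
    using filling[OF dim C(2) r fin \<phi> lin bound M(1) det eps, of c] by blast
  have curR: "current_with C R \<rho>" and P: "P \<in> sets borel" "P \<subseteq> C" "emeasure \<mu> P = 0" "emeasure \<rho> (C - P) = 0"
    and H: "\<And>B. B \<in> sets borel \<Longrightarrow> B \<subseteq> {x \<in> C. \<phi> x = c} \<Longrightarrow> emeasure \<rho> B = 0"
    using av by (simp_all add: avoiding_def[OF dim C(2) r fin \<phi>])
  let ?N = "\<lambda>f p. T f p + R f p"
  obtain \<nu> where \<nu>: "current_with C ?N \<nu>" "measure \<nu> C = measure \<mu> C + measure \<rho> C"
    using current_with_add[OF cur curR] by blast
  have bd: "\<forall>f\<in>Lip\<^sub>b C. boundary ?N f = 0"
    using R1[OF Lip\<^sub>b_imp_Lip] by (simp add: boundary_def L_def)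
  show ?thesis
  proof (rule that[OF P(1)])
    show "normal_1_current C ?N"
      unfolding normal_1_current_def
    \<comment> \<open>The boundary vanishes, so any finite Borel measure bounds it; \<mu> is at
      hand.\<close>
    proof (intro conjI exI[of _ \<mu>] ballI)
      show "metric_1_current C ?N" using \<nu>(1) by (simp add: current_with_def)
      show "finite_Borel_measure C \<mu>" by (rule fin)
      show "\<bar>boundary ?N f\<bar> \<le> (\<integral>x. \<bar>f x\<bar> \<partial>\<mu>)" if "f \<in> Lip\<^sub>b C" for f
        using bd that by simp
    qed
    show "\<forall>f\<in>Lip\<^sub>b C. boundary ?N f = 0" by (rule bd)
    have "measure \<rho> C \<le> (1 + \<epsilon>) * M"
    proof -
      interpret rho: finite_measure \<rho> by (rule finite_Borel_finite_measure[OF current_with_finite[OF curR]])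
      have "0 \<le> (1 + \<epsilon>) * M" using eps M(1) by simp
      then show ?thesis using \<rho>C by (simp add: rho.emeasure_eq_measure)
    qed
    moreover have "mass C ?N \<le> measure \<nu> C"
      by (rule mass_measure_mono(2)[OF \<nu>(1) Lip\<^sub>b_imp_bounded_Borel[OF Lip\<^sub>b_const[of 0]]])
    ultimately have "mass C ?N \<le> M + (1 + \<epsilon>) * M" using \<nu>(2) by (simp add: M_def)
    also have "\<dots> = (2 + \<epsilon>) * M" by (simp add: algebra_simps)
    finally show "mass C ?N \<le> (2 + \<epsilon>) * mass C T" unfolding M(2) .
    show "current_eq C (current_restrict C ?N (C - P)) T"
    proof (rule restrict_sum_of_singular[OF cur curR])
      show "C - P \<in> sets borel" using CB P(1) by (rule sets.Diff)
      have "C - (C - P) = P" using P(2) by blast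
      then show "emeasure \<mu> (C - (C - P)) = 0" using P(3) by simp
      have "C \<inter> (C - P) = C - P" by blast
      then show "emeasure \<rho> (C \<inter> (C - P)) = 0" using P(4) by simp
    qed
    fix B assume B: "B \<in> sets borel" "B \<subseteq> {x \<in> C. \<phi> x = c}" "emeasure (mass_measure C T) (C - B) = 0"
    show "current_eq C (current_restrict C ?N B) T"
    proof (rule restrict_sum_of_singular[OF cur curR B(1)])
      show "emeasure \<mu> (C - B) = 0" using B(3) by (simp add: \<mu>_def)
      have "C \<inter> B = B" using B(2) by blast
      then show "emeasure \<rho> (C \<inter> B) = 0" using H[OF B(1,2)] by simp
    qed
  qed
qed

theorem theorem5p1:
  fixes C :: "'a::banach set" and T :: "'a functional" and \<epsilon> :: real
  assumes dim: "\<exists>S::'a set. independent S \<and> card S > 1"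
    and C: "closed C" "convex C" "bounded C" "0 \<in> interior C"
    and T: "metric_1_current C T"
    and reg: "inner_regular_by_compacts (mass_measure C T)"
    and eps: "\<epsilon> > 0"
  shows "(\<exists>N. \<exists>B\<in>sets borel. normal_1_current C N \<and>
            (\<forall>f\<in>Lip\<^sub>b C. boundary N f = 0) \<and>
            mass C N \<le> (2 + \<epsilon>) * mass C T \<and>
            current_eq C (current_restrict C N B) T) \<and>
         ((\<exists>H. affine_hyperplane H \<and> current_supp C T \<subseteq> H) \<longrightarrow>
          (\<exists>N. \<exists>B\<in>sets borel. B = current_supp C T \<and> normal_1_current C N \<and>
            (\<forall>f\<in>Lip\<^sub>b C. boundary N f = 0) \<and>
            mass C N \<le> (2 + \<epsilon>) * mass C T \<and>
            current_eq C (current_restrict C N B) T))"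
proof (intro conjI impI)
  obtain S :: "'a set" where S: "independent S" "card S > 1" using dim by blast
  then obtain v where v: "v \<in> S" by (metis card.empty equals0I not_one_less_zero)
  \<comment> \<open>The general claim involves no hyperplane, so any nonzero linear functional can
    be handed to \<open>exists_filling\<close>; extending the constant 1 from an independent set
    provides one.\<close>
  obtain \<phi> :: "'a \<Rightarrow> real" where \<phi>: "linear \<phi>" "\<phi> v = 1"
    using linear_independent_extend[OF S(1), of "\<lambda>_. 1 :: real"] v by blast
  have \<phi>v: "\<phi> v \<noteq> 0" using \<phi>(2) by simp
  show "\<exists>N. \<exists>B\<in>sets borel. normal_1_current C N \<and> (\<forall>f\<in>Lip\<^sub>b C. boundary N f = 0) \<and>
    mass C N \<le> (2 + \<epsilon>) * mass C T \<and> current_eq C (current_restrict C N B) T"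
  proof (rule exists_filling[OF dim C(1,2,4) T reg eps \<phi>(1) \<phi>v, of 0])
    fix N P
    assume N: "P \<in> sets borel" "normal_1_current C N" "\<forall>f\<in>Lip\<^sub>b C. boundary N f = 0"
      "mass C N \<le> (2 + \<epsilon>) * mass C T" "current_eq C (current_restrict C N (C - P)) T"
    show ?thesis
    proof (intro exI bexI conjI)
      show "C - P \<in> sets borel" by (rule sets.Diff[OF borel_closed[OF C(1)] N(1)])
    qed (rule N)+
  qed
next
  assume "\<exists>H. affine_hyperplane H \<and> current_supp C T \<subseteq> H"
  then obtain \<phi> :: "'a \<Rightarrow> real" and c where \<phi>: "bounded_linear \<phi>" "\<phi> \<noteq> (\<lambda>_. 0)" and sub: "current_supp C T \<subseteq> {x. \<phi> x = c}"
    unfolding affine_hyperplane_def by blast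
  obtain v where v: "\<phi> v \<noteq> 0" using \<phi>(2) by blast
  have lin: "linear \<phi>" using \<phi>(1) by (rule bounded_linear.linear)
  have sC: "current_supp C T \<subseteq> {x \<in> C. \<phi> x = c}" using sub by (auto simp: current_supp_def)
  note supp = current_supp_carries[OF C(1) T reg]
  show "\<exists>N. \<exists>B\<in>sets borel. B = current_supp C T \<and> normal_1_current C N \<and> (\<forall>f\<in>Lip\<^sub>b C. boundary N f = 0) \<and>
    mass C N \<le> (2 + \<epsilon>) * mass C T \<and> current_eq C (current_restrict C N B) T"
  proof (rule exists_filling[OF dim C(1,2,4) T reg eps lin v, of c])
    fix N P
    assume N: "normal_1_current C N" "\<forall>f\<in>Lip\<^sub>b C. boundary N f = 0" "mass C N \<le> (2 + \<epsilon>) * mass C T"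
      and B: "\<And>B. B \<in> sets borel \<Longrightarrow> B \<subseteq> {x \<in> C. \<phi> x = c} \<Longrightarrow> emeasure (mass_measure C T) (C - B) = 0 \<Longrightarrow>
        current_eq C (current_restrict C N B) T"
    show ?thesis
    proof (intro exI bexI conjI)
      show "current_eq C (current_restrict C N (current_supp C T)) T" by (rule B[OF supp(1) sC supp(2)])
    qed (rule N supp(1) refl)+
  qed
qed

end
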